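(* Let $n\ge 2$ and $1<p<n$. For every $u\in W^{1,p}_0(\mathbb R^{n+1}_+)$, \[ \int_{\mathbb R^{n+1}_+}|D_\Theta u|^p\,dx\;\geq\;\left(\frac{n-p}{p}\right)^p\int_{\mathbb R^{n+1}_+}|u|^p\,\frac{\zeta^p(x)}{|x|^p}\,dx , \] and the constant $\left(\frac{n-p}{p}\right)^p$ is sharp (it cannot be replaced by a larger constant).
   Context: $\mathbb R^{n+1}_+=\{x\in\mathbb R^{n+1}: x_{n+1}>0\}$, $|x|$ is the Euclidean norm in $\mathbb R^{n+1}$, and $D_\Theta u(x)$ denotes the orthogonal projection of the gradient $Du(x)$ onto the tangent space of the sphere $\partial B(0,|x|)$ at $x$. On the unit sphere $\mathbb S^n\subset\mathbb R^{n+1}$, let $N=(0,\dots,0,1)$ and for $y\in\mathbb S^n$ let $\theta\in[0,\pi]$ be defined by $y_{n+1}=\cos\theta$; let $\mathcal B(\alpha)=\{y\in\mathbb S^n:0\le\theta<\alpha\}$. Define $\widetilde\eta_{\pi/2}:(0,\pi/2)\to\mathbb R$ by $\widetilde\eta_{\pi/2}(t)=(\sin t)^{-\frac{n-1}{p-1}}\big/\int_t^{\pi/2}(\sin s)^{-\frac{n-1}{p-1}}\,ds$. There is a unique $\widetilde T\in(0,\pi/2)$ such that $\widetilde\eta_{\pi/2}$ is strictly decreasing on $(0,\widetilde T)$ and strictly increasing on $(\widetilde T,\pi/2)$; let $\widetilde\eta_{\pi/2,T}(t)=\widetilde\eta_{\pi/2}(t)$ for $t\in(0,\widetilde T)$ and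 $=\widetilde\eta_{\pi/2}(\widetilde T)$ for $t\in[\widetilde T,\pi/2)$. Define $\rho_{\pi/2}:\mathbb S^n\setminus\{N\}\to\mathbb R$ by $\rho_{\pi/2}(y)=\frac{p-1}{n-p}\widetilde\eta_{\pi/2,T}(\theta)$ for $y\in\mathcal B(\pi/2)\setminus\{N\}$ and $\rho_{\pi/2}(y)=\frac{p-1}{n-p}\widetilde\eta_{\pi/2,T}(\widetilde T)$ otherwise. Finally, for $x\in\mathbb R^{n+1}_+$ not on the $x_{n+1}$-axis, $\zeta(x)=\rho_{\pi/2}(x/|x|)$. *)

theory Defs
  imports "HOL-Analysis.Analysis"
begin

text \<open>Ambient space R^(n+1) is real^'n with CARD('n) = n+1; the coordinate k plays the
 role of x_(n+1).  Upper half space, polar angle, and the functions of the paper.\<close>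

definition half_space :: "'n::finite \<Rightarrow> (real^'n) set" where
  "half_space k = {x. x $ k > 0}"

definition eta_t :: "nat \<Rightarrow> real \<Rightarrow> real \<Rightarrow> real" where
  "eta_t n p t = (sin t) powr (- (real n - 1) / (p - 1)) /
      integral {t..pi/2} (\<lambda>s. (sin s) powr (- (real n - 1) / (p - 1)))"

definition T_tilde :: "nat \<Rightarrow> real \<Rightarrow> real" where
  "T_tilde n p = (THE T. 0 < T \<and> T < pi/2 \<and>
      strict_antimono_on {0<..T} (eta_t n p) \<and> strict_mono_on {T..<pi/2} (eta_t n p))"

definition eta_tT :: "nat \<Rightarrow> real \<Rightarrow> real \<Rightarrow> real" where
  "eta_tT n p t = (if t < T_tilde n p then eta_t n p t else eta_t n p (T_tilde n p))"

definition polar_angle :: "'n::finite \<Rightarrow> real^'n \<Rightarrow> real" where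
  "polar_angle k y = arccos (y $ k)"

definition rho :: "nat \<Rightarrow> real \<Rightarrow> 'n::finite \<Rightarrow> real^'n \<Rightarrow> real" where
  "rho n p k y = (if polar_angle k y < pi/2
      then (p - 1) / (real n - p) * eta_tT n p (polar_angle k y)
      else (p - 1) / (real n - p) * eta_tT n p (T_tilde n p))"

text \<open>zeta(x) = rho(x/|x|); on the x_(n+1)-axis (a null set) it is set to 0.\<close>
definition zeta :: "nat \<Rightarrow> real \<Rightarrow> 'n::finite \<Rightarrow> real^'n \<Rightarrow> real" where
  "zeta n p k x = (if (\<forall>i. i \<noteq> k \<longrightarrow> x $ i = 0) then 0 else rho n p k (x /\<^sub>R norm x))"

definition tangential :: "real^'n::finite \<Rightarrow> real^'n \<Rightarrow> real^'n" where
  "tangential x g = g - (g \<bullet> (x /\<^sub>R norm x)) *\<^sub>R (x /\<^sub>R norm x)"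

definition C1c :: "(real^'n::finite) set \<Rightarrow> (real^'n \<Rightarrow> real) \<Rightarrow> (real^'n \<Rightarrow> real^'n) \<Rightarrow> bool" where
  "C1c \<Omega> \<phi> G \<longleftrightarrow> (\<forall>x. (\<phi> has_derivative (\<lambda>h. G x \<bullet> h)) (at x)) \<and> continuous_on UNIV G \<and>
     compact (closure {x. \<phi> x \<noteq> 0}) \<and> closure {x. \<phi> x \<noteq> 0} \<subseteq> \<Omega>"

text \<open>u belongs to W^{1,p}_0(Omega) with (weak) gradient g: u, g are L^p-limits on Omega
  of C^1_c(Omega) functions and of their gradients.\<close>
definition W1p0 :: "real \<Rightarrow> (real^'n::finite) set \<Rightarrow> (real^'n \<Rightarrow> real) \<Rightarrow> (real^'n \<Rightarrow> real^'n) \<Rightarrow> bool" where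
  "W1p0 p \<Omega> u g \<longleftrightarrow> u \<in> borel_measurable lborel \<and> g \<in> borel_measurable lborel \<and>
     (\<exists>\<phi> G. (\<forall>j::nat. C1c \<Omega> (\<phi> j) (G j)) \<and>
        (\<lambda>j. \<integral>\<^sup>+x\<in>\<Omega>. ennreal (\<bar>\<phi> j x - u x\<bar> powr p) \<partial>lborel) \<longlonglongrightarrow> 0 \<and>
        (\<lambda>j. \<integral>\<^sup>+x\<in>\<Omega>. ennreal (norm (G j x - g x) powr p) \<partial>lborel) \<longlonglongrightarrow> 0)"

end

theory Submission
  imports Defs
begin

text \<open>
  Write \<open>a = (n - 1)/(p - 1)\<close>, \<open>f(\<theta>)\<close> for the integral of \<open>(sin s) powr (- a)\<close> over \<open>[\<theta>, \<pi>/2]\<close>, and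
  \<open>\<eta> = - f'/f\<close>. As a function on the half space, \<open>f(\<theta>)\<close> is \<open>p\<close>-harmonic off the axis and vanishes on the
  boundary, so the tangential field \<open>X = |D f|\<^sup>p\<^sup>-\<^sup>2 D f / f\<^sup>p\<^sup>-\<^sup>1\<close> satisfies \<open>- div X = (p - 1) (\<eta>/|x|)\<^sup>p\<close>.
  Integrating \<open>div (|u|\<^sup>p X)\<close> and using Young's inequality gives Hardy's inequality with the constant
  \<open>((p - 1)/p)\<^sup>p\<close> and the weight \<open>\<eta>/|x|\<close>. A cutoff that is monotone in \<open>\<theta>\<close> removes the singularity at the
  axis and contributes a divergence of the favourable sign. Truncating \<open>\<eta>\<close> beyond its minimum only
  decreases the weight.

  Near the axis the weight \<open>\<zeta>/|x|\<close> is asymptotic to the inverse distance to the axis, whose codimension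
  is \<open>n\<close>; regularised powers of exponent \<open>- (n - p)/p\<close> have logarithmically diverging energy there and show
  that the constant cannot be improved.
\<close>

section \<open>The function eta and its minimum\<close>

text \<open>The exponent \<open>a\<close> is forced by the sphere: \<open>sin t powr (- a)\<close>
  raised to the power \<open>p - 1\<close> is \<open>sin t powr (- (n - 1))\<close>, the reciprocal
  of the volume density of the parallels, so the flux of f is the same through every parallel. As
  \<open>p < n\<close> gives \<open>a > 1\<close>, f behaves like
  \<open>sin t powr (1 - a) / (a - 1)\<close> at the pole and eta like
  \<open>(a - 1) / sin t\<close>. Since \<open>a - 1 = (n - p) / (p - 1)\<close>, the factor in zeta
  normalises it to \<open>1 / sin t\<close>, and the same factor turns \<open>(p - 1) / p\<close>
  into \<open>(n - p) / p\<close>.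

  Everything is expressed in \<open>z = x $ k / norm x\<close>, the cosine of the polar angle, which
  is smooth off the origin; Cartesian integration by parts and boxes then take the place of
  spherical coordinates. Two obstacles remain. The weight is unbounded, so approximation in L^p does
  not carry it to the limit by itself, and it is capped before the limit is taken. And zeta is
  comparable with the inverse distance to the axis only near the axis, so the sharpness argument
  isolates a cone where it loses at most a factor \<open>1 - d\<close>, and lets the energy there
  outgrow the bounded remainder.\<close>

definition sin_tail :: "real \<Rightarrow> real \<Rightarrow> real" where
  "sin_tail a t = integral {t..pi/2} (\<lambda>s. sin s powr (- a))"

lemma continuous_on_sin_powr:
  fixes c u v :: real
  assumes "0 < u" "v < pi"
  shows "continuous_on {u..v} (\<lambda>s. sin s powr c)"
  by (intro continuous_intros) (use assms in \<open>auto simp: sin_gt_zero less_imp_neq[symmetric]\<close>)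

lemma sin_tail_has_derivative:
  assumes "0 < t" "t < pi/2"
  shows "(sin_tail a has_real_derivative - (sin t powr (- a))) (at t)"
proof -
  have "((\<lambda>x. integral {x..pi/2} (\<lambda>s. sin s powr (- a))) has_real_derivative - (sin t powr (- a)))
      (at t within {t/2..pi/2})"
    using assms by (intro integral_has_real_derivative' continuous_on_sin_powr) auto
  moreover have "at t within {t/2..pi/2} = at t"
    using assms by (intro at_within_interior) auto
  ultimately show ?thesis by (simp add: sin_tail_def[abs_def])
qed

lemma sin_tail_pos:
  assumes "0 < t" "t < pi/2" "0 \<le> a"
  shows "0 < sin_tail a t"
proof -
  have "(pi/2 - t) *\<^sub>R (1::real) = integral {t..pi/2} (\<lambda>s. 1)"
    using assms by simp
  also have "\<dots> \<le> sin_tail a t"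
    unfolding sin_tail_def
  proof (rule integral_le)
    show "(\<lambda>s. sin s powr (- a)) integrable_on {t..pi/2}"
      using assms by (intro integrable_continuous_real continuous_on_sin_powr) auto
    fix s assume s: "s \<in> {t..pi/2}"
    then have "0 < sin s" using assms by (intro sin_gt_zero) auto
    then have "1 powr (-a) \<le> sin s powr (-a)" using assms
      by (intro powr_mono2') auto
    then show "1 \<le> sin s powr (- a)" by simp
  qed (auto intro: integrable_const_ivl)
  finally show ?thesis using assms by simp
qed

lemma eta_t_eq_sin_tail:
  "eta_t n p t = sin t powr (- ((real n - 1)/(p-1))) / sin_tail ((real n - 1)/(p-1)) t"
  by (simp add: eta_t_def sin_tail_def minus_divide_left)

section \<open>Asymptotics of the tail integral at the pole\<close>

lemma sin_powr_at_top:
  fixes a :: real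
  assumes "1 < a"
  shows "LIM t at_right 0. sin t powr (1 - a) :> at_top"
proof -
  have 1: "filterlim sin (at_right 0) (at_right (0::real))"
    unfolding filterlim_at
  proof
    show "eventually (\<lambda>x. sin x \<in> {0<..} \<and> sin x \<noteq> (0::real)) (at_right 0)"
      unfolding eventually_at_right_field
      by (rule exI[of _ pi]) (auto simp: sin_gt_zero less_imp_neq[symmetric])
    show "(sin \<longlongrightarrow> (0::real)) (at_right 0)"
      using isCont_sin[of 0] unfolding isCont_def by (auto intro: filterlim_at_split[THEN iffD1, THEN conjunct2] )
  qed
  have "LIM t at_right 0. sin t powr (a - 1) :> at_right (0::real)"
    unfolding filterlim_at
  proof
    show "\<forall>\<^sub>F x in at_right 0. sin x powr (a - 1) \<in> {0<..} \<and> sin x powr (a - 1) \<noteq> (0::real)"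
      unfolding eventually_at_right_field
      by (rule exI[of _ pi]) (auto simp: sin_gt_zero less_imp_neq[symmetric])
    have "((\<lambda>x. sin x powr (a - 1)) \<longlongrightarrow> 0 powr (a - 1)) (at_right (0::real))"
      using 1 assms unfolding filterlim_at
      by (intro tendsto_powr2) (auto elim: eventually_mono)
    then show "((\<lambda>x. sin x powr (a - 1)) \<longlongrightarrow> 0) (at_right (0::real))" by simp
  qed
  from filterlim_compose[OF filterlim_inverse_at_top_right this]
  have "LIM x at_right 0. inverse (sin x powr (a - 1)) :> at_top" .
  then show ?thesis by (simp add: powr_minus[symmetric])
qed

lemma sin_powr_has_derivative:
  assumes "0 < t" "t < pi/2"
  shows "((\<lambda>t. sin t powr c) has_real_derivative c * sin t powr (c - 1) * cos t) (at t)"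
proof -
  have "0 < sin t" using assms by (intro sin_gt_zero) auto
  then show ?thesis
    by (auto intro!: derivative_eq_intros simp: powr_diff field_simps)
qed

text \<open>L'Hopital's rule against \<open>sin t powr (1 - a)\<close>, which tends to infinity
  because \<open>1 < a\<close>; the quotient of the derivatives is
  \<open>1 / ((a - 1) * cos t)\<close>. The limit is used twice: for the sign of the derivative of
  eta near 0 and for the size of zeta near the axis.\<close>

lemma sin_tail_asymp:
  assumes "1 < a"
  shows "((\<lambda>t. sin_tail a t / sin t powr (1 - a)) \<longlongrightarrow> 1 / (a - 1)) (at_right 0)"
proof (rule lhopital_right_0_at_top[OF sin_powr_at_top[OF assms],
    where f' = "\<lambda>t. - (sin t powr (- a))" and g' = "\<lambda>t. (1 - a) * sin t powr (1 - a - 1) * cos t"])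
  show "\<forall>\<^sub>F t in at_right 0. (1 - a) * sin t powr (1 - a - 1) * cos t \<noteq> 0"
    unfolding eventually_at_right_field
    using assms cos_gt_zero sin_gt_zero by (intro exI[of _ "pi/2"]) (fastforce simp: less_imp_neq[symmetric])
  show "\<forall>\<^sub>F t in at_right 0. (sin_tail a has_real_derivative - (sin t powr - a)) (at t)"
    unfolding eventually_at_right_field
    by (intro exI[of _ "pi/2"]) (auto intro: sin_tail_has_derivative)
  show "\<forall>\<^sub>F t in at_right 0. ((\<lambda>t. sin t powr (1 - a)) has_real_derivative
      (1 - a) * sin t powr (1 - a - 1) * cos t) (at t)"
    unfolding eventually_at_right_field
    by (intro exI[of _ "pi/2"] conjI allI impI sin_powr_has_derivative) auto
  have "((\<lambda>t. 1 / ((a - 1) * cos t)) \<longlongrightarrow> 1 / ((a - 1) * cos 0)) (at_right (0::real))"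
    using assms by (intro tendsto_intros) auto
  then have "((\<lambda>t. 1 / ((a - 1) * cos t)) \<longlongrightarrow> 1 / (a - 1)) (at_right (0::real))" by simp
  then show "((\<lambda>t. - (sin t powr - a) / ((1 - a) * sin t powr (1 - a - 1) * cos t)) \<longlongrightarrow> 1 / (a - 1))
     (at_right 0)"
  proof (rule Lim_transform_eventually)
    show "\<forall>\<^sub>F t in at_right 0. 1 / ((a - 1) * cos t)
      = - (sin t powr - a) / ((1 - a) * sin t powr (1 - a - 1) * cos t)"
      unfolding eventually_at_right_field
    proof (intro exI[of _ "pi/2"] conjI allI impI)
      fix t :: real assume t: "0 < t" "t < pi/2"
      then have "0 < sin t" "0 < cos t" by (auto intro: sin_gt_zero cos_gt_zero)
      then show "1 / ((a - 1) * cos t)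
        = - (sin t powr - a) / ((1 - a) * sin t powr (1 - a - 1) * cos t)"
        using assms by (simp add: divide_simps)
    qed simp
  qed
qed

text \<open>\<open>sin t powr (- a) / sin_tail a t\<close> has a derivative of the same sign as this function, whose own
  derivative \<open>sin t powr (- a) / (a * (cos t)\<^sup>2)\<close> no longer involves the integral.\<close>
definition eta_sign :: "real \<Rightarrow> real \<Rightarrow> real" where
  "eta_sign a t = sin t powr (1 - a) / (a * cos t) - sin_tail a t"

lemma eta_sign_has_derivative:
  assumes "0 < t" "t < pi/2" "0 < a"
  shows "(eta_sign a has_real_derivative sin t powr (- a) / (a * (cos t)\<^sup>2)) (at t)"
proof -
  have pos: "0 < sin t" "0 < cos t" using assms by (auto intro: sin_gt_zero cos_gt_zero)
  define P where "P = sin t powr (- a)"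
  have P: "sin t powr (1 - a) = sin t * P" "sin t powr (1 - a - 1) = P"
    using pos by (simp_all add: P_def powr_diff powr_minus field_simps)
  have "(eta_sign a has_real_derivative
     ((1 - a) * sin t powr (1 - a - 1) * cos t * (a * cos t) - sin t powr (1 - a) * (a * - sin t))
       / ((a * cos t) * (a * cos t)) - (- (sin t powr (- a)))) (at t)"
    unfolding eta_sign_def[abs_def]
    by (rule derivative_eq_intros sin_powr_has_derivative sin_tail_has_derivative refl | use assms pos in force)+
  also have "((1 - a) * sin t powr (1 - a - 1) * cos t * (a * cos t) - sin t powr (1 - a) * (a * - sin t))
       / ((a * cos t) * (a * cos t)) - (- (sin t powr (- a))) = P * ((sin t)\<^sup>2 + (cos t)\<^sup>2) / (a * (cos t)\<^sup>2)"
    unfolding P P_def[symmetric] using pos assms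
    by (simp add: divide_simps power2_eq_square del: sin_cos_squared_add sin_cos_squared_add2 sin_cos_squared_add3)
      (simp add: algebra_simps del: sin_cos_squared_add sin_cos_squared_add2 sin_cos_squared_add3)
  finally show ?thesis by (simp add: P_def)
qed

section \<open>The sign change of the derivative of eta\<close>

lemma eta_sign_strict_mono:
  assumes "0 < a" "0 < t" "t < t'" "t' < pi/2"
  shows "eta_sign a t < eta_sign a t'"
proof (rule DERIV_pos_imp_increasing[OF assms(3)])
  fix x assume x: "t \<le> x" "x \<le> t'"
  then have "0 < sin x" "0 < cos x" using assms by (auto intro: sin_gt_zero cos_gt_zero)
  then show "\<exists>y. (eta_sign a has_real_derivative y) (at x) \<and> 0 < y"
    using x assms
    by (intro exI[of _ "sin x powr (- a) / (a * (cos x)\<^sup>2)"] conjI eta_sign_has_derivative) auto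
qed

text \<open>After division by the positive \<open>sin t powr (1 - a)\<close> the limit at 0 is
  \<open>1 / a - 1 / (a - 1)\<close>, which is negative.\<close>

lemma eta_sign_neg_near_0:
  assumes "1 < a"
  shows "\<exists>t. 0 < t \<and> t < pi/2 \<and> eta_sign a t < 0"
proof -
  have "((\<lambda>t. 1 / (a * cos t) - sin_tail a t / sin t powr (1 - a)) \<longlongrightarrow>
      1 / (a * cos 0) - 1 / (a - 1)) (at_right 0)"
    using assms by (intro tendsto_intros sin_tail_asymp) auto
  moreover have "1 / (a * cos 0) - 1 / (a - 1) < 0"
    using assms by (simp add: frac_less2)
  ultimately have "\<forall>\<^sub>F t in at_right 0. 1 / (a * cos t) - sin_tail a t / sin t powr (1 - a) < 0"
    by (rule order_tendstoD(2))
  then obtain b where b: "0 < b" "\<And>t. 0 < t \<Longrightarrow> t < b \<Longrightarrow>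
      1 / (a * cos t) - sin_tail a t / sin t powr (1 - a) < 0"
    unfolding eventually_at_right_field by auto
  define t where "t = min b (pi/2) / 2"
  have t: "0 < t" "t < b" "t < pi/2" using b by (auto simp: t_def min_def)
  then have "0 < sin t" by (intro sin_gt_zero) auto
  then have S: "0 < sin t powr (1 - a)" by simp
  have "eta_sign a t = sin t powr (1 - a) * (1 / (a * cos t) - sin_tail a t / sin t powr (1 - a))"
    using S by (simp add: eta_sign_def right_diff_distrib)
  also have "\<dots> < 0" using S b(2)[OF t(1,2)] by (simp add: mult_pos_neg)
  finally show ?thesis using t by blast
qed

text \<open>Towards \<open>pi/2\<close> the first term of \<open>eta_sign\<close> blows up like
  \<open>1 / (a * cos t)\<close>, while the integral is at most its value \<open>F\<close> at
  \<open>pi/4\<close>.\<close>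

lemma eta_sign_pos_near_pi_half:
  assumes "1 < a"
  shows "\<exists>t. 0 < t \<and> t < pi/2 \<and> 0 < eta_sign a t"
proof -
  define F where "F = sin_tail a (pi/4)"
  have F: "0 < F" unfolding F_def using assms by (intro sin_tail_pos) auto
  \<comment> \<open>The first bound makes \<open>1 / (a * c)\<close> at least \<open>F + 1\<close>;
    the second keeps \<open>arccos c\<close> positive.\<close>
  define c where "c = min (1 / (a * (F + 1))) (1/2)"
  have c: "0 < c" "c \<le> 1/2" using F assms by (auto simp: c_def)
  define t where "t = max (arccos c) (pi/4)"
  have ac: "0 < arccos c" "arccos c < pi/2"
    using c arccos_less_mono[of 1 c] arccos_less_mono[of c 0] by (auto simp: arccos_0)
  have t: "0 < t" "t < pi/2" "pi/4 \<le> t" using ac pi_gt_zero by (auto simp: t_def)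
  have pos: "0 < sin t" "0 < cos t" using t by (auto intro: sin_gt_zero cos_gt_zero)
  have "cos t \<le> cos (arccos c)" using ac t by (intro cos_monotone_0_pi_le) (auto simp: t_def)
  then have ct: "cos t \<le> c" using c by simp
  have "sin_tail a t \<le> F"
    unfolding F_def
  proof (rule DERIV_nonpos_imp_nonincreasing[OF t(3)])
    fix x assume "pi/4 \<le> x" "x \<le> t"
    then show "\<exists>y. (sin_tail a has_real_derivative y) (at x) \<and> y \<le> 0"
      using t by (intro exI[of _ "- (sin x powr - a)"] conjI sin_tail_has_derivative) auto
  qed
  also have "F < F + 1" by simp
  also have "\<dots> \<le> 1 / (a * c)"
  proof -
    have "a * c \<le> a * (1 / (a * (F + 1)))" using assms by (intro mult_left_mono) (auto simp: c_def)
    then have "a * c \<le> 1 / (F + 1)" using assms by simp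
    then show ?thesis using c F assms by (simp add: field_simps)
  qed
  also have "\<dots> \<le> 1 / (a * cos t)" using ct pos assms by (intro divide_left_mono mult_left_mono) auto
  also have "\<dots> \<le> sin t powr (1 - a) / (a * cos t)"
  proof (intro divide_right_mono)
    have "1 powr (1 - a) \<le> sin t powr (1 - a)" using pos assms by (intro powr_mono2') auto
    then show "1 \<le> sin t powr (1 - a)" by simp
  qed (use pos assms in auto)
  finally show ?thesis using t by (intro exI[of _ t]) (auto simp: eta_sign_def)
qed

lemma eta_sign_root:
  assumes "1 < a"
  obtains T where "0 < T" "T < pi/2" "\<And>t. 0 < t \<Longrightarrow> t < T \<Longrightarrow> eta_sign a t < 0"
    "\<And>t. T < t \<Longrightarrow> t < pi/2 \<Longrightarrow> 0 < eta_sign a t"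
proof -
  obtain t0 where t0: "0 < t0" "t0 < pi/2" "eta_sign a t0 < 0" using eta_sign_neg_near_0[OF assms] by auto
  obtain t1 where t1: "0 < t1" "t1 < pi/2" "0 < eta_sign a t1" using eta_sign_pos_near_pi_half[OF assms] by auto
  have "t0 < t1" using eta_sign_strict_mono[of a t1 t0] t0 t1 assms by (cases t0 t1 rule: linorder_cases) auto
  moreover have "\<forall>x. t0 \<le> x \<and> x \<le> t1 \<longrightarrow> isCont (eta_sign a) x"
    using t0 t1 assms by (auto intro!: DERIV_isCont[OF eta_sign_has_derivative])
  ultimately obtain T where T: "t0 \<le> T" "T \<le> t1" "eta_sign a T = 0"
    using IVT[of "eta_sign a" t0 0 t1] t0 t1 by auto
  show ?thesis
    using T t0 t1 assms eta_sign_strict_mono[of a _ T] eta_sign_strict_mono[of a T] by (intro that[of T]) auto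
qed

lemma eta_quotient_has_derivative:
  assumes "0 < t" "t < pi/2" "0 < a"
  shows "((\<lambda>t. sin t powr (- a) / sin_tail a t) has_real_derivative
    sin t powr (- a) * a * cos t / (sin t * (sin_tail a t)\<^sup>2) * eta_sign a t) (at t)"
proof -
  have pos: "0 < sin t" "0 < cos t" "0 < sin_tail a t"
    using assms by (auto intro: sin_gt_zero cos_gt_zero sin_tail_pos)
  define P where "P = sin t powr (- a)"
  have P: "sin t powr (1 - a) = sin t * P" "sin t powr (- a - 1) = P / sin t"
    using pos by (simp_all add: P_def powr_diff powr_minus field_simps)
  have "((\<lambda>t. sin t powr (- a) / sin_tail a t) has_real_derivative
     ((- a) * sin t powr (- a - 1) * cos t * sin_tail a t - sin t powr (- a) * (- (sin t powr (- a))))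
       / (sin_tail a t * sin_tail a t)) (at t)"
    by (rule derivative_eq_intros sin_powr_has_derivative sin_tail_has_derivative refl | use assms pos in force)+
  also have "((- a) * sin t powr (- a - 1) * cos t * sin_tail a t - sin t powr (- a) * (- (sin t powr (- a))))
       / (sin_tail a t * sin_tail a t)
    = P * a * cos t / (sin t * (sin_tail a t)\<^sup>2) * eta_sign a t"
    unfolding P P_def[symmetric] eta_sign_def using pos assms by (simp add: field_simps power2_eq_square)
  finally show ?thesis by (simp add: P_def)
qed

text \<open>\<open>T_tilde\<close> is a definite description, so nothing can be said about it before
  unique existence is proved. Existence comes from the root of \<open>eta_sign\<close>; for two
  admissible values \<open>T1 < T2\<close>, eta would both decrease and increase from
  \<open>T1\<close> to \<open>T2\<close>.\<close>

lemma T_tilde_props: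
  assumes "1 < p" "p < real n"
  shows "0 < T_tilde n p" "T_tilde n p < pi/2"
    "strict_antimono_on {0<..T_tilde n p} (eta_t n p)" "strict_mono_on {T_tilde n p..<pi/2} (eta_t n p)"
proof -
  let ?Q = "\<lambda>T. 0 < T \<and> T < pi/2 \<and>
      strict_antimono_on {0<..T} (eta_t n p) \<and> strict_mono_on {T..<pi/2} (eta_t n p)"
  define a where "a = (real n - 1) / (p - 1)"
  have a: "1 < a" using assms by (simp add: a_def field_simps)
  have eta: "eta_t n p = (\<lambda>t. sin t powr (- a) / sin_tail a t)"
    by (simp add: fun_eq_iff eta_t_eq_sin_tail a_def)
  obtain T where T: "0 < T" "T < pi/2" "\<And>t. 0 < t \<Longrightarrow> t < T \<Longrightarrow> eta_sign a t < 0"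
    "\<And>t. T < t \<Longrightarrow> t < pi/2 \<Longrightarrow> 0 < eta_sign a t"
    using eta_sign_root[OF a] by blast
  have deriv: "(eta_t n p has_real_derivative
    sin t powr (- a) * a * cos t / (sin t * (sin_tail a t)\<^sup>2) * eta_sign a t) (at t)"
    if "0 < t" "t < pi/2" for t
    unfolding eta using that a by (intro eta_quotient_has_derivative) auto
  have cont: "continuous_on {u..v} (eta_t n p)" if "0 < u" "v < pi/2" for u v
    using that by (intro DERIV_atLeastAtMost_imp_continuous_on exI) (rule deriv, auto)
  have cpos: "0 < sin t powr (- a) * a * cos t / (sin t * (sin_tail a t)\<^sup>2)" if "0 < t" "t < pi/2" for t
  proof -
    have "0 < sin t" "0 < cos t" "0 < sin_tail a t"
      using that a by (auto intro: sin_gt_zero cos_gt_zero sin_tail_pos)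
    then show ?thesis using a by simp
  qed
  have QT: "?Q T"
  proof (intro conjI T)
    show "strict_antimono_on {0<..T} (eta_t n p)"
    proof (rule monotone_onI)
      fix x y assume xy: "x \<in> {0<..T}" "y \<in> {0<..T}" "x < y"
      show "eta_t n p y < eta_t n p x"
        using xy(3)
      proof (rule DERIV_neg_imp_decreasing_open)
        show "continuous_on {x..y} (eta_t n p)" using xy T by (intro cont) auto
        fix t assume "x < t" "t < y"
        then have t: "0 < t" "t < T" "t < pi/2" using xy T by auto
        show "\<exists>d. (eta_t n p has_real_derivative d) (at t) \<and> d < 0"
          using deriv[of t] mult_pos_neg[OF cpos T(3)] t by blast
      qed
    qed
    show "strict_mono_on {T..<pi/2} (eta_t n p)"
    proof (rule monotone_onI)
      fix x y assume xy: "x \<in> {T..<pi/2}" "y \<in> {T..<pi/2}" "x < y"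
      show "eta_t n p x < eta_t n p y"
        using xy(3)
      proof (rule DERIV_pos_imp_increasing_open)
        show "continuous_on {x..y} (eta_t n p)" using xy T by (intro cont) auto
        fix t assume "x < t" "t < y"
        then have t: "0 < t" "T < t" "t < pi/2" using xy T by auto
        show "\<exists>d. (eta_t n p has_real_derivative d) (at t) \<and> 0 < d"
          using deriv[of t] mult_pos_pos[OF cpos T(4)] t by blast
      qed
    qed
  qed
  have *: False if "?Q T1" "?Q T2" "T1 < T2" for T1 T2
  proof -
    have "strict_antimono_on {0<..T2} (eta_t n p)" using that by blast
    from monotone_onD[OF this, of T1 T2] have "eta_t n p T2 < eta_t n p T1" using that by simp
    moreover have "strict_mono_on {T1..<pi/2} (eta_t n p)" using that by blast
    from monotone_onD[OF this, of T1 T2] have "eta_t n p T1 < eta_t n p T2" using that by simp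
    ultimately show False by simp
  qed
  have "T' = T" if "?Q T'" for T'
    using QT that *[of T T'] *[of T' T] by (cases T T' rule: linorder_cases) blast+
  with QT have "\<exists>!T. ?Q T" by (rule ex1I[of ?Q T])
  from theI'[OF this] show "0 < T_tilde n p" "T_tilde n p < pi/2"
    "strict_antimono_on {0<..T_tilde n p} (eta_t n p)" "strict_mono_on {T_tilde n p..<pi/2} (eta_t n p)"
    unfolding T_tilde_def by auto
qed

lemma eta_t_pos:
  assumes "1 < p" "p < real n" "0 < t" "t < pi/2"
  shows "0 < eta_t n p t"
proof -
  have "0 < sin t" using assms by (intro sin_gt_zero) auto
  then show ?thesis
    unfolding eta_t_eq_sin_tail using assms by (intro divide_pos_pos sin_tail_pos) auto
qed

lemma eta_tT_pos_le:
  assumes "1 < p" "p < real n" "0 < t" "t < pi/2"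
  shows "0 < eta_tT n p t" "eta_tT n p t \<le> eta_t n p t"
proof -
  note T = T_tilde_props[OF assms(1,2)]
  show "0 < eta_tT n p t" using eta_t_pos[OF assms(1,2)] assms T by (auto simp: eta_tT_def)
  show "eta_tT n p t \<le> eta_t n p t"
  proof (cases "T_tilde n p < t")
    case True
    then have "eta_t n p (T_tilde n p) < eta_t n p t"
      using T assms by (intro monotone_onD[OF T(4)]) auto
    then show ?thesis by (simp add: eta_tT_def)
  next
    case False
    then show ?thesis by (cases "t = T_tilde n p") (auto simp: eta_tT_def)
  qed
qed

text \<open>The factor \<open>(p - 1) / (real n - p)\<close> is the reciprocal of
  \<open>a - 1\<close>, and \<open>a - 1\<close> is the limit of \<open>sin t * eta_t n p t\<close>
  at 0. Only angles below \<open>T_tilde\<close> are considered, where the truncation has no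
  effect.\<close>

lemma eta_tT_near_0:
  assumes "1 < p" "p < real n" "0 < d"
  shows "\<exists>t0. 0 < t0 \<and> t0 < pi/2 \<and> (\<forall>t. 0 < t \<and> t < t0 \<longrightarrow>
           (1 - d) / sin t \<le> (p - 1) / (real n - p) * eta_tT n p t)"
proof -
  define a where "a = (real n - 1) / (p - 1)"
  have a: "1 < a" "(p - 1) / (real n - p) = 1 / (a - 1)" using assms by (simp_all add: a_def field_simps)
  note T = T_tilde_props[OF assms(1,2)]
  have "((\<lambda>t. 1 / (a - 1) * inverse (sin_tail a t / sin t powr (1 - a))) \<longlongrightarrow> 1 / (a - 1) * inverse (1 / (a - 1))) (at_right 0)"
    using a by (intro tendsto_intros sin_tail_asymp) auto
  moreover have "1 - d < 1 / (a - 1) * inverse (1 / (a - 1))" using a assms by simp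
  ultimately have "\<forall>\<^sub>F t in at_right 0. 1 - d < 1 / (a - 1) * inverse (sin_tail a t / sin t powr (1 - a))"
    by (rule order_tendstoD(1))
  then obtain b where b: "0 < b" "\<And>t. 0 < t \<Longrightarrow> t < b \<Longrightarrow>
      1 - d < 1 / (a - 1) * inverse (sin_tail a t / sin t powr (1 - a))"
    unfolding eventually_at_right_field by auto
  show ?thesis
  proof (intro exI[of _ "min b (T_tilde n p)"] conjI allI impI)
    fix t assume t: "0 < t \<and> t < min b (T_tilde n p)"
    then have pos: "0 < sin t" using T by (intro sin_gt_zero) auto
    have "sin t powr (1 - a) = sin t * sin t powr (- a)"
      using pos by (simp add: powr_diff powr_minus field_simps)
    then have "1 / (a - 1) * inverse (sin_tail a t / sin t powr (1 - a))
       = sin t * ((p - 1) / (real n - p) * eta_tT n p t)"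
      using t unfolding a by (simp add: eta_tT_def eta_t_eq_sin_tail a_def[symmetric])
    with b(2)[of t] t have "1 - d < sin t * ((p - 1) / (real n - p) * eta_tT n p t)" by auto
    then have "(1 - d) / sin t < (p - 1) / (real n - p) * eta_tT n p t"
      using pos by (simp add: pos_divide_less_eq mult.commute)
    then show "(1 - d) / sin t \<le> (p - 1) / (real n - p) * eta_tT n p t" by simp
  qed (use b T in auto)
qed

section \<open>Integration by parts for compactly supported functions\<close>

text \<open>By translation invariance of Lebesgue measure every difference quotient of
  \<open>f\<close> has integral 0. The bound on the derivative dominates the quotients on a fixed
  ball, so the limit has integral 0 as well.\<close>

lemma integral_directional_derivative_eq_0:
  fixes f :: "'a::euclidean_space \<Rightarrow> real"
  assumes der: "\<And>x. (f has_derivative D x) (at x)"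
    and bnd: "\<And>x h. \<bar>D x h\<bar> \<le> M * norm h"
    and supp: "\<And>x. R < norm x \<Longrightarrow> f x = 0"
  shows "integrable lborel (\<lambda>x. D x e)" "(\<integral>x. D x e \<partial>lborel) = 0"
proof -
  define g where "g j x = (f (x + (1 / real (Suc j)) *\<^sub>R e) - f x) * real (Suc j)" for j x
  \<comment> \<open>The steps \<open>1 / real (Suc j)\<close> are at most 1, so the enlarged ball
    contains the supports of all difference quotients.\<close>
  define w where "w x = indicator (cball 0 (R + norm e)) x *\<^sub>R (M * norm e)" for x :: 'a
  have cont: "continuous_on A f" for A
    using der by (meson continuous_at_imp_continuous_on has_derivative_continuous)
  have meas: "f \<in> borel_measurable lborel"
    using cont[of UNIV] by (simp add: borel_measurable_continuous_onI)
  have intf: "integrable lborel f"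
  proof -
    have "integrable lborel (\<lambda>x. indicator (cball 0 R) x *\<^sub>R f x)"
      by (intro borel_integrable_compact cont compact_cball)
    also have "(\<lambda>x. indicator (cball 0 R) x *\<^sub>R f x) = f"
      using supp by (auto simp: fun_eq_iff indicator_def)
    finally show ?thesis .
  qed
  have trans: "integrable lborel (\<lambda>x. f (x + c))" "(\<integral>x. f (x + c) \<partial>lborel) = (\<integral>x. f x \<partial>lborel)" for c
  proof -
    have "integrable (distr lborel borel ((+) c)) f" using intf by (simp add: lborel_distr_plus)
    then show "integrable lborel (\<lambda>x. f (x + c))"
      using meas by (subst (asm) integrable_distr_eq) (auto simp: add.commute)
    have "(\<integral>x. f x \<partial>lborel) = (\<integral>x. f x \<partial>(distr lborel borel ((+) c)))" by (simp add: lborel_distr_plus)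
    also have "\<dots> = (\<integral>x. f (c + x) \<partial>lborel)" using meas by (intro integral_distr) auto
    finally show "(\<integral>x. f (x + c) \<partial>lborel) = (\<integral>x. f x \<partial>lborel)" by (simp add: add.commute)
  qed
  have g_int: "integrable lborel (g j)" "(\<integral>x. g j x \<partial>lborel) = 0" for j
    unfolding g_def using intf trans by auto
  have g_lim: "(\<lambda>j. g j x) \<longlonglongrightarrow> D x e" for x
  proof -
    have "((\<lambda>t. f (x + t *\<^sub>R e)) has_derivative (\<lambda>t. D x (t *\<^sub>R e))) (at 0)"
      by (rule has_derivative_compose[of "\<lambda>t. x + t *\<^sub>R e" "\<lambda>t. t *\<^sub>R e" 0 UNIV f "D x"])
        (use der[of x] in \<open>auto intro!: derivative_eq_intros\<close>)
    moreover have "(\<lambda>t. D x (t *\<^sub>R e)) = (*) (D x e)"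
      using linear_scale[OF has_derivative_linear[OF der[of x]]] by (auto simp: fun_eq_iff)
    ultimately have "((\<lambda>t. f (x + t *\<^sub>R e)) has_real_derivative D x e) (at 0)"
      by (simp add: has_field_derivative_def)
    then have "((\<lambda>h. (f (x + h *\<^sub>R e) - f x) / h) \<longlongrightarrow> D x e) (at 0)"
      by (simp add: DERIV_def)
    moreover have "filterlim (\<lambda>j. 1 / real (Suc j)) (at 0) sequentially"
      unfolding filterlim_at using LIMSEQ_inverse_real_of_nat by (auto simp: inverse_eq_divide)
    ultimately have "((\<lambda>j. (f (x + (1 / real (Suc j)) *\<^sub>R e) - f x) / (1 / real (Suc j))) \<longlongrightarrow> D x e) sequentially"
      by (rule filterlim_compose)
    then show ?thesis by (simp add: g_def)
  qed
  have g_bnd: "norm (g j x) \<le> w x" for j x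
  proof (cases "x \<in> cball 0 (R + norm e)")
    case True
    have "norm (f (x + (1 / real (Suc j)) *\<^sub>R e) - f x) \<le> M * norm (x + (1 / real (Suc j)) *\<^sub>R e - x)"
      by (rule differentiable_bound[OF convex_UNIV]) (use der bnd in \<open>auto intro: onorm_le\<close>)
    then have "\<bar>f (x + (1 / real (Suc j)) *\<^sub>R e) - f x\<bar> * real (Suc j) \<le> M * norm e / real (Suc j) * real (Suc j)"
      by (intro mult_right_mono) auto
    then show ?thesis using True by (simp add: w_def g_def abs_mult)
  next
    case False
    have "norm x \<le> norm (x + (1 / real (Suc j)) *\<^sub>R e) + norm ((1 / real (Suc j)) *\<^sub>R e)"
      by (metis add_diff_cancel_right' norm_triangle_ineq4)
    moreover have "norm ((1 / real (Suc j)) *\<^sub>R e) \<le> norm e"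
      by (simp add: divide_le_eq mult_le_cancel_left1)
    ultimately have "R < norm (x + (1 / real (Suc j)) *\<^sub>R e)" using False by simp
    moreover have "R < norm x" using False norm_ge_zero[of e] unfolding mem_cball dist_0_norm by linarith
    ultimately show ?thesis using supp False by (simp add: g_def w_def)
  qed
  have D_meas: "(\<lambda>x. D x e) \<in> borel_measurable lborel"
    by (rule borel_measurable_LIMSEQ_real[OF g_lim]) (use g_int in auto)
  have w_int: "integrable lborel w"
    unfolding w_def by (intro borel_integrable_compact compact_cball continuous_intros)
  show "integrable lborel (\<lambda>x. D x e)"
    by (rule integrable_dominated_convergence[OF D_meas _ w_int, where s = g])
      (use g_lim g_bnd g_int in auto)
  have "(\<lambda>j. \<integral>x. g j x \<partial>lborel) \<longlonglongrightarrow> (\<integral>x. D x e \<partial>lborel)"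
    by (rule integral_dominated_convergence[OF D_meas _ w_int])
      (use g_lim g_bnd g_int in auto)
  then show "(\<integral>x. D x e \<partial>lborel) = 0"
    by (simp add: g_int LIMSEQ_const_iff)
qed

lemma open_half_space: "open (half_space k)"
proof -
  have "half_space k = {x. (0::real) < x $ k}" by (simp add: half_space_def)
  also have "open \<dots>" by (intro open_Collect_less continuous_intros)
  finally show ?thesis .
qed

section \<open>Calculus of C1 functions with compact support\<close>

lemma C1c_D:
  assumes "C1c \<Omega> f F"
  shows "(f has_derivative (\<lambda>h. F x \<bullet> h)) (at x)" "continuous_on A F" "continuous_on A f"
    "f \<in> borel_measurable borel" "F \<in> borel_measurable borel"
proof -
  show d: "(f has_derivative (\<lambda>h. F x \<bullet> h)) (at x)" for x using assms by (simp add: C1c_def)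
  show F: "continuous_on A F" for A using assms by (auto simp: C1c_def intro: continuous_on_subset)
  show f: "continuous_on A f" for A
    using d by (meson continuous_at_imp_continuous_on has_derivative_continuous)
  show "f \<in> borel_measurable borel" "F \<in> borel_measurable borel"
    using F[of UNIV] f[of UNIV] by (auto simp: borel_measurable_continuous_onI)
qed

lemma C1c_support:
  assumes "C1c \<Omega> f F"
  obtains K where "compact K" "K \<subseteq> \<Omega>" "\<And>x. x \<notin> K \<Longrightarrow> f x = 0" "\<And>x. x \<notin> K \<Longrightarrow> F x = 0"
proof -
  define K where "K = closure {x. f x \<noteq> 0}"
  have f0: "f x = 0" if "x \<notin> K" for x
    using that closure_subset[of "{x. f x \<noteq> 0}"] unfolding K_def by auto
  have F0: "F x = 0" if x: "x \<notin> K" for x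
  proof -
    have "(f has_derivative (\<lambda>h. 0)) (at x)"
    proof (rule has_derivative_transform_within_open)
      show "((\<lambda>x. 0) has_derivative (\<lambda>h. 0)) (at x)" by simp
      show "open (- K)" unfolding K_def by (intro open_Compl closed_closure)
    qed (use x f0 in auto)
    from has_derivative_unique[OF C1c_D(1)[OF assms] this]
    have "F x \<bullet> F x = 0" by (rule fun_cong)
    then show ?thesis by simp
  qed
  have "compact K" "K \<subseteq> \<Omega>" using assms by (auto simp: C1c_def K_def)
  from that[OF this f0 F0] show ?thesis .
qed

lemma C1c_I:
  assumes "\<And>x. (f has_derivative (\<lambda>h. F x \<bullet> h)) (at x)" "continuous_on UNIV F"
    "compact K" "K \<subseteq> \<Omega>" "\<And>x. x \<notin> K \<Longrightarrow> f x = 0"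
  shows "C1c \<Omega> f F"
proof -
  have "closure {x. f x \<noteq> 0} \<subseteq> K"
    using assms by (intro closure_minimal) (auto simp: compact_imp_closed)
  moreover from this have "compact (closure {x. f x \<noteq> 0})"
    using compact_Int_closed[OF assms(3) closed_closure] by (metis inf.absorb2)
  ultimately show ?thesis using assms by (auto simp: C1c_def)
qed

text \<open>The multiplier has to be C1 on \<open>\<Omega>\<close> only: off the support of
  \<open>\<psi>\<close> the product is identically 0, and \<open>\<Omega>\<close> together with the
  complement of that support covers the whole space. This admits multipliers that are singular at
  the origin, such as powers of the norm.\<close>

lemma C1c_mult:
  assumes \<psi>: "C1c \<Omega> \<psi> \<Psi>" and \<Omega>: "open \<Omega>"
    and m: "\<And>x. x \<in> \<Omega> \<Longrightarrow> (m has_derivative (\<lambda>h. gm x \<bullet> h)) (at x)"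
    and gm: "continuous_on \<Omega> gm"
  shows "C1c \<Omega> (\<lambda>x. \<psi> x * m x) (\<lambda>x. m x *\<^sub>R \<Psi> x + \<psi> x *\<^sub>R gm x)"
proof -
  obtain K where K: "compact K" "K \<subseteq> \<Omega>" "\<And>x. x \<notin> K \<Longrightarrow> \<psi> x = 0" "\<And>x. x \<notin> K \<Longrightarrow> \<Psi> x = 0"
    using C1c_support[OF \<psi>] by blast
  let ?G = "\<lambda>x. m x *\<^sub>R \<Psi> x + \<psi> x *\<^sub>R gm x"
  have cm: "continuous_on \<Omega> m"
    using m by (meson continuous_at_imp_continuous_on has_derivative_continuous)
  show ?thesis
  proof (rule C1c_I[OF _ _ K(1,2)])
    show "((\<lambda>x. \<psi> x * m x) has_derivative (\<lambda>h. ?G x \<bullet> h)) (at x)" for x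
    proof (cases "x \<in> \<Omega>")
      case True
      have "((\<lambda>x. \<psi> x * m x) has_derivative (\<lambda>h. \<psi> x * (gm x \<bullet> h) + (\<Psi> x \<bullet> h) * m x)) (at x)"
        by (rule has_derivative_mult[OF C1c_D(1)[OF \<psi>] m[OF True]])
      then show ?thesis by (simp add: inner_add_left algebra_simps)
    next
      case False
      then have x: "x \<notin> K" using K by auto
      have "((\<lambda>x. \<psi> x * m x) has_derivative (\<lambda>h. 0)) (at x)"
      proof (rule has_derivative_transform_within_open)
        show "((\<lambda>x. 0) has_derivative (\<lambda>h. 0)) (at x)" by simp
        show "open (- K)" using K(1) by (simp add: compact_imp_closed open_Compl)
      qed (use x K in auto)
      then show ?thesis using x K by simp
    qed
    have "continuous_on (\<Omega> \<union> - K) ?G"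
    proof (rule continuous_on_open_Un[OF \<Omega>])
      show "open (- K)" using K(1) by (simp add: compact_imp_closed open_Compl)
      show "continuous_on \<Omega> ?G" by (intro continuous_intros cm gm C1c_D[OF \<psi>])
      have "continuous_on (- K) (\<lambda>x. 0 :: real^'a)" by simp
      then show "continuous_on (- K) ?G" by (rule continuous_on_eq) (use K in auto)
    qed
    moreover have "\<Omega> \<union> - K = UNIV" using K by auto
    ultimately show "continuous_on UNIV ?G" by simp
  qed (use K in auto)
qed

lemma C1c_bounded:
  fixes f :: "real^'n::finite \<Rightarrow> real"
  assumes "C1c \<Omega> f F"
  obtains M R where "0 \<le> R" "0 \<le> M" "\<And>x. \<bar>f x\<bar> \<le> M" "\<And>x. norm (F x) \<le> M" "\<And>x. R < norm x \<Longrightarrow> f x = 0"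
    "\<And>x. R < norm x \<Longrightarrow> F x = 0"
proof -
  obtain K where K: "compact K" "K \<subseteq> \<Omega>" "\<And>x. x \<notin> K \<Longrightarrow> f x = 0" "\<And>x. x \<notin> K \<Longrightarrow> F x = 0"
    using C1c_support[OF assms] by blast
  obtain R where R: "\<forall>x\<in>K. norm x \<le> R"
    using compact_imp_bounded[OF K(1)] by (auto simp: bounded_iff)
  obtain M1 where M1: "\<forall>y\<in>f ` K. norm y \<le> M1"
    using compact_imp_bounded[OF compact_continuous_image[OF C1c_D(3)[OF assms] K(1)]] by (auto simp: bounded_iff)
  obtain M2 where M2: "\<forall>y\<in>F ` K. norm y \<le> M2"
    using compact_imp_bounded[OF compact_continuous_image[OF C1c_D(2)[OF assms] K(1)]] by (auto simp: bounded_iff)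
  show ?thesis
  proof (rule that[of "max 0 R" "max 0 (max M1 M2)"])
    show "\<bar>f x\<bar> \<le> max 0 (max M1 M2)" for x
      using M1 K(3)[of x] by (cases "x \<in> K") (auto simp: le_max_iff_disj)
    show "norm (F x) \<le> max 0 (max M1 M2)" for x
      using M2 K(4)[of x] by (cases "x \<in> K") (auto simp: le_max_iff_disj)
    fix x :: "real^'n" assume "max 0 R < norm x"
    then have "x \<notin> K" using R by fastforce
    then show "f x = 0" "F x = 0" using K by auto
  qed auto
qed

lemma C1c_integral_gradient:
  assumes "C1c \<Omega> f F"
  shows "integrable lborel (\<lambda>x. F x \<bullet> e)" "(\<integral>x. F x \<bullet> e \<partial>lborel) = 0"
proof -
  obtain M R where *: "\<And>x. \<bar>f x\<bar> \<le> M" "\<And>x. norm (F x) \<le> M" "\<And>x. R < norm x \<Longrightarrow> f x = 0"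
    using C1c_bounded[OF assms] by metis
  have "\<bar>F x \<bullet> h\<bar> \<le> M * norm h" for x h
    using Cauchy_Schwarz_ineq2[of "F x" h] mult_right_mono[OF *(2)[of x], of "norm h"] by simp
  then show "integrable lborel (\<lambda>x. F x \<bullet> e)" "(\<integral>x. F x \<bullet> e \<partial>lborel) = 0"
    using integral_directional_derivative_eq_0[of f "\<lambda>x h. F x \<bullet> h" M R e] C1c_D(1)[OF assms] * by auto
qed

text \<open>The integrand is the divergence of the field \<open>f x *\<^sub>R x\<close>, a sum of
  partial derivatives of the functions \<open>f x * x $ i\<close>. It serves the radial part of the
  fields below.\<close>

lemma C1c_integral_euler:
  fixes f :: "real^'n::finite \<Rightarrow> real"
  assumes "C1c \<Omega> f F"
  shows "integrable lborel (\<lambda>x. CARD('n) * f x + F x \<bullet> x)"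
    "(\<integral>x. CARD('n) * f x + F x \<bullet> x \<partial>lborel) = 0"
proof -
  have f: "C1c UNIV f F" using assms by (auto simp: C1c_def)
  have *: "C1c UNIV (\<lambda>x. f x * (x $ i)) (\<lambda>x. (x $ i) *\<^sub>R F x + f x *\<^sub>R axis i 1)" for i
  proof (rule C1c_mult[OF f open_UNIV])
    have "((\<lambda>x. x $ i) has_derivative (\<lambda>h. h $ i)) (at x)" for x :: "real^'n"
      by (rule bounded_linear_imp_has_derivative[OF bounded_linear_vec_nth])
    then show "((\<lambda>x. x $ i) has_derivative (\<lambda>h. axis i 1 \<bullet> h)) (at x)" for x :: "real^'n"
      by (simp add: inner_axis')
  qed (rule continuous_on_const)
  have eq: "CARD('n) * f x + F x \<bullet> x = (\<Sum>i\<in>UNIV. ((x $ i) *\<^sub>R F x + f x *\<^sub>R axis i 1) \<bullet> axis i 1)" for x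
    by (simp add: inner_add_left inner_axis sum.distrib inner_vec_def[of "F x" x] mult.commute inner_axis_axis)
  show "integrable lborel (\<lambda>x. CARD('n) * f x + F x \<bullet> x)"
    unfolding eq by (intro Bochner_Integration.integrable_sum C1c_integral_gradient(1)[OF *])
  show "(\<integral>x. CARD('n) * f x + F x \<bullet> x \<partial>lborel) = 0"
    unfolding eq by (subst Bochner_Integration.integral_sum)
      (use C1c_integral_gradient[OF *] in auto)
qed

section \<open>Functions of the radius and the polar angle\<close>

lemma C1c_eq_0:
  assumes "C1c \<Omega> f F" "x \<notin> \<Omega>"
  shows "f x = 0" "F x = 0"
proof -
  obtain K where K: "compact K" "K \<subseteq> \<Omega>" "\<And>x. x \<notin> K \<Longrightarrow> f x = 0" "\<And>x. x \<notin> K \<Longrightarrow> F x = 0"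
    using C1c_support[OF assms(1)] by blast
  have "x \<notin> K" using assms(2) K(2) by auto
  then show "f x = 0" "F x = 0" by (simp_all add: K)
qed

lemma abs_powr_has_derivative:
  fixes p t :: real
  assumes "1 < p"
  shows "((\<lambda>t. \<bar>t\<bar> powr p) has_real_derivative p * \<bar>t\<bar> powr (p - 1) * sgn t) (at t)"
proof (cases "t = 0")
  case True
  have "((\<lambda>h. \<bar>h\<bar> powr (p - 1)) \<longlongrightarrow> 0 powr (p - 1)) (at (0::real))"
    using assms by (intro tendsto_powr2 tendsto_rabs_zero tendsto_ident_at tendsto_const) auto
  then have "((\<lambda>h. \<bar>h\<bar> powr (p - 1)) \<longlongrightarrow> 0) (at (0::real))" by simp
  then have "((\<lambda>h. \<bar>h\<bar> powr p / h) \<longlongrightarrow> 0) (at (0::real))"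
  proof (rule tendsto_0_le[where K = 1])
    show "\<forall>\<^sub>F h in at (0::real). norm (\<bar>h\<bar> powr p / h) \<le> norm (\<bar>h\<bar> powr (p - 1)) * 1"
      by (auto simp: eventually_at_filter powr_diff)
  qed
  then show ?thesis using True by (simp add: DERIV_def)
next
  case False
  have "(norm has_derivative (\<lambda>h. sgn t * h)) (at t)"
    using has_derivative_norm[OF False] by (simp add: mult.commute)
  moreover have "norm = (abs :: real \<Rightarrow> real)" by (simp add: fun_eq_iff)
  ultimately have *: "(abs has_real_derivative sgn t) (at t)"
    by (simp add: has_field_derivative_def)
  show ?thesis
    using False by (auto intro!: derivative_eq_intros * simp: powr_diff)
qed

lemma continuous_on_abs_powr_sgn:
  fixes p :: real
  assumes "1 < p"
  shows "continuous_on A (\<lambda>t. p * \<bar>t\<bar> powr (p - 1) * sgn t)"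
proof -
  \<comment> \<open>Split into positive and negative parts, the jump of \<open>sgn\<close> at 0
    disappears; both powers are continuous because \<open>p - 1 > 0\<close>.\<close>
  have "continuous_on A (\<lambda>t. p * (max 0 t powr (p - 1) - max 0 (- t) powr (p - 1)))"
    using assms by (intro continuous_intros continuous_on_powr') auto
  also have "(\<lambda>t. p * (max 0 t powr (p - 1) - max 0 (- t) powr (p - 1))) = (\<lambda>t. p * \<bar>t\<bar> powr (p - 1) * sgn t)"
    by (auto simp: fun_eq_iff sgn_if max_def)
  finally show ?thesis .
qed

text \<open>Because \<open>1 < p\<close>, the function \<open>\<bar>t\<bar> powr p\<close> is C1
  even at 0, so the p-th power of a test function may itself be multiplied into a field and
  integrated by parts.\<close>

lemma C1c_abs_powr:
  assumes "C1c \<Omega> \<phi> G" "1 < p"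
  shows "C1c \<Omega> (\<lambda>x. \<bar>\<phi> x\<bar> powr p) (\<lambda>x. (p * \<bar>\<phi> x\<bar> powr (p - 1) * sgn (\<phi> x)) *\<^sub>R G x)"
proof -
  obtain K where K: "compact K" "K \<subseteq> \<Omega>" "\<And>x. x \<notin> K \<Longrightarrow> \<phi> x = 0"
    using C1c_support[OF assms(1)] by metis
  show ?thesis
  proof (rule C1c_I[OF _ _ K(1,2)])
    show "((\<lambda>x. \<bar>\<phi> x\<bar> powr p) has_derivative
        (\<lambda>h. ((p * \<bar>\<phi> x\<bar> powr (p - 1) * sgn (\<phi> x)) *\<^sub>R G x) \<bullet> h)) (at x)" for x
      using has_derivative_compose[OF C1c_D(1)[OF assms(1), of x],
          of "\<lambda>t. \<bar>t\<bar> powr p" "(*) (p * \<bar>\<phi> x\<bar> powr (p - 1) * sgn (\<phi> x))"]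
        abs_powr_has_derivative[OF assms(2), of "\<phi> x"]
      by (simp add: has_field_derivative_def)
    have "continuous_on UNIV (\<lambda>x. p * \<bar>\<phi> x\<bar> powr (p - 1) * sgn (\<phi> x))"
      by (rule continuous_on_compose2[OF continuous_on_abs_powr_sgn[OF assms(2), of UNIV] C1c_D(3)[OF assms(1)]]) auto
    then show "continuous_on UNIV (\<lambda>x. (p * \<bar>\<phi> x\<bar> powr (p - 1) * sgn (\<phi> x)) *\<^sub>R G x)"
      by (rule continuous_on_scaleR[OF _ C1c_D(2)[OF assms(1)]])
  qed (use K in auto)
qed

text \<open>The projection of \<open>axis k 1\<close> onto the tangent space of the sphere through
  \<open>x\<close>, divided by \<open>norm x\<close>. Off the axis it is a multiple of the unit
  vector of increasing polar angle, the only direction in which the Hardy fields and the tangential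
  gradients of the test functions point.\<close>

definition cos_grad :: "'n::finite \<Rightarrow> real^'n \<Rightarrow> real^'n" where
  "cos_grad k x = (1 / norm x) *\<^sub>R (axis k 1 - (x $ k / (norm x)\<^sup>2) *\<^sub>R x)"

lemma cos_has_derivative:
  fixes x :: "real^'n::finite"
  assumes "x \<noteq> 0"
  shows "((\<lambda>x. x $ k / norm x) has_derivative (\<lambda>h. cos_grad k x \<bullet> h)) (at x)"
proof -
  have 1: "((\<lambda>x. x $ k) has_derivative (\<lambda>h. h $ k)) (at x)"
    by (rule bounded_linear_imp_has_derivative[OF bounded_linear_vec_nth])
  have 2: "(norm has_derivative (\<lambda>h. sgn x \<bullet> h)) (at x)"
    using has_derivative_norm[OF assms] by (simp add: inner_commute)
  have "((\<lambda>x. x $ k / norm x) has_derivative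
      (\<lambda>h. (h $ k * norm x - x $ k * (sgn x \<bullet> h)) / (norm x * norm x))) (at x)"
    by (rule has_derivative_divide'[OF 1 2]) (use assms in auto)
  also have "(\<lambda>h. (h $ k * norm x - x $ k * (sgn x \<bullet> h)) / (norm x * norm x)) = (\<lambda>h. cos_grad k x \<bullet> h)"
    using assms by (auto simp: fun_eq_iff cos_grad_def inner_diff_left inner_axis' sgn_div_norm field_simps power2_eq_square)
  finally show ?thesis .
qed

lemma cos_grad_inner_self:
  fixes x :: "real^'n::finite"
  shows "cos_grad k x \<bullet> x = 0"
  by (cases "x = 0") (simp_all add: cos_grad_def inner_diff_left inner_axis' power2_norm_eq_inner)

lemma cos_grad_nth:
  fixes x :: "real^'n::finite"
  shows "x \<noteq> 0 \<Longrightarrow> cos_grad k x $ k = (1 - (x $ k / norm x)\<^sup>2) / norm x"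
  by (simp add: cos_grad_def field_simps power2_eq_square)

lemma cos_abs_le_1:
  fixes x :: "real^'n::finite"
  shows "\<bar>x $ k / norm x\<bar> \<le> 1"
  using component_le_norm_cart[of x k] by (simp add: divide_le_eq_1)

lemma norm_cos_grad:
  fixes x :: "real^'n::finite"
  assumes "x \<noteq> 0"
  shows "norm (cos_grad k x) = sqrt (1 - (x $ k / norm x)\<^sup>2) / norm x"
proof -
  have "(norm (cos_grad k x))\<^sup>2 = cos_grad k x \<bullet> ((1 / norm x) *\<^sub>R (axis k 1 - (x $ k / (norm x)\<^sup>2) *\<^sub>R x))"
    by (simp only: power2_norm_eq_inner cos_grad_def)
  also have "\<dots> = (1 - (x $ k / norm x)\<^sup>2) / (norm x)\<^sup>2"
    using assms by (simp add: inner_diff_right cos_grad_inner_self inner_axis cos_grad_nth power2_eq_square)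
  finally have "norm (cos_grad k x) = sqrt ((1 - (x $ k / norm x)\<^sup>2) / (norm x)\<^sup>2)"
    by (metis norm_ge_zero real_sqrt_abs abs_of_nonneg)
  then show ?thesis by (simp add: real_sqrt_divide)
qed

lemma continuous_on_cos_grad:
  "0 \<notin> A \<Longrightarrow> continuous_on A (cos_grad k)"
  unfolding cos_grad_def[abs_def] by (intro continuous_intros) auto

lemma continuous_on_cos:
  fixes A :: "(real^'n::finite) set"
  shows "0 \<notin> A \<Longrightarrow> continuous_on A (\<lambda>x. x $ k / norm x)"
  by (intro continuous_intros) auto

lemma polar_product_has_derivative:
  fixes x :: "real^'n::finite"
  assumes "x \<noteq> 0"
    and \<alpha>: "(\<alpha> has_real_derivative \<alpha>') (at (norm x))"
    and \<beta>: "(\<beta> has_real_derivative \<beta>') (at (x $ k / norm x))"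
  shows "((\<lambda>x. \<alpha> (norm x) * \<beta> (x $ k / norm x)) has_derivative
    (\<lambda>h. ((\<alpha>' * \<beta> (x $ k / norm x) / norm x) *\<^sub>R x + (\<alpha> (norm x) * \<beta>') *\<^sub>R cos_grad k x) \<bullet> h)) (at x)"
proof -
  have 1: "((\<lambda>x. \<alpha> (norm x)) has_derivative (\<lambda>h. \<alpha>' * (sgn x \<bullet> h))) (at x)"
    using has_derivative_compose[OF has_derivative_norm[OF assms(1)], of \<alpha> "(*) \<alpha>'"] \<alpha>
    by (simp add: has_field_derivative_def inner_commute)
  have 2: "((\<lambda>x. \<beta> (x $ k / norm x)) has_derivative (\<lambda>h. \<beta>' * (cos_grad k x \<bullet> h))) (at x)"
    using has_derivative_compose[OF cos_has_derivative[OF assms(1)], of \<beta> "(*) \<beta>'"] \<beta>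
    by (simp add: has_field_derivative_def)
  have "(\<lambda>h. \<alpha> (norm x) * (\<beta>' * (cos_grad k x \<bullet> h)) + \<alpha>' * (sgn x \<bullet> h) * \<beta> (x $ k / norm x))
    = (\<lambda>h. ((\<alpha>' * \<beta> (x $ k / norm x) / norm x) *\<^sub>R x + (\<alpha> (norm x) * \<beta>') *\<^sub>R cos_grad k x) \<bullet> h)"
    using assms(1) by (auto simp: fun_eq_iff inner_add_left sgn_div_norm field_simps)
  with has_derivative_mult[OF 1 2] show ?thesis by simp
qed

lemma half_space_nonzero: "x \<in> half_space k \<Longrightarrow> x \<noteq> 0" and zero_notin_half_space: "0 \<notin> half_space k"
  by (auto simp: half_space_def)

lemma half_space_cos_pos: "x \<in> half_space k \<Longrightarrow> 0 < x $ k / norm x"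
  using half_space_nonzero[of x k] by (simp add: half_space_def)

text \<open>On the half space \<open>x $ k / norm x\<close> lies in \<open>(0, 1]\<close> and equals
  1 on the axis. Asking for \<open>\<beta>\<close> on all positive reals makes 1 an interior point,
  so the axis needs no separate treatment.\<close>

lemma C1c_mult_polar:
  fixes \<psi> :: "real^'n::finite \<Rightarrow> real"
  assumes \<psi>: "C1c (half_space k) \<psi> \<Psi>"
    and \<beta>: "\<And>z. 0 < z \<Longrightarrow> (\<beta> has_real_derivative \<beta>' z) (at z)" "continuous_on {0<..} \<beta>'"
  shows "C1c (half_space k) (\<lambda>x. \<psi> x * (norm x powr q * \<beta> (x $ k / norm x)))
    (\<lambda>x. (norm x powr q * \<beta> (x $ k / norm x)) *\<^sub>R \<Psi> x + \<psi> x *\<^sub>R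
      ((q * norm x powr (q - 1) * \<beta> (x $ k / norm x) / norm x) *\<^sub>R x
        + (norm x powr q * \<beta>' (x $ k / norm x)) *\<^sub>R cos_grad k x))"
proof (rule C1c_mult[OF \<psi> open_half_space])
  have "continuous_on {0<..} \<beta>"
    using \<beta>(1) by (meson DERIV_isCont continuous_at_imp_continuous_on greaterThan_iff)
  then have 1: "continuous_on (half_space k) (\<lambda>x. \<beta> (x $ k / norm x))"
    by (rule continuous_on_compose2[OF _ continuous_on_cos[OF zero_notin_half_space]])
      (use half_space_cos_pos in auto)
  have 2: "continuous_on (half_space k) (\<lambda>x. \<beta>' (x $ k / norm x))"
    by (rule continuous_on_compose2[OF \<beta>(2) continuous_on_cos[OF zero_notin_half_space]])
      (use half_space_cos_pos in auto)
  show "continuous_on (half_space k) (\<lambda>x. (q * norm x powr (q - 1) * \<beta> (x $ k / norm x) / norm x) *\<^sub>R x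
        + (norm x powr q * \<beta>' (x $ k / norm x)) *\<^sub>R cos_grad k x)"
    by (intro continuous_intros continuous_on_powr 1 2 continuous_on_cos_grad zero_notin_half_space)
      (auto dest: half_space_nonzero)
  fix x assume x: "x \<in> half_space k"
  show "((\<lambda>x. norm x powr q * \<beta> (x $ k / norm x)) has_derivative
    (\<lambda>h. ((q * norm x powr (q - 1) * \<beta> (x $ k / norm x) / norm x) *\<^sub>R x
        + (norm x powr q * \<beta>' (x $ k / norm x)) *\<^sub>R cos_grad k x) \<bullet> h)) (at x)"
    by (rule polar_product_has_derivative[where \<alpha> = "\<lambda>r. r powr q", OF half_space_nonzero[OF x]
          has_real_derivative_powr \<beta>(1)[OF half_space_cos_pos[OF x]]])
      (use half_space_nonzero[OF x] in simp)
qed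

text \<open>The integrand is the divergence of \<open>\<psi> X\<close> for the tangential field
  \<open>X = - b(cos \<theta>) |x|\<^sup>2\<^sup>-\<^sup>p D(cos \<theta>)\<close>.\<close>
lemma polar_field_divergence:
  fixes \<psi> :: "real^'n::finite \<Rightarrow> real" and p :: real
  assumes \<psi>: "C1c (half_space k) \<psi> \<Psi>"
    and b: "\<And>z. 0 < z \<Longrightarrow> (b has_real_derivative b' z) (at z)" "continuous_on {0<..} b'"
  defines "E \<equiv> \<lambda>x. - (b (x $ k / norm x) * norm x powr (2 - p) * (\<Psi> x \<bullet> cos_grad k x))
      + \<psi> x * norm x powr (- p) * ((real CARD('n) - 1) * (x $ k / norm x) * b (x $ k / norm x)
          - (1 - (x $ k / norm x)\<^sup>2) * b' (x $ k / norm x))"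
  shows "integrable lborel E" "(\<integral>x. E x \<partial>lborel) = 0"
proof -
  \<comment> \<open>Splitting \<open>cos_grad\<close> into its multiples of \<open>x\<close> and of
    \<open>axis k 1\<close> writes the field as
    \<open>f1 x *\<^sub>R x - f2 x *\<^sub>R axis k 1\<close>: the first summand falls under the
    Euler identity, the second under a plain directional derivative.\<close>
  define f1 where "f1 x = \<psi> x * (norm x powr (- p) * (b (x $ k / norm x) * (x $ k / norm x)))" for x
  define f2 where "f2 x = \<psi> x * (norm x powr (1 - p) * b (x $ k / norm x))" for x
  define F1 where "F1 x = (norm x powr (- p) * (b (x $ k / norm x) * (x $ k / norm x))) *\<^sub>R \<Psi> x + \<psi> x *\<^sub>R
      (((- p) * norm x powr (- p - 1) * (b (x $ k / norm x) * (x $ k / norm x)) / norm x) *\<^sub>R x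
        + (norm x powr (- p) * (b' (x $ k / norm x) * (x $ k / norm x) + b (x $ k / norm x))) *\<^sub>R cos_grad k x)" for x
  define F2 where "F2 x = (norm x powr (1 - p) * b (x $ k / norm x)) *\<^sub>R \<Psi> x + \<psi> x *\<^sub>R
      (((1 - p) * norm x powr (1 - p - 1) * b (x $ k / norm x) / norm x) *\<^sub>R x
        + (norm x powr (1 - p) * b' (x $ k / norm x)) *\<^sub>R cos_grad k x)" for x
  have bc: "continuous_on {0<..} b"
    using b(1) by (meson DERIV_isCont continuous_at_imp_continuous_on greaterThan_iff)
  have C1: "C1c (half_space k) f1 F1"
    unfolding f1_def[abs_def] F1_def[abs_def]
    by (rule C1c_mult_polar[OF \<psi>, where \<beta> = "\<lambda>z. b z * z" and \<beta>' = "\<lambda>z. b' z * z + b z"])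
      (use b bc in \<open>auto intro!: derivative_eq_intros continuous_intros\<close>)
  have C2: "C1c (half_space k) f2 F2"
    unfolding f2_def[abs_def] F2_def[abs_def] by (rule C1c_mult_polar[OF \<psi> b])
  have E: "E x = (CARD('n) * f1 x + F1 x \<bullet> x) - F2 x \<bullet> axis k 1" for x
  proof (cases "x \<in> half_space k")
    case False
    then have "\<psi> x = 0" "\<Psi> x = 0" by (simp_all add: C1c_eq_0[OF \<psi>])
    then show ?thesis by (simp add: E_def f1_def F1_def F2_def)
  next
    case True
    then have x: "x \<noteq> 0" by (rule half_space_nonzero)
    define r where "r = norm x"
    define z where "z = x $ k / r"
    have r: "0 < r" using x by (simp add: r_def)
    have xk: "x $ k = z * r" using r by (simp add: z_def)
    have xx: "x \<bullet> x = r * r" by (simp add: r_def power2_norm_eq_inner[symmetric] power2_eq_square)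
    define P where "P = r powr (- p)"
    have P: "r powr (- p - 1) = P / r" "r powr (1 - p) = P * r" "r powr (1 - p - 1) = P" "r powr (2 - p) = P * r * r"
      using r by (simp_all add: P_def powr_diff powr_minus powr_numeral field_simps power2_eq_square)
    have cg: "cos_grad k x = (1 / r) *\<^sub>R (axis k 1 - (z / r) *\<^sub>R x)"
      using r by (simp add: cos_grad_def r_def z_def power2_eq_square)
    have cgk: "cos_grad k x $ k = (1 - z\<^sup>2) / r"
      using cos_grad_nth[OF x, of k] by (simp add: r_def z_def)
    have S: "\<Psi> x \<bullet> cos_grad k x = (\<Psi> x \<bullet> axis k 1 - (z / r) * (\<Psi> x \<bullet> x)) / r"
      by (simp add: cg inner_diff_right)
    have F1: "F1 x \<bullet> x = P * (b z * z) * (\<Psi> x \<bullet> x) + \<psi> x * (- p * (P / r) * (b z * z) / r * (r * r))"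
      unfolding F1_def r_def[symmetric] z_def[symmetric] P P_def[symmetric]
      by (simp add: inner_add_left inner_diff_left cos_grad_inner_self xx)
    have F2: "F2 x \<bullet> axis k 1 = P * r * b z * (\<Psi> x \<bullet> axis k 1) +
        \<psi> x * ((1 - p) * P * b z / r * (z * r) + P * r * b' z * ((1 - z\<^sup>2) / r))"
      unfolding F2_def r_def[symmetric] z_def[symmetric] P P_def[symmetric]
      by (simp add: inner_add_left inner_diff_left cgk inner_axis xk)
    have f1: "f1 x = \<psi> x * (P * (b z * z))"
      unfolding f1_def r_def[symmetric] z_def[symmetric] P P_def[symmetric] ..
    show ?thesis
      unfolding F1 F2 f1 E_def r_def[symmetric] z_def[symmetric] P P_def[symmetric] S
      using r by (simp add: field_simps)
  qed
  show "integrable lborel E" "(\<integral>x. E x \<partial>lborel) = 0"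
    unfolding E using C1c_integral_euler[OF C1] C1c_integral_gradient[OF C2] by auto
qed

section \<open>Tangential components and two inequalities for powers\<close>

lemma tangential_inner_cos_grad:
  "tangential x g \<bullet> cos_grad k x = g \<bullet> cos_grad k x"
  by (simp add: tangential_def inner_diff_left inner_commute[of x] cos_grad_inner_self)

lemma norm_tangential_le: "norm (tangential x g) \<le> norm g"
proof (cases "x = 0")
  case False
  define e where "e = x /\<^sub>R norm x"
  have e: "e \<bullet> e = 1" using False by (simp add: e_def power2_norm_eq_inner[symmetric] power2_eq_square)
  have "(norm (tangential x g))\<^sup>2 = (norm g)\<^sup>2 - (g \<bullet> e)\<^sup>2"
    unfolding tangential_def e_def[symmetric] power2_norm_eq_inner
    using e by (simp add: inner_diff_left inner_diff_right inner_commute power2_eq_square)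
  then have "(norm (tangential x g))\<^sup>2 \<le> (norm g)\<^sup>2" by simp
  then show ?thesis by simp
qed (simp add: tangential_def)

lemma tangential_diff: "tangential x (g - h) = tangential x g - tangential x h"
  by (simp add: tangential_def inner_diff_left algebra_simps)

lemma borel_measurable_tangential [measurable]:
  fixes g :: "real^'n::finite \<Rightarrow> real^'n"
  assumes [measurable]: "g \<in> borel_measurable borel"
  shows "(\<lambda>x. tangential x (g x)) \<in> borel_measurable borel"
  unfolding tangential_def by measurable

text \<open>Young's inequality with exponents \<open>p\<close> and \<open>p / (p - 1)\<close>.
  Equality holds at \<open>t = y\<close>, so using it need not spoil the constant.\<close>

lemma youngs_powr:
  fixes p t y :: real
  assumes "1 < p" "0 \<le> t" "0 \<le> y"
  shows "p * (y powr (p - 1) * t) \<le> t powr p + (p - 1) * y powr p"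
proof -
  define q where "q = p / (p - 1)"
  have q: "q > 1" "1/p + 1/q = 1" "1 / q = (p - 1) / p" using assms by (auto simp: q_def field_simps)
  have "t * y powr (p - 1) \<le> t powr p / p + (y powr (p - 1)) powr q / q"
    using assms q by (intro Youngs_inequality) auto
  also have "(y powr (p - 1)) powr q = y powr p"
    using assms by (simp add: powr_powr q_def)
  also have "y powr p / q = (p - 1) / p * y powr p" using q(3) by (simp add: divide_inverse)
  finally show ?thesis using assms by (simp add: field_simps)
qed

text \<open>Convexity of the p-th power, applied to \<open>x + y\<close> as the combination of
  \<open>x / (1 - s)\<close> and \<open>y / s\<close> with weights \<open>1 - s\<close> and
  \<open>s\<close>. As \<open>s\<close> tends to 0 the factor of \<open>x powr p\<close> tends to 1,
  while that of \<open>y powr p\<close> explodes; hence \<open>y\<close> will be an error that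
  vanishes for fixed \<open>s\<close>.\<close>

lemma powr_add_le:
  fixes p s x y :: real
  assumes "1 < p" "0 \<le> x" "0 \<le> y" "0 < s" "s < 1"
  shows "(x + y) powr p \<le> (1 - s) powr (1 - p) * x powr p + s powr (1 - p) * y powr p"
proof -
  have ge1: "1 \<le> c powr (1 - p)" if "0 < c" "c < 1" for c :: real
    using that assms powr_mono2'[of "1 - p" c 1] by simp
  consider "x = 0" | "y = 0" | "0 < x" "0 < y" using assms by linarith
  then show ?thesis
  proof cases
    case 1
    then show ?thesis using ge1[of s] mult_right_mono[OF ge1[of s], of "y powr p"] assms by simp
  next
    case 2
    then show ?thesis using mult_right_mono[OF ge1[of "1 - s"], of "x powr p"] assms by simp
  next
    case 3
    have "((1 - s) *\<^sub>R (x / (1 - s)) + s *\<^sub>R (y / s)) powr p \<le> (1 - s) * (x / (1 - s)) powr p + s * (y / s) powr p"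
      using assms 3 by (intro convex_onD[OF powr_convex[of p]]) auto
    moreover have "(1 - s) *\<^sub>R (x / (1 - s)) + s *\<^sub>R (y / s) = x + y" using assms by simp
    moreover have "c * (v / c) powr p = c powr (1 - p) * v powr p" if "0 < c" "0 < v" for c v :: real
      using that by (simp add: powr_divide powr_diff)
    ultimately show ?thesis using assms 3 by simp
  qed
qed

text \<open>In closed form a C1 cutoff that vanishes for \<open>z \<ge> 1 - e\<close>, that is
  around the axis, does not increase in \<open>z\<close>, and tends to 1 for every
  \<open>z < 1\<close> as \<open>e\<close> tends to 0. It is the increasing function
  \<open>y / (y + e)\<close> of the squared positive part of \<open>1 - e - z\<close>.\<close>

definition axis_cutoff :: "real \<Rightarrow> real \<Rightarrow> real" where
  "axis_cutoff e z = (max 0 (1 - e - z))\<^sup>2 / ((max 0 (1 - e - z))\<^sup>2 + e)"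

text \<open>The squared positive part is the C1 building block of \<open>axis_cutoff\<close>,
  \<open>shell\<close> and \<open>ramp\<close>. Written as
  \<open>(y\<^sup>2 + y * \<bar>y\<bar>) / 2\<close> it leaves only \<open>y * \<bar>y\<bar>\<close>
  to be differentiated at 0.\<close>

lemma max_0_square_has_derivative:
  fixes y :: real
  shows "((\<lambda>y. (max 0 y)\<^sup>2) has_real_derivative 2 * max 0 y) (at y)"
proof -
  have eq: "(max 0 y)\<^sup>2 = (y\<^sup>2 + y * \<bar>y\<bar>) / 2" for y :: real
    by (auto simp: max_def power2_eq_square)
  have "((\<lambda>y. y * \<bar>y\<bar>) has_real_derivative 2 * \<bar>y\<bar>) (at y)"
  proof (cases "y = 0")
    case True
    have "((\<lambda>h. \<bar>h\<bar>) \<longlongrightarrow> 0) (at (0::real))" by (intro tendsto_rabs_zero tendsto_ident_at)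
    then have "((\<lambda>h. (h * \<bar>h\<bar>) / h) \<longlongrightarrow> 0) (at (0::real))"
      by (rule Lim_transform_eventually) (auto simp: eventually_at_filter)
    then show ?thesis using True by (simp add: DERIV_def)
  next
    case False
    have "(norm has_derivative (\<lambda>h. sgn y * h)) (at y)"
      using has_derivative_norm[OF False] by (simp add: mult.commute)
    moreover have "norm = (abs :: real \<Rightarrow> real)" by (simp add: fun_eq_iff)
    ultimately have "(abs has_real_derivative sgn y) (at y)"
      by (simp add: has_field_derivative_def)
    from DERIV_mult[OF DERIV_ident this] show ?thesis
      by (simp add: sgn_if abs_if split: if_splits)
  qed
  from DERIV_cong[OF DERIV_cdivide[OF DERIV_add[OF DERIV_power[OF DERIV_ident, where n = 2] this], of 2], of "2 * max 0 y"]
  show ?thesis unfolding eq by (simp add: max_def)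
qed

lemma axis_cutoff_bounds:
  assumes "0 < e"
  shows "0 \<le> axis_cutoff e z" "axis_cutoff e z \<le> 1" "1 - e \<le> z \<Longrightarrow> axis_cutoff e z = 0"
  using assms by (auto simp: axis_cutoff_def divide_le_eq_1 add_nonneg_pos)

definition axis_cutoff_deriv :: "real \<Rightarrow> real \<Rightarrow> real" where
  "axis_cutoff_deriv e z = - (2 * max 0 (1 - e - z) * e / ((max 0 (1 - e - z))\<^sup>2 + e)\<^sup>2)"

lemma axis_cutoff_has_derivative:
  assumes "0 < e"
  shows "(axis_cutoff e has_real_derivative axis_cutoff_deriv e z) (at z)"
proof -
  let ?y = "\<lambda>z. (max 0 (1 - e - z))\<^sup>2"
  have pos: "0 < ?y z + e" using assms by (simp add: add_nonneg_pos)
  have y: "(?y has_real_derivative 2 * max 0 (1 - e - z) * (- 1)) (at z)"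
    by (rule DERIV_chain2[OF max_0_square_has_derivative]) (auto intro!: derivative_eq_intros)
  have "((\<lambda>z. ?y z / (?y z + e)) has_real_derivative
      (2 * max 0 (1 - e - z) * (- 1) * (?y z + e) - ?y z * (2 * max 0 (1 - e - z) * (- 1) + 0)) / ((?y z + e) * (?y z + e))) (at z)"
    by (intro DERIV_divide DERIV_add y DERIV_const) (use pos in simp)
  also have "(2 * max 0 (1 - e - z) * (- 1) * (?y z + e) - ?y z * (2 * max 0 (1 - e - z) * (- 1) + 0)) / ((?y z + e) * (?y z + e))
    = axis_cutoff_deriv e z"
  proof -
    define m where "m = max 0 (1 - e - z)"
    have "2 * m * (- 1) * (m\<^sup>2 + e) - m\<^sup>2 * (2 * m * (- 1) + 0) = - (2 * m * e)"
      by (simp add: algebra_simps)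
    then show ?thesis unfolding axis_cutoff_deriv_def m_def[symmetric] by (simp add: power2_eq_square)
  qed
  finally show ?thesis by (simp add: axis_cutoff_def[abs_def])
qed

lemma axis_cutoff_deriv_props:
  assumes "0 < e"
  shows "axis_cutoff_deriv e z \<le> 0" "1 - e \<le> z \<Longrightarrow> axis_cutoff_deriv e z = 0"
    "continuous_on A (axis_cutoff_deriv e)"
proof -
  have pos: "0 < (max 0 (1 - e - z))\<^sup>2 + e" for z using assms by (simp add: add_nonneg_pos)
  show "axis_cutoff_deriv e z \<le> 0" "1 - e \<le> z \<Longrightarrow> axis_cutoff_deriv e z = 0"
    using assms by (auto simp: axis_cutoff_deriv_def)
  show "continuous_on A (axis_cutoff_deriv e)"
    unfolding axis_cutoff_deriv_def[abs_def]
    by (intro continuous_intros) (use pos in \<open>simp add: less_imp_neq[symmetric]\<close>)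
qed

text \<open>The double successor keeps the parameter strictly between 0 and 1, as the field
  construction demands; \<open>z < 1\<close> keeps the limit of the denominator away from 0.\<close>

lemma axis_cutoff_tendsto:
  assumes "z < 1"
  shows "(\<lambda>j. axis_cutoff (1 / real (Suc (Suc j))) z) \<longlonglongrightarrow> 1"
proof -
  have e: "(\<lambda>j. 1 / real (Suc (Suc j))) \<longlonglongrightarrow> 0"
    using LIMSEQ_Suc[OF LIMSEQ_inverse_real_of_nat] by (simp add: inverse_eq_divide)
  have "(\<lambda>j. axis_cutoff (1 / real (Suc (Suc j))) z) \<longlonglongrightarrow> (max 0 (1 - 0 - z))\<^sup>2 / ((max 0 (1 - 0 - z))\<^sup>2 + 0)"
    unfolding axis_cutoff_def using assms by (intro tendsto_intros e) auto
  then show ?thesis using assms by simp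
qed

lemma sin_tail_arccos_has_derivative:
  assumes "0 < z" "z < 1"
  shows "((\<lambda>z. sin_tail a (arccos z)) has_real_derivative (1 - z\<^sup>2) powr (- (a + 1) / 2)) (at z)"
proof -
  have arc: "0 < arccos z" "arccos z < pi/2"
    using assms arccos_less_mono[of 1 z] arccos_less_mono[of z 0] by (auto simp: arccos_0)
  have s: "0 < 1 - z\<^sup>2" using assms by (simp add: power_less_one_iff)
  have "((\<lambda>z. sin_tail a (arccos z)) has_real_derivative
      - (sin (arccos z) powr (- a)) * inverse (- sqrt (1 - z\<^sup>2))) (at z)"
    by (rule DERIV_chain2[OF sin_tail_has_derivative[OF arc] DERIV_arccos]) (use assms in auto)
  also have "- (sin (arccos z) powr (- a)) * inverse (- sqrt (1 - z\<^sup>2)) = (1 - z\<^sup>2) powr (- (a + 1) / 2)"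
    using assms s by (simp add: sin_arccos powr_half_sqrt[symmetric] powr_powr powr_minus[symmetric] powr_add[symmetric] field_simps)
  finally show ?thesis .
qed

text \<open>The field of \<open>polar_field_divergence\<close> built from the \<open>p\<close>-harmonic function
  \<open>sin_tail a \<theta>\<close>: up to the cutoff it satisfies the Riccati equation behind Hardy's inequality.\<close>
lemma hardy_field_exists:
  fixes p :: real
  assumes p: "1 < p" "p < real n" and e: "0 < e" "e < 1"
  obtains b b' where
    "\<And>z. 0 < z \<Longrightarrow> (b has_real_derivative b' z) (at z)" "continuous_on {0<..} b'"
    "\<And>z. 0 < z \<Longrightarrow> z \<le> 1 \<Longrightarrow> 0 \<le> b z"
    "\<And>z. 0 < z \<Longrightarrow> z \<le> 1 \<Longrightarrow> b z * sqrt (1 - z\<^sup>2) = axis_cutoff e z * eta_t n p (arccos z) powr (p - 1)"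
    "\<And>z. 0 < z \<Longrightarrow> z \<le> 1 \<Longrightarrow> (p - 1) * axis_cutoff e z * eta_t n p (arccos z) powr p
        \<le> real n * z * b z - (1 - z\<^sup>2) * b' z"
proof -
  define a where "a = (real n - 1) / (p - 1)"
  have a: "1 < a" "a * (p - 1) = real n - 1" using p by (simp_all add: a_def field_simps)
  define w w' f where "w = axis_cutoff e" and "w' = axis_cutoff_deriv e" and "f z = sin_tail a (arccos z)" for z
  note w = axis_cutoff_bounds[OF e(1), folded w_def] and w' = axis_cutoff_deriv_props[OF e(1), folded w'_def]
  \<comment> \<open>As \<open>a * (p - 1) = real n - 1\<close>, the power \<open>p - 1\<close> of
    eta is \<open>(1 - z\<^sup>2) powr ((1 - real n) / 2) * f z powr (1 - p)\<close>. The exponent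
    here is smaller by 1/2, since the length of \<open>cos_grad\<close> contributes another
    \<open>sqrt (1 - z\<^sup>2)\<close>.\<close>
  define B where "B z = w z * ((1 - z\<^sup>2) powr (- real n / 2) * f z powr (1 - p))" for z
  define B' where "B' z = w' z * ((1 - z\<^sup>2) powr (- real n / 2) * f z powr (1 - p))
    + w z * (real n * z * (1 - z\<^sup>2) powr (- real n / 2 - 1) * f z powr (1 - p)
       + (1 - z\<^sup>2) powr (- real n / 2) * ((1 - p) * f z powr (- p) * (1 - z\<^sup>2) powr (- (a + 1) / 2)))" for z
  \<comment> \<open>The cutoff already vanishes on \<open>[1 - e, 1)\<close>, so the extension by 0
    to \<open>z \<ge> 1\<close> is C1 across the axis.\<close>
  define b where "b z = (if z < 1 then B z else 0)" for z
  define b' where "b' z = (if z < 1 then B' z else 0)" for z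
  have fpos: "0 < f z" if "0 < z" "z < 1" for z
    unfolding f_def using that a arccos_less_mono[of 1 z] arccos_less_mono[of z 0]
    by (intro sin_tail_pos) (auto simp: arccos_0)
  have spos: "0 < 1 - z\<^sup>2" if "0 < z" "z < 1" for z :: real using that by (simp add: power_less_one_iff)
  have fd: "(f has_real_derivative (1 - z\<^sup>2) powr (- (a + 1) / 2)) (at z)" if "0 < z" "z < 1" for z
    unfolding f_def[abs_def] using that by (rule sin_tail_arccos_has_derivative)
  have Bd: "(B has_real_derivative B' z) (at z)" if z: "0 < z" "z < 1" for z
  proof -
    have 1: "((\<lambda>z. (1 - z\<^sup>2) powr (- real n / 2)) has_real_derivative real n * z * (1 - z\<^sup>2) powr (- real n / 2 - 1)) (at z)"
    proof -
      have "((\<lambda>z. (1 - z\<^sup>2) powr (- real n / 2)) has_real_derivative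
          (- real n / 2) * (1 - z\<^sup>2) powr (- real n / 2 - 1) * (- (2 * z))) (at z)"
        by (rule DERIV_chain2[where f = "\<lambda>y. y powr (- real n / 2)" and g = "\<lambda>z. 1 - z\<^sup>2", OF has_real_derivative_powr[OF spos[OF z]]]) (auto intro!: derivative_eq_intros)
      then show ?thesis by (simp add: algebra_simps)
    qed
    have 2: "((\<lambda>z. f z powr (1 - p)) has_real_derivative (1 - p) * f z powr (- p) * (1 - z\<^sup>2) powr (- (a + 1) / 2)) (at z)"
      using DERIV_chain2[where f = "\<lambda>y. y powr (1 - p)" and g = f, OF has_real_derivative_powr[OF fpos[OF z]] fd[OF z]] by simp
    show ?thesis
      unfolding B_def[abs_def] B'_def
      by (rule DERIV_cong[OF DERIV_mult[OF axis_cutoff_has_derivative[OF e(1), folded w_def w'_def] DERIV_mult[OF 1 2]]])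
        (simp add: algebra_simps)
  qed
  have b0: "b z = 0" "b' z = 0" if "1 - e < z" for z
    using that w(3)[of z] w'(2)[of z] by (auto simp: b_def b'_def B_def B'_def)
  show ?thesis
  proof
    show "(b has_real_derivative b' z) (at z)" if z: "0 < z" for z
    proof (cases "z < 1")
      case True
      have "(b has_real_derivative B' z) (at z)"
        by (rule has_field_derivative_transform_within_open[OF Bd, where S = "{0<..<1}"]) (use z True in \<open>auto simp: b_def\<close>)
      then show ?thesis using True by (simp add: b'_def)
    next
      case False
      have "(b has_real_derivative 0) (at z)"
        by (rule has_field_derivative_transform_within_open[OF DERIV_const, where S = "{1 - e<..}"]) (use False e b0 in auto)
      then show ?thesis using False by (simp add: b'_def)
    qed
    have fc: "continuous_on {0<..<1} f"
      by (intro continuous_at_imp_continuous_on ballI DERIV_isCont[OF fd]) auto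
    have wc: "continuous_on {0<..<1} w"
      unfolding w_def by (intro continuous_at_imp_continuous_on ballI DERIV_isCont[OF axis_cutoff_has_derivative[OF e(1)]])
    have "continuous_on ({0<..<1} \<union> {1 - e<..}) b'"
    proof (rule continuous_on_open_Un)
      have "continuous_on {0<..<1} B'"
        unfolding B'_def[abs_def]
        by (intro continuous_intros continuous_on_powr w'(3) wc fc)
          (use fpos spos in \<open>auto simp: less_imp_neq[symmetric]\<close>)
      then show "continuous_on {0<..<1} b'" by (rule continuous_on_eq) (simp add: b'_def)
      have "continuous_on {1 - e<..} (\<lambda>z. 0 :: real)" by simp
      then show "continuous_on {1 - e<..} b'" by (rule continuous_on_eq) (simp add: b0)
    qed auto
    then show "continuous_on {0<..} b'" by (rule continuous_on_subset) (use e in auto)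
    fix z :: real assume z: "0 < z" "z \<le> 1"
    show "0 \<le> b z" using w by (simp add: b_def B_def)
    have "b z * sqrt (1 - z\<^sup>2) = w z * eta_t n p (arccos z) powr (p - 1) \<and>
      (p - 1) * w z * eta_t n p (arccos z) powr p \<le> real n * z * b z - (1 - z\<^sup>2) * b' z"
    proof (cases "z = 1")
      case True
      then show ?thesis using b0[of 1] w(3)[of 1] e by simp
    next
      case False
      then have z1: "z < 1" using z by simp
      define q where "q = 1 - z\<^sup>2"
      have q: "0 < q" using spos[OF z(1) z1] by (simp add: q_def)
      have F: "0 < f z" using fpos[OF z(1) z1] .
      have sq: "sqrt q = q powr (1/2)" using q by (simp add: powr_half_sqrt)
      have eta: "eta_t n p (arccos z) = q powr (- a / 2) / f z"
        using z q by (simp add: eta_t_eq_sin_tail a_def[symmetric] f_def sin_arccos q_def[symmetric] sq powr_powr)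
      have eta_powr: "eta_t n p (arccos z) powr c = q powr (- a / 2 * c) * f z powr (- c)" for c
        unfolding eta using F q by (simp add: powr_divide powr_powr powr_minus_divide powr_mult)
      have e1: "eta_t n p (arccos z) powr (p - 1) = q powr ((1 - real n) / 2) * f z powr (1 - p)"
      proof -
        have "- a / 2 * (p - 1) = (1 - real n) / 2" using a(2) by (simp add: field_simps)
        then show ?thesis unfolding eta_powr by (simp only: minus_diff_eq)
      qed
      have e2: "eta_t n p (arccos z) powr p = q powr (- a * p / 2) * f z powr (- p)"
        unfolding eta_powr by simp
      have b: "b z = w z * (q powr (- real n / 2) * f z powr (1 - p))"
        using z1 by (simp add: b_def B_def q_def)
      have b': "b' z = w' z * (q powr (- real n / 2) * f z powr (1 - p))
        + w z * (real n * z * q powr (- real n / 2 - 1) * f z powr (1 - p)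
           + q powr (- real n / 2) * ((1 - p) * f z powr (- p) * q powr (- (a + 1) / 2)))"
        using z1 by (simp add: b'_def B'_def q_def)
      have "b z * sqrt q = w z * (q powr (- real n / 2) * q powr (1/2)) * f z powr (1 - p)"
        unfolding b sq by simp
      also have "q powr (- real n / 2) * q powr (1/2) = q powr ((1 - real n) / 2)"
        by (simp add: powr_add[symmetric] field_simps)
      finally have c1: "b z * sqrt q = w z * eta_t n p (arccos z) powr (p - 1)"
        unfolding e1 by simp
      have q1: "q * q powr (- real n / 2 - 1) = q powr (- real n / 2)"
        using q by (simp add: powr_diff)
      have q2: "q * q powr (- real n / 2) * q powr (- (a + 1) / 2) = q powr (- a * p / 2)"
      proof -
        have "1 + (- real n / 2) + (- (a + 1) / 2) = - a * p / 2" using a(2) by (simp add: field_simps)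
        moreover have "q * q powr (- real n / 2) * q powr (- (a + 1) / 2) = q powr (1 + (- real n / 2) + (- (a + 1) / 2))"
          using q by (simp only: powr_add powr_one)
        ultimately show ?thesis by simp
      qed
      \<comment> \<open>The second line cancels, which is p-harmonicity of f. What remains is the
        Riccati term of the third line and, in the first, the nonnegative contribution of the
        cutoff.\<close>
      have "real n * z * b z - q * b' z =
        - w' z * (q * q powr (- real n / 2) * f z powr (1 - p))
        + real n * z * w z * f z powr (1 - p) * (q powr (- real n / 2) - q * q powr (- real n / 2 - 1))
        + (p - 1) * w z * (f z powr (- p) * (q * q powr (- real n / 2) * q powr (- (a + 1) / 2)))"
        unfolding b b' by (simp add: algebra_simps)
      also have "\<dots> = - w' z * (q * q powr (- real n / 2) * f z powr (1 - p)) + (p - 1) * w z * eta_t n p (arccos z) powr p"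
        unfolding q1 q2 e2 by simp
      also have "\<dots> \<ge> (p - 1) * w z * eta_t n p (arccos z) powr p"
        using w'(1)[of z] q by (simp add: mult_nonpos_nonneg)
      finally show ?thesis using c1 by (simp add: q_def)
    qed
    then show "b z * sqrt (1 - z\<^sup>2) = axis_cutoff e z * eta_t n p (arccos z) powr (p - 1)"
      "(p - 1) * axis_cutoff e z * eta_t n p (arccos z) powr p \<le> real n * z * b z - (1 - z\<^sup>2) * b' z"
      by (simp_all add: w_def)
  qed
qed

section \<open>The inequality\<close>

text \<open>The weight before truncation. The indicator makes it 0 wherever the polar angle is
  outside \<open>(0, pi/2)\<close>, in particular on the axis, and so Borel on the whole
  space.\<close>

definition hardy_weight :: "nat \<Rightarrow> real \<Rightarrow> 'n::finite \<Rightarrow> real^'n \<Rightarrow> real" where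
  "hardy_weight n p k x = (indicator {0<..<1} (x $ k / norm x) *\<^sub>R eta_t n p (arccos (x $ k / norm x))) / norm x"

lemma continuous_on_eta_t_arccos:
  assumes "1 < p" "p < real n"
  shows "continuous_on {0<..<1} (\<lambda>z. eta_t n p (arccos z))"
proof -
  define a where "a = (real n - 1) / (p - 1)"
  have a: "1 < a" using assms by (simp_all add: a_def field_simps)
  have arc: "0 < arccos z" "arccos z < pi/2" if "z \<in> {0<..<1}" for z
    using that arccos_less_mono[of 1 z] arccos_less_mono[of z 0] by (auto simp: arccos_0)
  have f: "continuous_on {0<..<1} (\<lambda>z. sin_tail a (arccos z))"
    by (intro continuous_at_imp_continuous_on ballI DERIV_isCont[OF sin_tail_arccos_has_derivative]) auto
  have s: "continuous_on {0<..<1} (\<lambda>z. sin (arccos z))"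
    by (intro continuous_intros) auto
  have fpos: "sin_tail a (arccos z) \<noteq> 0" "sin (arccos z) \<noteq> 0" if "z \<in> {0<..<1}" for z
    using sin_tail_pos[OF arc[OF that], of a] sin_gt_zero[of "arccos z"] arc[OF that] a by auto
  show ?thesis
    unfolding eta_t_eq_sin_tail a_def[symmetric]
    by (intro continuous_on_divide continuous_on_powr s f continuous_on_const) (use fpos in auto)
qed

lemma hardy_weight_measurable [measurable]:
  assumes "1 < p" "p < real n"
  shows "hardy_weight n p k \<in> borel_measurable borel"
proof -
  have [measurable]: "(\<lambda>z. indicator {0<..<1} z *\<^sub>R eta_t n p (arccos z)) \<in> borel_measurable borel"
    using continuous_on_eta_t_arccos[OF assms] by (intro borel_measurable_continuous_on_indicator) auto
  show ?thesis unfolding hardy_weight_def by measurable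
qed

lemma hardy_weight_nonneg:
  assumes "1 < p" "p < real n"
  shows "0 \<le> hardy_weight n p k x"
proof (cases "x $ k / norm x \<in> {0<..<1}")
  case True
  then have "0 < eta_t n p (arccos (x $ k / norm x))"
    using arccos_less_mono[of 1 "x $ k / norm x"] arccos_less_mono[of "x $ k / norm x" 0] assms
    by (intro eta_t_pos) (auto simp: arccos_0)
  then show ?thesis by (simp add: hardy_weight_def)
qed (simp add: hardy_weight_def)

lemma half_space_measurable [measurable]: "half_space k \<in> sets borel"
  using open_half_space by (rule borel_open)

text \<open>Fatou's lemma under a uniform bound. It serves two limits: the removal of the axis
  cutoff and the removal of the cap on the weight.\<close>

lemma nn_integral_le_of_tendsto:
  fixes f :: "nat \<Rightarrow> 'a \<Rightarrow> ennreal"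
  assumes "\<And>j. f j \<in> borel_measurable M" "\<And>x. (\<lambda>j. f j x) \<longlonglongrightarrow> F x" "\<And>j. (\<integral>\<^sup>+x. f j x \<partial>M) \<le> C"
  shows "(\<integral>\<^sup>+x. F x \<partial>M) \<le> C"
proof -
  have "(\<integral>\<^sup>+x. F x \<partial>M) = (\<integral>\<^sup>+x. liminf (\<lambda>j. f j x) \<partial>M)"
    using assms(2) by (intro nn_integral_cong) (metis lim_imp_Liminf sequentially_bot)
  also have "\<dots> \<le> liminf (\<lambda>j. \<integral>\<^sup>+x. f j x \<partial>M)"
    by (rule nn_integral_liminf[OF assms(1)])
  also have "\<dots> \<le> limsup (\<lambda>j. \<integral>\<^sup>+x. f j x \<partial>M)" by (intro Liminf_le_Limsup) simp
  also have "\<dots> \<le> C" using assms(3) by (intro Limsup_bounded) simp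
  finally show ?thesis .
qed

text \<open>Here \<open>t\<close> and \<open>G\<close> stand for the value and gradient of the test
  function at \<open>x\<close>, and \<open>D\<close> for the angular factor of the divergence.
  Young's inequality is applied to the tangential gradient and
  \<open>y = c * hardy_weight n p k x * \<bar>t\<bar>\<close>. Multiplying the field by
  \<open>c powr (p - 1)\<close> is the optimal scaling: then
  \<open>p * c powr p = (p - 1) * c powr (p - 1)\<close>, so the divergence supplies
  \<open>p\<close> copies of \<open>y powr p\<close>, Young's inequality consumes
  \<open>p - 1\<close> of them, and one is left.\<close>

lemma hardy_cutoff_pointwise:
  fixes x :: "real^'n::finite" and p :: real
  assumes p: "1 < p" "p < real n" and e: "0 < e" and x: "x \<in> half_space k"
  defines "z \<equiv> x $ k / norm x" and "c \<equiv> (p - 1) / p"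
  assumes b: "0 \<le> b"
    and b1: "b * sqrt (1 - z\<^sup>2) = axis_cutoff e z * eta_t n p (arccos z) powr (p - 1)"
    and b2: "(p - 1) * axis_cutoff e z * eta_t n p (arccos z) powr p \<le> D"
  shows "c powr p * axis_cutoff e z * \<bar>t\<bar> powr p * hardy_weight n p k x powr p
    \<le> norm (tangential x G) powr p + c powr (p - 1) *
      (- (b * norm x powr (2 - p) * (((p * \<bar>t\<bar> powr (p - 1) * sgn t) *\<^sub>R G) \<bullet> cos_grad k x))
        + \<bar>t\<bar> powr p * norm x powr (- p) * D)"
proof -
  \<comment> \<open>On the axis \<open>H\<close> is 0, in agreement with
    \<open>hardy_weight\<close>; the cutoff vanishes there, so the hypotheses on \<open>b\<close>
    and \<open>D\<close> survive the replacement of eta by \<open>H\<close>.\<close>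
  define r \<xi> w H where "r = norm x" and "\<xi> = norm (tangential x G)" and "w = axis_cutoff e z"
    and "H = (if z = 1 then 0 else eta_t n p (arccos z))"
  have x0: "x \<noteq> 0" using x by (rule half_space_nonzero)
  have r: "0 < r" using x0 by (simp add: r_def)
  have z: "0 < z" "z \<le> 1"
    using half_space_cos_pos[OF x] order_trans[OF abs_ge_self cos_abs_le_1[of x k]] by (auto simp: z_def)
  note w = axis_cutoff_bounds(1,2)[OF e, of z, folded w_def]
  have w1: "w = 0" if "z = 1" using axis_cutoff_bounds(3)[OF e, of z] that e by (simp add: w_def)
  have H: "0 \<le> H"
  proof (cases "z = 1")
    case False
    then have "0 < eta_t n p (arccos z)"
      using arccos_less_mono[of 1 z] arccos_less_mono[of z 0] z p by (intro eta_t_pos) (auto simp: arccos_0)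
    then show ?thesis by (simp add: H_def)
  qed (simp add: H_def)
  define y where "y = c * (H / r) * \<bar>t\<bar>"
  have c: "0 < c" using p by (simp add: c_def)
  have y: "0 \<le> y" using c H r by (simp add: y_def)
  have V: "hardy_weight n p k x = H / r"
    unfolding hardy_weight_def z_def[symmetric] using z by (auto simp: r_def H_def)
  have bH: "b * sqrt (1 - z\<^sup>2) = w * H powr (p - 1)"
    using b1 w1 by (auto simp: H_def w_def)
  have DH: "(p - 1) * w * H powr p \<le> D"
    using b2 w1 by (auto simp: H_def w_def)
  have yp: "y powr q = c powr q * (H powr q * r powr (- q)) * \<bar>t\<bar> powr q" for q
    unfolding y_def using c H r by (simp add: powr_mult powr_divide powr_minus_divide)
  have A: "b * r powr (2 - p) * (((p * \<bar>t\<bar> powr (p - 1) * sgn t) *\<^sub>R G) \<bullet> cos_grad k x)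
     \<le> b * r powr (2 - p) * (p * \<bar>t\<bar> powr (p - 1) * (\<xi> * (sqrt (1 - z\<^sup>2) / r)))"
  proof (intro mult_left_mono)
    have "((p * \<bar>t\<bar> powr (p - 1) * sgn t) *\<^sub>R G) \<bullet> cos_grad k x
        = p * \<bar>t\<bar> powr (p - 1) * (sgn t * (tangential x G \<bullet> cos_grad k x))"
      by (simp add: tangential_inner_cos_grad)
    also have "\<dots> \<le> p * \<bar>t\<bar> powr (p - 1) * (\<xi> * (sqrt (1 - z\<^sup>2) / r))"
    proof (intro mult_left_mono)
      have "sgn t * (tangential x G \<bullet> cos_grad k x) \<le> \<bar>tangential x G \<bullet> cos_grad k x\<bar>"
        by (auto simp: sgn_if)
      also have "\<dots> \<le> \<xi> * norm (cos_grad k x)"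
        unfolding \<xi>_def by (rule Cauchy_Schwarz_ineq2)
      also have "norm (cos_grad k x) = sqrt (1 - z\<^sup>2) / r"
        using norm_cos_grad[OF x0, of k] by (simp add: z_def r_def)
      finally show "sgn t * (tangential x G \<bullet> cos_grad k x) \<le> \<xi> * (sqrt (1 - z\<^sup>2) / r)" .
    qed (use p in auto)
    finally show "((p * \<bar>t\<bar> powr (p - 1) * sgn t) *\<^sub>R G) \<bullet> cos_grad k x
      \<le> p * \<bar>t\<bar> powr (p - 1) * (\<xi> * (sqrt (1 - z\<^sup>2) / r))" .
  qed (use b in auto)
  have "c powr (p - 1) * (b * r powr (2 - p) * (p * \<bar>t\<bar> powr (p - 1) * (\<xi> * (sqrt (1 - z\<^sup>2) / r))))
      = c powr (p - 1) * ((b * sqrt (1 - z\<^sup>2)) * (r powr (2 - p) / r) * (p * \<bar>t\<bar> powr (p - 1) * \<xi>))"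
    by simp
  also have "r powr (2 - p) / r = r powr (- (p - 1))"
    using r by (simp add: powr_diff power2_eq_square)
  also have "c powr (p - 1) * ((b * sqrt (1 - z\<^sup>2)) * r powr (- (p - 1)) * (p * \<bar>t\<bar> powr (p - 1) * \<xi>))
    = w * (p * (y powr (p - 1) * \<xi>))"
    unfolding bH yp by simp
  also have "\<dots> \<le> w * (\<xi> powr p + (p - 1) * y powr p)"
    using w p y by (intro mult_left_mono youngs_powr) (auto simp: \<xi>_def)
  also have "\<dots> \<le> \<xi> powr p + (p - 1) * w * y powr p"
    using mult_right_mono[OF w(2), of "\<xi> powr p"] by (simp add: algebra_simps)
  finally have B: "c powr (p - 1) * (b * r powr (2 - p) * (p * \<bar>t\<bar> powr (p - 1) * (\<xi> * (sqrt (1 - z\<^sup>2) / r))))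
     \<le> \<xi> powr p + (p - 1) * w * y powr p" .
  have "p * w * y powr p = c powr (p - 1) * (\<bar>t\<bar> powr p * r powr (- p) * ((p - 1) * w * H powr p))"
  proof -
    have "p * c powr p = c powr (p - 1) * (p - 1)"
      using c p by (simp add: powr_diff c_def)
    moreover have "p * w * y powr p = (p * c powr p) * (w * (H powr p * r powr (- p)) * \<bar>t\<bar> powr p)"
      unfolding yp by simp
    ultimately show ?thesis by (simp add: mult_ac)
  qed
  also have "\<dots> \<le> c powr (p - 1) * (\<bar>t\<bar> powr p * r powr (- p) * D)"
    by (intro mult_left_mono DH) auto
  finally have C: "p * w * y powr p \<le> c powr (p - 1) * (\<bar>t\<bar> powr p * r powr (- p) * D)" .
  have "c powr p * w * \<bar>t\<bar> powr p * hardy_weight n p k x powr p = w * y powr p"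
    unfolding V yp using H r by (simp add: powr_divide powr_minus_divide)
  also have "\<dots> \<le> \<xi> powr p + c powr (p - 1) * (- (b * r powr (2 - p) * (((p * \<bar>t\<bar> powr (p - 1) * sgn t) *\<^sub>R G) \<bullet> cos_grad k x))
        + \<bar>t\<bar> powr p * r powr (- p) * D)"
    using mult_left_mono[OF A, of "c powr (p - 1)"] B C by (simp add: algebra_simps)
  finally show ?thesis by (simp add: r_def \<xi>_def w_def)
qed

lemma C1c_integrable_tangential:
  fixes \<phi> :: "real^'n::finite \<Rightarrow> real"
  assumes \<phi>: "C1c \<Omega> \<phi> G" and p: "0 \<le> p"
  shows "integrable lborel (\<lambda>x. norm (tangential x (G x)) powr p)"
proof -
  let ?\<xi> = "\<lambda>x. norm (tangential x (G x)) powr p"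
  have [measurable]: "G \<in> borel_measurable borel" using C1c_D(5)[OF \<phi>] .
  obtain M R where MR: "0 \<le> R" "0 \<le> M" "\<And>x. norm (G x) \<le> M" "\<And>x. R < norm x \<Longrightarrow> G x = 0"
    using C1c_bounded[OF \<phi>] by metis
  show ?thesis
  proof (rule Bochner_Integration.integrable_bound)
    show "integrable lborel (\<lambda>x::real^'n. indicator (cball 0 R) x *\<^sub>R (M powr p))"
      by (intro borel_integrable_compact compact_cball continuous_intros)
    have "norm (?\<xi> x) \<le> norm (indicator (cball 0 R) x *\<^sub>R (M powr p))" for x
    proof (cases "x \<in> cball 0 R")
      case True
      have "norm (tangential x (G x)) \<le> M" using norm_tangential_le[of x "G x"] MR(3)[of x] by simp
      then show ?thesis using True p by (auto intro!: powr_mono2)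
    next
      case False
      then show ?thesis using MR(4)[of x] by (simp add: tangential_def)
    qed
    then show "AE x in lborel. norm (?\<xi> x) \<le> norm (indicator (cball 0 R) x *\<^sub>R (M powr p))" by simp
  qed simp
qed

text \<open>The pointwise bound is integrated; its last term is a multiple of the divergence of the
  field times \<open>\<bar>\<phi> x\<bar> powr p\<close> and contributes nothing.\<close>

lemma hardy_cutoff:
  fixes \<phi> :: "real^'n::finite \<Rightarrow> real"
  assumes n: "CARD('n) = n + 1" and p: "1 < p" "p < real n" and e: "0 < e" "e < 1"
    and \<phi>: "C1c (half_space k) \<phi> G"
  shows "(\<integral>\<^sup>+x. ennreal (((p - 1) / p) powr p * axis_cutoff e (x $ k / norm x) * \<bar>\<phi> x\<bar> powr p * hardy_weight n p k x powr p) \<partial>lborel)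
    \<le> (\<integral>\<^sup>+x. ennreal (norm (tangential x (G x)) powr p) \<partial>lborel)"
proof -
  obtain b b' where b: "\<And>z. 0 < z \<Longrightarrow> (b has_real_derivative b' z) (at z)" "continuous_on {0<..} b'"
    "\<And>z. 0 < z \<Longrightarrow> z \<le> 1 \<Longrightarrow> 0 \<le> b z"
    "\<And>z. 0 < z \<Longrightarrow> z \<le> 1 \<Longrightarrow> b z * sqrt (1 - z\<^sup>2) = axis_cutoff e z * eta_t n p (arccos z) powr (p - 1)"
    "\<And>z. 0 < z \<Longrightarrow> z \<le> 1 \<Longrightarrow> (p - 1) * axis_cutoff e z * eta_t n p (arccos z) powr p
        \<le> real n * z * b z - (1 - z\<^sup>2) * b' z"
    using hardy_field_exists[OF p e] by blast
  define c where "c = (p - 1) / p"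
  define E where "E x = - (b (x $ k / norm x) * norm x powr (2 - p) * (((p * \<bar>\<phi> x\<bar> powr (p - 1) * sgn (\<phi> x)) *\<^sub>R G x) \<bullet> cos_grad k x))
      + \<bar>\<phi> x\<bar> powr p * norm x powr (- p) * ((real CARD('n) - 1) * (x $ k / norm x) * b (x $ k / norm x)
          - (1 - (x $ k / norm x)\<^sup>2) * b' (x $ k / norm x))" for x
  have E: "integrable lborel E" "(\<integral>x. E x \<partial>lborel) = 0"
    unfolding E_def[abs_def] using polar_field_divergence[OF C1c_abs_powr[OF \<phi> p(1)] b(1,2), of p] by auto
  let ?\<xi> = "\<lambda>x. norm (tangential x (G x)) powr p"
  have \<xi>: "integrable lborel ?\<xi>" by (rule C1c_integrable_tangential[OF \<phi> less_imp_le[OF order_less_trans[OF zero_less_one p(1)]]])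
  let ?L = "\<lambda>x. c powr p * axis_cutoff e (x $ k / norm x) * \<bar>\<phi> x\<bar> powr p * hardy_weight n p k x powr p"
  have pw: "?L x \<le> ?\<xi> x + c powr (p - 1) * E x" for x
  proof (cases "x \<in> half_space k")
    case True
    have z: "0 < x $ k / norm x" "x $ k / norm x \<le> 1"
      using half_space_cos_pos[OF True] order_trans[OF abs_ge_self cos_abs_le_1[of x k]] by auto
    have "real CARD('n) - 1 = real n" using n by simp
    then show ?thesis
      unfolding E_def c_def
      using hardy_cutoff_pointwise[OF p e(1) True b(3)[OF z] b(4)[OF z] b(5)[OF z], of "\<phi> x" "G x"] by simp
  next
    case False
    then show ?thesis using C1c_eq_0[OF \<phi> False] p by (simp add: E_def)
  qed
  have L0: "0 \<le> ?L x" for x using axis_cutoff_bounds(1)[OF e(1)] by simp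
  have "(\<integral>\<^sup>+x. ennreal (?L x) \<partial>lborel) \<le> (\<integral>\<^sup>+x. ennreal (?\<xi> x + c powr (p - 1) * E x) \<partial>lborel)"
    by (intro nn_integral_mono ennreal_leI pw)
  \<comment> \<open>The divergence has no fixed sign, but the sum is nonnegative because it
    dominates the nonnegative \<open>?L\<close>; this permits the return to the Bochner
    integral.\<close>
  also have "\<dots> = ennreal (\<integral>x. ?\<xi> x + c powr (p - 1) * E x \<partial>lborel)"
    using E \<xi> order_trans[OF L0 pw] by (intro nn_integral_eq_integral) auto
  also have "(\<integral>x. ?\<xi> x + c powr (p - 1) * E x \<partial>lborel) = (\<integral>x. ?\<xi> x \<partial>lborel)"
    using E \<xi> by simp
  also have "ennreal (\<integral>x. ?\<xi> x \<partial>lborel) = (\<integral>\<^sup>+x. ennreal (?\<xi> x) \<partial>lborel)"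
    using \<xi> by (intro nn_integral_eq_integral[symmetric]) auto
  finally show ?thesis by (simp add: c_def)
qed

text \<open>The cutoff parameter tends to 0. On the axis the cutoff stays 0, but there the weight is
  0 too, so the integrands converge everywhere.\<close>

lemma hardy_C1c:
  fixes \<phi> :: "real^'n::finite \<Rightarrow> real"
  assumes n: "CARD('n) = n + 1" and p: "1 < p" "p < real n"
    and \<phi>: "C1c (half_space k) \<phi> G"
  shows "(\<integral>\<^sup>+x. ennreal (((p - 1) / p) powr p * \<bar>\<phi> x\<bar> powr p * hardy_weight n p k x powr p) \<partial>lborel)
    \<le> (\<integral>\<^sup>+x. ennreal (norm (tangential x (G x)) powr p) \<partial>lborel)"
proof (rule nn_integral_le_of_tendsto[where f = "\<lambda>j x. ennreal (((p - 1) / p) powr p * axis_cutoff (1 / real (Suc (Suc j))) (x $ k / norm x)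
       * \<bar>\<phi> x\<bar> powr p * hardy_weight n p k x powr p)"])
  note [measurable] = C1c_D(4)[OF \<phi>] hardy_weight_measurable[OF p]
  show "(\<lambda>x. ennreal (((p - 1) / p) powr p * axis_cutoff (1 / real (Suc (Suc j))) (x $ k / norm x)
       * \<bar>\<phi> x\<bar> powr p * hardy_weight n p k x powr p)) \<in> borel_measurable lborel" for j
    unfolding axis_cutoff_def by measurable
  show "(\<integral>\<^sup>+x. ennreal (((p - 1) / p) powr p * axis_cutoff (1 / real (Suc (Suc j))) (x $ k / norm x)
       * \<bar>\<phi> x\<bar> powr p * hardy_weight n p k x powr p) \<partial>lborel)
    \<le> (\<integral>\<^sup>+x. ennreal (norm (tangential x (G x)) powr p) \<partial>lborel)" for j
    by (rule hardy_cutoff[OF n p _ _ \<phi>]) auto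
  fix x :: "real^'n"
  show "(\<lambda>j. ennreal (((p - 1) / p) powr p * axis_cutoff (1 / real (Suc (Suc j))) (x $ k / norm x)
       * \<bar>\<phi> x\<bar> powr p * hardy_weight n p k x powr p)) \<longlonglongrightarrow>
      ennreal (((p - 1) / p) powr p * \<bar>\<phi> x\<bar> powr p * hardy_weight n p k x powr p)"
  proof (cases "x $ k / norm x < 1")
    case True
    have "(\<lambda>j. ((p - 1) / p) powr p * axis_cutoff (1 / real (Suc (Suc j))) (x $ k / norm x)
       * \<bar>\<phi> x\<bar> powr p * hardy_weight n p k x powr p) \<longlonglongrightarrow> ((p - 1) / p) powr p * 1
       * \<bar>\<phi> x\<bar> powr p * hardy_weight n p k x powr p"
      by (intro tendsto_mult tendsto_const axis_cutoff_tendsto True)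
    then show ?thesis by simp
  next
    case False
    then have "hardy_weight n p k x = 0" by (simp add: hardy_weight_def)
    then show ?thesis by simp
  qed
qed

section \<open>From C1 functions to the Sobolev space\<close>

lemma nn_set_integral_le_combine:
  fixes f g h :: "'a \<Rightarrow> real"
  assumes [measurable]: "g \<in> borel_measurable M" "h \<in> borel_measurable M" "\<Omega> \<in> sets M"
    and "0 \<le> A" "0 \<le> B" "\<And>x. 0 \<le> g x" "\<And>x. 0 \<le> h x" "\<And>x. f x \<le> A * g x + B * h x"
  shows "(\<integral>\<^sup>+x\<in>\<Omega>. ennreal (f x) \<partial>M) \<le> ennreal A * (\<integral>\<^sup>+x\<in>\<Omega>. ennreal (g x) \<partial>M) + ennreal B * (\<integral>\<^sup>+x\<in>\<Omega>. ennreal (h x) \<partial>M)"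
proof -
  have "(\<integral>\<^sup>+x\<in>\<Omega>. ennreal (f x) \<partial>M) \<le>
    (\<integral>\<^sup>+x. ennreal A * (ennreal (g x) * indicator \<Omega> x) + ennreal B * (ennreal (h x) * indicator \<Omega> x) \<partial>M)"
    using assms(4-)
    by (intro nn_integral_mono)
      (auto simp: indicator_def ennreal_mult[symmetric] ennreal_plus[symmetric] simp del: ennreal_plus intro!: ennreal_leI)
  also have "\<dots> = ennreal A * (\<integral>\<^sup>+x\<in>\<Omega>. ennreal (g x) \<partial>M) + ennreal B * (\<integral>\<^sup>+x\<in>\<Omega>. ennreal (h x) \<partial>M)"
    by (subst nn_integral_add) (auto simp: nn_integral_cmult)
  finally show ?thesis .
qed

lemma tendsto_one_minus_powr:
  fixes q :: real
  shows "(\<lambda>i. (1 - 1 / real (Suc (Suc i))) powr q) \<longlonglongrightarrow> 1"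
proof -
  have e: "(\<lambda>j. 1 / real (Suc (Suc j))) \<longlonglongrightarrow> 0"
    using LIMSEQ_Suc[OF LIMSEQ_inverse_real_of_nat] by (simp add: inverse_eq_divide)
  have "(\<lambda>i. (1 - 1 / real (Suc (Suc i))) powr q) \<longlonglongrightarrow> (1 - 0) powr q"
    by (intro tendsto_intros e) auto
  then show ?thesis by simp
qed

text \<open>Since \<open>Z\<close> may be unbounded, L^p convergence does not control the weighted
  integrals. With \<open>Z\<close> capped at \<open>M\<close>, the error terms vanish as
  \<open>j\<close> tends to infinity for fixed \<open>s\<close> and \<open>M\<close>; then
  \<open>s\<close> tends to 0, and only at the end \<open>M\<close> to infinity.\<close>

lemma W1p0_weighted_inequality:
  fixes Z :: "real^'n::finite \<Rightarrow> real"
  assumes p: "1 < p" and [measurable]: "\<Omega> \<in> sets borel" "Z \<in> borel_measurable borel" and Z: "\<And>x. 0 \<le> Z x"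
    and C1c: "\<And>\<phi> G. C1c \<Omega> \<phi> G \<Longrightarrow> (\<integral>\<^sup>+x\<in>\<Omega>. ennreal (\<bar>\<phi> x\<bar> powr p * Z x) \<partial>lborel)
        \<le> (\<integral>\<^sup>+x\<in>\<Omega>. ennreal (norm (tangential x (G x)) powr p) \<partial>lborel)"
    and ug: "W1p0 p \<Omega> u g"
  shows "(\<integral>\<^sup>+x\<in>\<Omega>. ennreal (\<bar>u x\<bar> powr p * Z x) \<partial>lborel) \<le> (\<integral>\<^sup>+x\<in>\<Omega>. ennreal (norm (tangential x (g x)) powr p) \<partial>lborel)"
    (is "_ \<le> ?T")
proof -
  have [measurable]: "u \<in> borel_measurable borel" "g \<in> borel_measurable borel" using ug by (auto simp: W1p0_def)
  from ug obtain \<phi> G where \<phi>G: "\<And>j::nat. C1c \<Omega> (\<phi> j) (G j)"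
    "(\<lambda>j. \<integral>\<^sup>+x\<in>\<Omega>. ennreal (\<bar>\<phi> j x - u x\<bar> powr p) \<partial>lborel) \<longlonglongrightarrow> 0"
    "(\<lambda>j. \<integral>\<^sup>+x\<in>\<Omega>. ennreal (norm (G j x - g x) powr p) \<partial>lborel) \<longlonglongrightarrow> 0"
    unfolding W1p0_def by blast
  have [measurable]: "\<phi> j \<in> borel_measurable borel" "G j \<in> borel_measurable borel" for j
    using C1c_D(4,5)[OF \<phi>G(1)] by auto
  define \<delta> where "\<delta> j = (\<integral>\<^sup>+x\<in>\<Omega>. ennreal (\<bar>\<phi> j x - u x\<bar> powr p) \<partial>lborel)" for j
  define \<delta>' where "\<delta>' j = (\<integral>\<^sup>+x\<in>\<Omega>. ennreal (norm (G j x - g x) powr p) \<partial>lborel)" for j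
  \<comment> \<open>The exponent carries a factor 2 because \<open>powr_add_le\<close> is used
    twice: once to replace \<open>u\<close> by \<open>\<phi> j\<close>, once to replace
    \<open>G j\<close> by \<open>g\<close>.\<close>
  have step: "(\<integral>\<^sup>+x\<in>\<Omega>. ennreal (\<bar>u x\<bar> powr p * min (Z x) (real M)) \<partial>lborel) \<le> ennreal ((1 - s) powr (2 * (1 - p))) * ?T"
    if s: "0 < s" "s < 1" for s M
  proof -
    define A B where "A = (1 - s) powr (1 - p)" and "B = s powr (1 - p)"
    have AB: "0 \<le> A" "0 \<le> B" by (auto simp: A_def B_def)
    have A2: "(1 - s) powr (2 * (1 - p)) = A * A" by (simp add: A_def powr_add[symmetric])
    have "(\<integral>\<^sup>+x\<in>\<Omega>. ennreal (\<bar>u x\<bar> powr p * min (Z x) (real M)) \<partial>lborel) \<le>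
        ennreal A * (ennreal A * ?T + ennreal B * \<delta>' j) + ennreal (B * real M) * \<delta> j" for j
    proof -
      have "(\<integral>\<^sup>+x\<in>\<Omega>. ennreal (\<bar>u x\<bar> powr p * min (Z x) (real M)) \<partial>lborel) \<le>
        ennreal A * (\<integral>\<^sup>+x\<in>\<Omega>. ennreal (\<bar>\<phi> j x\<bar> powr p * Z x) \<partial>lborel) + ennreal (B * real M) * \<delta> j"
        unfolding \<delta>_def
      proof (rule nn_set_integral_le_combine)
        fix x
        have "\<bar>u x\<bar> powr p \<le> (\<bar>\<phi> j x\<bar> + \<bar>\<phi> j x - u x\<bar>) powr p"
          using p by (intro powr_mono2) auto
        also have "\<dots> \<le> A * \<bar>\<phi> j x\<bar> powr p + B * \<bar>\<phi> j x - u x\<bar> powr p"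
          unfolding A_def B_def using p s by (intro powr_add_le) auto
        finally have "\<bar>u x\<bar> powr p * min (Z x) (real M) \<le> (A * \<bar>\<phi> j x\<bar> powr p + B * \<bar>\<phi> j x - u x\<bar> powr p) * min (Z x) (real M)"
          using Z by (intro mult_right_mono) auto
        also have "\<dots> = A * \<bar>\<phi> j x\<bar> powr p * min (Z x) (real M) + B * \<bar>\<phi> j x - u x\<bar> powr p * min (Z x) (real M)"
          by (simp add: algebra_simps)
        \<comment> \<open>The cap is kept on the error term alone; on the main term it is given up,
          so that the inequality for \<open>\<phi> j\<close> applies.\<close>
        also have "\<dots> \<le> A * \<bar>\<phi> j x\<bar> powr p * Z x + B * \<bar>\<phi> j x - u x\<bar> powr p * real M"
          using AB by (intro add_mono mult_left_mono) auto
        finally show "\<bar>u x\<bar> powr p * min (Z x) (real M) \<le> A * (\<bar>\<phi> j x\<bar> powr p * Z x) + B * real M * \<bar>\<phi> j x - u x\<bar> powr p"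
          by (simp add: mult_ac)
      qed (use AB Z in auto)
      also have "(\<integral>\<^sup>+x\<in>\<Omega>. ennreal (\<bar>\<phi> j x\<bar> powr p * Z x) \<partial>lborel) \<le> (\<integral>\<^sup>+x\<in>\<Omega>. ennreal (norm (tangential x (G j x)) powr p) \<partial>lborel)"
        by (rule C1c[OF \<phi>G(1)])
      also have "\<dots> \<le> ennreal A * ?T + ennreal B * \<delta>' j"
        unfolding \<delta>'_def
      proof (rule nn_set_integral_le_combine)
        fix x
        have "tangential x (G j x) = tangential x (g x) + tangential x (G j x - g x)"
          by (simp add: tangential_diff)
        then have "norm (tangential x (G j x)) \<le> norm (tangential x (g x)) + norm (G j x - g x)"
          using norm_triangle_ineq[of "tangential x (g x)" "tangential x (G j x - g x)"]
            norm_tangential_le[of x "G j x - g x"] by simp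
        then have "norm (tangential x (G j x)) powr p \<le> (norm (tangential x (g x)) + norm (G j x - g x)) powr p"
          using p by (intro powr_mono2) auto
        also have "\<dots> \<le> A * norm (tangential x (g x)) powr p + B * norm (G j x - g x) powr p"
          unfolding A_def B_def using p s by (intro powr_add_le) auto
        finally show "norm (tangential x (G j x)) powr p \<le> A * norm (tangential x (g x)) powr p + B * norm (G j x - g x) powr p" .
      qed (use AB in auto)
      finally show ?thesis by (simp add: mult_left_mono add_mono)
    qed
    moreover have "(\<lambda>j. ennreal A * (ennreal A * ?T + ennreal B * \<delta>' j) + ennreal (B * real M) * \<delta> j)
        \<longlonglongrightarrow> ennreal A * (ennreal A * ?T + ennreal B * 0) + ennreal (B * real M) * 0"
      using \<phi>G(2,3) unfolding \<delta>_def[symmetric] \<delta>'_def[symmetric]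
      by (intro tendsto_add ennreal_tendsto_cmult tendsto_const) auto
    ultimately have "(\<integral>\<^sup>+x\<in>\<Omega>. ennreal (\<bar>u x\<bar> powr p * min (Z x) (real M)) \<partial>lborel)
        \<le> ennreal A * (ennreal A * ?T + ennreal B * 0) + ennreal (B * real M) * 0"
      by (intro LIMSEQ_le_const) auto
    then show ?thesis unfolding A2 using AB by (simp add: ennreal_mult mult.assoc)
  qed
  have bound: "(\<integral>\<^sup>+x\<in>\<Omega>. ennreal (\<bar>u x\<bar> powr p * min (Z x) (real M)) \<partial>lborel) \<le> ?T" for M
  proof (cases "?T = top")
    case False
    have "(\<lambda>i. ?T * ennreal ((1 - 1 / real (Suc (Suc i))) powr (2 * (1 - p)))) \<longlonglongrightarrow> ?T * ennreal 1"
      using False by (intro ennreal_tendsto_cmult tendsto_ennrealI tendsto_one_minus_powr) (simp add: less_top)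
    moreover have "(\<integral>\<^sup>+x\<in>\<Omega>. ennreal (\<bar>u x\<bar> powr p * min (Z x) (real M)) \<partial>lborel)
        \<le> ?T * ennreal ((1 - 1 / real (Suc (Suc i))) powr (2 * (1 - p)))" for i
      using step[of "1 / real (Suc (Suc i))" M] by (simp add: mult.commute)
    ultimately show ?thesis by (intro LIMSEQ_le_const[of _ "?T"]) auto
  qed simp
  show ?thesis
  proof (rule nn_integral_le_of_tendsto[OF _ _ bound])
    show "(\<lambda>M. ennreal (\<bar>u x\<bar> powr p * min (Z x) (real M)) * indicator \<Omega> x) \<longlonglongrightarrow> ennreal (\<bar>u x\<bar> powr p * Z x) * indicator \<Omega> x" for x
    proof (rule tendsto_eventually)
      obtain N :: nat where "Z x \<le> real N" using real_arch_simple by blast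
      then have "ennreal (\<bar>u x\<bar> powr p * min (Z x) (real M)) * indicator \<Omega> x = ennreal (\<bar>u x\<bar> powr p * Z x) * indicator \<Omega> x" if "N \<le> M" for M
        using that of_nat_mono[OF that, where 'a = real] by (simp add: min_def)
      then show "\<forall>\<^sub>F M in sequentially. ennreal (\<bar>u x\<bar> powr p * min (Z x) (real M)) * indicator \<Omega> x = ennreal (\<bar>u x\<bar> powr p * Z x) * indicator \<Omega> x"
        unfolding eventually_sequentially by blast
    qed
  qed measurable
qed

text \<open>The truncation at \<open>T_tilde\<close> only decreases the weight.\<close>
lemma zeta_le_hardy_weight:
  fixes x :: "real^'n::finite"
  assumes p: "1 < p" "p < real n" and x: "x \<in> half_space k"
  shows "0 \<le> zeta n p k x" "zeta n p k x / norm x \<le> (p - 1) / (real n - p) * hardy_weight n p k x"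
proof -
  define z where "z = x $ k / norm x"
  have x0: "x \<noteq> 0" using x by (rule half_space_nonzero)
  have z0: "0 < z" "z \<le> 1"
    using half_space_cos_pos[OF x] order_trans[OF abs_ge_self cos_abs_le_1[of x k]] by (auto simp: z_def)
  have "0 \<le> zeta n p k x \<and> zeta n p k x / norm x \<le> (p - 1) / (real n - p) * hardy_weight n p k x"
  proof (cases "\<forall>i. i \<noteq> k \<longrightarrow> x $ i = 0")
    case True
    then show ?thesis using hardy_weight_nonneg[OF p, of k x] p by (simp add: zeta_def)
  next
    case False
    then obtain i where i: "i \<noteq> k" "x $ i \<noteq> 0" by auto
    have "(x $ k)\<^sup>2 + (x $ i)\<^sup>2 = (\<Sum>j\<in>{k, i}. (x $ j)\<^sup>2)" using i by simp
    also have "\<dots> \<le> (\<Sum>j\<in>UNIV. (x $ j)\<^sup>2)" by (intro sum_mono2) auto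
    also have "\<dots> = (norm x)\<^sup>2" by (simp add: norm_vec_def L2_set_def sum_nonneg)
    finally have "(x $ k)\<^sup>2 < (norm x)\<^sup>2" using i by (smt (verit) zero_less_power2)
    then have "x $ k < norm x" by (rule power2_less_imp_less) simp
    then have z1: "z < 1" using x0 by (simp add: z_def)
    have arc: "0 < arccos z" "arccos z < pi/2"
      using z0 z1 arccos_less_mono[of 1 z] arccos_less_mono[of z 0] by (auto simp: arccos_0)
    have pa: "polar_angle k (x /\<^sub>R norm x) = arccos z"
      by (simp add: polar_angle_def z_def divide_inverse mult.commute)
    have zeta: "zeta n p k x = (p - 1) / (real n - p) * eta_tT n p (arccos z)"
      using False arc unfolding zeta_def rho_def pa by auto
    have hw: "hardy_weight n p k x = eta_t n p (arccos z) / norm x"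
      unfolding hardy_weight_def z_def[symmetric] using z0 z1 by simp
    have c: "0 < (p - 1) / (real n - p)" using p by simp
    have "zeta n p k x / norm x \<le> (p - 1) / (real n - p) * hardy_weight n p k x"
      unfolding zeta hw times_divide_eq_right
      using eta_tT_pos_le(2)[OF p arc] c by (intro divide_right_mono mult_left_mono) auto
    moreover have "0 \<le> zeta n p k x"
      unfolding zeta using c eta_tT_pos_le(1)[OF p arc] by (intro mult_nonneg_nonneg) auto
    ultimately show ?thesis by simp
  qed
  then show "0 \<le> zeta n p k x" "zeta n p k x / norm x \<le> (p - 1) / (real n - p) * hardy_weight n p k x" by auto
qed

lemma hardy_inequality_half_space:
  fixes k :: "'n::finite"
  assumes n: "CARD('n) = n + 1" and p: "1 < p" "p < real n" and ug: "W1p0 p (half_space k) u g"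
  shows "ennreal (((real n - p) / p) powr p) *
      (\<integral>\<^sup>+x\<in>half_space k. ennreal (\<bar>u x\<bar> powr p * (zeta n p k x) powr p / norm x powr p) \<partial>lborel)
    \<le> (\<integral>\<^sup>+x\<in>half_space k. ennreal (norm (tangential x (g x)) powr p) \<partial>lborel)"
proof -
  let ?\<Omega> = "half_space k" and ?c = "((real n - p) / p) powr p"
  define Z where "Z x = ((p - 1) / p) powr p * hardy_weight n p k x powr p" for x
  note [measurable] = hardy_weight_measurable[OF p]
  have [measurable]: "u \<in> borel_measurable borel" using ug by (auto simp: W1p0_def)
  have Zm [measurable]: "Z \<in> borel_measurable borel" unfolding Z_def[abs_def] by measurable
  have c: "0 < ?c" using p by simp
  have "ennreal ?c * (\<integral>\<^sup>+x\<in>?\<Omega>. ennreal (\<bar>u x\<bar> powr p * (zeta n p k x) powr p / norm x powr p) \<partial>lborel)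
    \<le> ennreal ?c * (\<integral>\<^sup>+x\<in>?\<Omega>. ennreal (\<bar>u x\<bar> powr p * Z x / ?c) \<partial>lborel)"
  proof (intro mult_left_mono nn_integral_mono)
    fix x
    have "\<bar>u x\<bar> powr p * zeta n p k x powr p / norm x powr p \<le> \<bar>u x\<bar> powr p * Z x / ?c" if x: "x \<in> ?\<Omega>"
    proof -
      note z = zeta_le_hardy_weight[OF p x]
      have "zeta n p k x powr p / norm x powr p = (zeta n p k x / norm x) powr p"
        using z by (simp add: powr_divide)
      also have "\<dots> \<le> ((p - 1) / (real n - p) * hardy_weight n p k x) powr p"
        using z p by (intro powr_mono2) auto
      also have "\<dots> = Z x / ?c"
        unfolding Z_def using p hardy_weight_nonneg[OF p, of k x] by (simp add: powr_mult powr_divide)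
      finally show ?thesis by (simp add: mult_left_mono flip: times_divide_eq_right)
    qed
    then show "ennreal (\<bar>u x\<bar> powr p * (zeta n p k x) powr p / norm x powr p) * indicator ?\<Omega> x
        \<le> ennreal (\<bar>u x\<bar> powr p * Z x / ?c) * indicator ?\<Omega> x"
      by (auto simp: indicator_def intro!: ennreal_leI)
  qed simp
  \<comment> \<open>Taking the constant inside requires a measurable integrand; this is why zeta was
    first replaced by a multiple of the Borel weight \<open>Z\<close>.\<close>
  also have "\<dots> = (\<integral>\<^sup>+x. ennreal ?c * (ennreal (\<bar>u x\<bar> powr p * Z x / ?c) * indicator ?\<Omega> x) \<partial>lborel)"
    by (rule nn_integral_cmult[symmetric]) measurable
  also have "\<dots> = (\<integral>\<^sup>+x\<in>?\<Omega>. ennreal (\<bar>u x\<bar> powr p * Z x) \<partial>lborel)"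
    using c by (intro nn_integral_cong) (simp add: mult.assoc[symmetric] ennreal_mult'[symmetric])
  also have "\<dots> \<le> (\<integral>\<^sup>+x\<in>?\<Omega>. ennreal (norm (tangential x (g x)) powr p) \<partial>lborel)"
  proof (rule W1p0_weighted_inequality[OF p(1) half_space_measurable Zm _ _ ug])
    show "0 \<le> Z x" for x by (simp add: Z_def)
    fix \<phi> G assume \<phi>: "C1c ?\<Omega> \<phi> G"
    have "(\<integral>\<^sup>+x\<in>?\<Omega>. ennreal (\<bar>\<phi> x\<bar> powr p * Z x) \<partial>lborel) =
        (\<integral>\<^sup>+x. ennreal (((p - 1) / p) powr p * \<bar>\<phi> x\<bar> powr p * hardy_weight n p k x powr p) \<partial>lborel)"
      using C1c_eq_0[OF \<phi>] p by (intro nn_integral_cong) (auto simp: Z_def indicator_def mult_ac)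
    also have "\<dots> \<le> (\<integral>\<^sup>+x. ennreal (norm (tangential x (G x)) powr p) \<partial>lborel)"
      by (rule hardy_C1c[OF n p \<phi>])
    also have "\<dots> = (\<integral>\<^sup>+x\<in>?\<Omega>. ennreal (norm (tangential x (G x)) powr p) \<partial>lborel)"
      using C1c_eq_0[OF \<phi>] p by (intro nn_integral_cong) (auto simp: indicator_def tangential_def)
    finally show "(\<integral>\<^sup>+x\<in>?\<Omega>. ennreal (\<bar>\<phi> x\<bar> powr p * Z x) \<partial>lborel)
        \<le> (\<integral>\<^sup>+x\<in>?\<Omega>. ennreal (norm (tangential x (G x)) powr p) \<partial>lborel)" .
  qed
  finally show ?thesis .
qed

section \<open>Sharpness\<close>

text \<open>A C1 radial factor supported in \<open>1 \<le> r \<le> 4\<close> and at least 1 on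
  \<open>[2, 7/2]\<close>, an interval that contains the norms of all points of the dyadic boxes
  used below.\<close>

definition shell :: "real \<Rightarrow> real" where
  "shell r = (max 0 ((r - 1) * (4 - r)))\<^sup>2"

definition shell_deriv :: "real \<Rightarrow> real" where
  "shell_deriv r = 2 * max 0 ((r - 1) * (4 - r)) * (5 - 2 * r)"

lemma shell_has_derivative: "(shell has_real_derivative shell_deriv r) (at r)"
  unfolding shell_def[abs_def] shell_deriv_def
  by (rule DERIV_chain2[OF max_0_square_has_derivative]) (auto intro!: derivative_eq_intros)

lemma shell_eq_0:
  assumes "r \<le> 1 \<or> 4 \<le> r"
  shows "shell r = 0" "shell_deriv r = 0"
proof -
  have "(r - 1) * (4 - r) \<le> 0" using assms by (auto intro: mult_nonpos_nonneg mult_nonneg_nonpos)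
  then show "shell r = 0" "shell_deriv r = 0" by (simp_all add: shell_def shell_deriv_def max_def)
qed

lemma shell_bounds:
  shows "0 \<le> shell r" "shell r \<le> 6" "2 \<le> r \<Longrightarrow> r \<le> 7/2 \<Longrightarrow> 1 \<le> shell r"
proof -
  have eq: "(r - 1) * (4 - r) = 9/4 - (r - 5/2)\<^sup>2" by (simp add: power2_eq_square algebra_simps)
  show "0 \<le> shell r" by (simp add: shell_def)
  have "max 0 ((r - 1) * (4 - r)) \<le> 9/4"
    unfolding eq using zero_le_power2[of "r - 5/2"] by (intro max.boundedI) linarith+
  then have "(max 0 ((r - 1) * (4 - r)))\<^sup>2 \<le> (9/4)\<^sup>2" by (intro power_mono) auto
  then show "shell r \<le> 6" by (simp add: shell_def power2_eq_square)
  assume r: "2 \<le> r" "r \<le> 7/2"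
  then have "\<bar>r - 5/2\<bar> \<le> 1" by auto
  then have "(r - 5/2)\<^sup>2 \<le> 1" by (simp add: abs_square_le_1)
  then have "1 \<le> max 0 ((r - 1) * (4 - r))" unfolding eq by simp
  then show "1 \<le> shell r" unfolding shell_def by (intro one_le_power)
qed

text \<open>A C1 step from 0 on \<open>z \<le> c / 2\<close> to 1 on \<open>z \<ge> c\<close>. It
  keeps the support away from the boundary \<open>z = 0\<close> of the half space and leaves the
  power near the axis unchanged.\<close>

definition ramp :: "real \<Rightarrow> real \<Rightarrow> real" where
  "ramp c z = 1 - (max 0 (1 - (max 0 (2 * z / c - 1))\<^sup>2))\<^sup>2"

definition ramp_deriv :: "real \<Rightarrow> real \<Rightarrow> real" where
  "ramp_deriv c z = 2 * max 0 (1 - (max 0 (2 * z / c - 1))\<^sup>2) * (2 * max 0 (2 * z / c - 1) * (2 / c))"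

lemma ramp_has_derivative: "(ramp c has_real_derivative ramp_deriv c z) (at z)"
proof -
  have 0: "((\<lambda>z. 2 * z / c - 1) has_real_derivative 2 / c) (at z)"
    using DERIV_diff[OF DERIV_cdivide[OF DERIV_cmult[OF DERIV_ident, of 2]] DERIV_const] by simp
  have 1: "((\<lambda>z. (max 0 (2 * z / c - 1))\<^sup>2) has_real_derivative 2 * max 0 (2 * z / c - 1) * (2 / c)) (at z)"
    by (rule DERIV_chain2[OF max_0_square_has_derivative 0])
  have 2: "((\<lambda>z. 1 - (max 0 (2 * z / c - 1))\<^sup>2) has_real_derivative 0 - 2 * max 0 (2 * z / c - 1) * (2 / c)) (at z)"
    by (intro DERIV_diff DERIV_const 1)
  have 3: "((\<lambda>z. (max 0 (1 - (max 0 (2 * z / c - 1))\<^sup>2))\<^sup>2) has_real_derivative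
      2 * max 0 (1 - (max 0 (2 * z / c - 1))\<^sup>2) * (0 - 2 * max 0 (2 * z / c - 1) * (2 / c))) (at z)"
    by (rule DERIV_chain2[OF max_0_square_has_derivative 2])
  from DERIV_diff[OF DERIV_const 3, of 1] show ?thesis
    by (simp add: ramp_def[abs_def] ramp_deriv_def)
qed

lemma ramp_bounds:
  assumes "0 < c"
  shows "0 \<le> ramp c z" "ramp c z \<le> 1" "z \<le> c / 2 \<Longrightarrow> ramp c z = 0"
    "c \<le> z \<Longrightarrow> ramp c z = 1" "c \<le> z \<Longrightarrow> ramp_deriv c z = 0"
    "0 \<le> ramp_deriv c z" "z \<le> c \<Longrightarrow> ramp_deriv c z \<le> 8 / c"
proof -
  define y where "y = max 0 (2 * z / c - 1)"
  have y: "0 \<le> y" by (simp add: y_def)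
  have "max 0 (1 - y\<^sup>2) \<le> 1" by simp
  then have "(max 0 (1 - y\<^sup>2))\<^sup>2 \<le> 1" by (simp add: power_le_one)
  then show "0 \<le> ramp c z" "ramp c z \<le> 1" by (simp_all add: ramp_def y_def)
  show "z \<le> c / 2 \<Longrightarrow> ramp c z = 0"
    using assms by (simp add: ramp_def max_def field_simps)
  show "0 \<le> ramp_deriv c z" using assms by (simp add: ramp_deriv_def)
  have big: "1 \<le> y" if "c \<le> z" using that assms by (simp add: y_def field_simps)
  then have m0: "max 0 (1 - y\<^sup>2) = 0" if "c \<le> z"
    using one_le_power[of y 2] that by (intro max_absorb1) auto
  show "c \<le> z \<Longrightarrow> ramp c z = 1" "c \<le> z \<Longrightarrow> ramp_deriv c z = 0"
    using m0 by (simp_all add: ramp_def ramp_deriv_def y_def)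
  assume "z \<le> c"
  then have y1: "y \<le> 1" using assms by (simp add: y_def field_simps)
  have "max 0 (1 - y\<^sup>2) * y \<le> 1 * 1" using y y1 by (intro mult_mono) auto
  then have "max 0 (1 - y\<^sup>2) * y * (8 / c) \<le> 8 / c" using assms by (intro mult_left_le_one_le) (auto simp: y)
  moreover have "ramp_deriv c z = max 0 (1 - y\<^sup>2) * y * (8 / c)" by (simp add: ramp_deriv_def y_def)
  ultimately show "ramp_deriv c z \<le> 8 / c" by simp
qed

text \<open>\<open>1 - z\<^sup>2\<close> is the squared sine of the polar angle; adding
  \<open>e\<close> makes the power differentiable across the axis \<open>z = 1\<close>.\<close>

definition profile :: "real \<Rightarrow> real \<Rightarrow> real \<Rightarrow> real \<Rightarrow> real" where
  "profile \<beta> e c z = (1 - z\<^sup>2 + e) powr (- \<beta> / 2) * ramp c z"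

definition profile_deriv :: "real \<Rightarrow> real \<Rightarrow> real \<Rightarrow> real \<Rightarrow> real" where
  "profile_deriv \<beta> e c z = \<beta> * z * (1 - z\<^sup>2 + e) powr (- \<beta> / 2 - 1) * ramp c z
    + (1 - z\<^sup>2 + e) powr (- \<beta> / 2) * ramp_deriv c z"

lemma profile_arg_pos:
  fixes z :: real
  assumes "0 < e" "\<bar>z\<bar> \<le> 1"
  shows "0 < 1 - z\<^sup>2 + e"
proof -
  have "z\<^sup>2 \<le> 1" using assms by (simp add: abs_square_le_1)
  then show ?thesis using assms by simp
qed

lemma profile_has_derivative:
  assumes "0 < e" "\<bar>z\<bar> \<le> 1"
  shows "(profile \<beta> e c has_real_derivative profile_deriv \<beta> e c z) (at z)"
proof -
  have "((\<lambda>z. (1 - z\<^sup>2 + e) powr (- \<beta> / 2)) has_real_derivative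
      (- \<beta> / 2) * (1 - z\<^sup>2 + e) powr (- \<beta> / 2 - 1) * (- (2 * z))) (at z)"
    by (rule DERIV_chain2[where f = "\<lambda>y. y powr (- \<beta> / 2)" and g = "\<lambda>z. 1 - z\<^sup>2 + e",
          OF has_real_derivative_powr[OF profile_arg_pos[OF assms]]])
      (auto intro!: derivative_eq_intros)
  then show ?thesis
    unfolding profile_def[abs_def]
    by (rule DERIV_cong[OF DERIV_mult[OF _ ramp_has_derivative]]) (simp add: profile_deriv_def algebra_simps)
qed

lemma continuous_on_profile:
  assumes "0 < e"
  shows "continuous_on {-1..1} (profile \<beta> e c)" "continuous_on {-1..1} (profile_deriv \<beta> e c)"
proof -
  have ne: "1 - z\<^sup>2 + e \<noteq> 0" if "z \<in> {-1..1}" for z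
  proof -
    have "\<bar>z\<bar> \<le> 1" using that by auto
    from profile_arg_pos[OF assms this] show ?thesis by simp
  qed
  have r: "continuous_on {-1..1} (ramp c)"
    by (intro continuous_at_imp_continuous_on ballI DERIV_isCont[OF ramp_has_derivative])
  have r': "continuous_on {-1..1} (ramp_deriv c)"
    unfolding ramp_deriv_def[abs_def] divide_inverse by (intro continuous_intros)
  show "continuous_on {-1..1} (profile \<beta> e c)" "continuous_on {-1..1} (profile_deriv \<beta> e c)"
    unfolding profile_def[abs_def] profile_deriv_def[abs_def]
    by (intro continuous_intros continuous_on_powr r r'; use ne in auto)+
qed

text \<open>A regularisation of the critical power \<open>(sin \<theta>) powr (- \<beta>)\<close> near the axis. Being a product of a
  radial and an angular factor, it has a tangential gradient that does not involve the derivative of the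
  radial factor.\<close>
definition test_fun :: "'n::finite \<Rightarrow> real \<Rightarrow> real \<Rightarrow> real \<Rightarrow> real^'n \<Rightarrow> real" where
  "test_fun k \<beta> e c x = shell (norm x) * profile \<beta> e c (x $ k / norm x)"

definition test_grad :: "'n::finite \<Rightarrow> real \<Rightarrow> real \<Rightarrow> real \<Rightarrow> real^'n \<Rightarrow> real^'n" where
  "test_grad k \<beta> e c x = (shell_deriv (norm x) * profile \<beta> e c (x $ k / norm x) / norm x) *\<^sub>R x
     + (shell (norm x) * profile_deriv \<beta> e c (x $ k / norm x)) *\<^sub>R cos_grad k x"

lemma C1c_test_fun:
  fixes k :: "'n::finite"
  assumes e: "0 < e" and c: "0 < c"
  shows "C1c (half_space k) (test_fun k \<beta> e c) (test_grad k \<beta> e c)"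
proof (rule C1c_I)
  \<comment> \<open>A truncated cone containing the support: \<open>z \<ge> c / 2\<close> and
    \<open>1 \<le> norm x \<le> 4\<close>. The first condition is multiplied out so that it is
    visibly closed.\<close>
  define K where "K = {x :: real^'n. c / 2 * norm x \<le> x $ k} \<inter> (cball 0 4 \<inter> {x. 1 \<le> norm x})"
  have zero: "test_fun k \<beta> e c x = 0" "test_grad k \<beta> e c x = 0" if "norm x \<le> 1" for x
    using that shell_eq_0[of "norm x"] by (simp_all add: test_fun_def test_grad_def)
  have z1: "\<bar>x $ k / norm x\<bar> \<le> 1" for x :: "real^'n" by (rule cos_abs_le_1)
  show "(test_fun k \<beta> e c has_derivative (\<lambda>h. test_grad k \<beta> e c x \<bullet> h)) (at x)" for x
  proof (cases "x = 0")
    case True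
    have "(test_fun k \<beta> e c has_derivative (\<lambda>h. 0)) (at x)"
    proof (rule has_derivative_transform_within_open)
      show "((\<lambda>x. 0) has_derivative (\<lambda>h. 0)) (at x)" by simp
      show "open (ball (0 :: real^'n) 1)" "x \<in> ball 0 1" using True by auto
      show "0 = test_fun k \<beta> e c y" if "y \<in> ball 0 1" for y using that by (simp add: zero)
    qed
    then show ?thesis using True by (simp add: zero)
  next
    case False
    show ?thesis
      unfolding test_fun_def[abs_def] test_grad_def
      by (rule polar_product_has_derivative[OF False shell_has_derivative profile_has_derivative[OF e z1]])
  qed
  have "continuous_on (- {0} \<union> ball 0 1) (test_grad k \<beta> e c)"
  proof (rule continuous_on_open_Un)
    have cz: "continuous_on (- {0}) (\<lambda>x :: real^'n. x $ k / norm x)" by (rule continuous_on_cos) simp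
    have im: "(\<lambda>x :: real^'n. x $ k / norm x) ` (- {0}) \<subseteq> {-1..1}"
    proof (rule image_subsetI)
      fix x :: "real^'n"
      show "x $ k / norm x \<in> {-1..1}" unfolding atLeastAtMost_iff using z1[of x] by linarith
    qed
    have P: "continuous_on (- {0}) (\<lambda>x :: real^'n. profile \<beta> e c (x $ k / norm x))"
      "continuous_on (- {0}) (\<lambda>x :: real^'n. profile_deriv \<beta> e c (x $ k / norm x))"
      using continuous_on_compose2[OF continuous_on_profile(1)[OF e] cz im]
        continuous_on_compose2[OF continuous_on_profile(2)[OF e] cz im] by auto
    have S: "continuous_on A (\<lambda>x :: real^'n. shell (norm x))" "continuous_on A (\<lambda>x :: real^'n. shell_deriv (norm x))" for A
      unfolding shell_def shell_deriv_def by (intro continuous_intros)+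
    show "continuous_on (- {0}) (test_grad k \<beta> e c)"
      unfolding test_grad_def[abs_def]
      by (intro continuous_on_add continuous_on_scaleR continuous_on_divide continuous_on_mult P S
          continuous_on_cos_grad continuous_on_norm continuous_on_id) auto
    have "continuous_on (ball 0 1) (\<lambda>x. 0 :: real^'n)" by simp
    then show "continuous_on (ball 0 1) (test_grad k \<beta> e c)"
      by (rule continuous_on_eq) (simp add: zero)
  qed auto
  moreover have "- {0} \<union> ball 0 1 = (UNIV :: (real^'n) set)" by auto
  ultimately show "continuous_on UNIV (test_grad k \<beta> e c)" by simp
  have "closed {x :: real^'n. c / 2 * norm x \<le> x $ k}" "closed {x :: real^'n. 1 \<le> norm x}"
    by (intro closed_Collect_le continuous_intros)+
  then show "compact K" unfolding K_def
    by (intro closed_Int_compact compact_Int_closed compact_cball)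
  show "K \<subseteq> half_space k"
  proof
    fix x assume "x \<in> K"
    then have x: "c / 2 * norm x \<le> x $ k" "1 \<le> norm x" by (auto simp: K_def)
    have "0 < c / 2 * norm x" using x c by (intro mult_pos_pos) auto
    then show "x \<in> half_space k" using x by (simp add: half_space_def)
  qed
  fix x assume x: "x \<notin> K"
  show "test_fun k \<beta> e c x = 0"
  proof (cases "1 \<le> norm x \<and> norm x \<le> 4")
    case True
    then have "x $ k < c / 2 * norm x" using x by (auto simp: K_def)
    then have "x $ k / norm x \<le> c / 2" using True by (subst pos_divide_le_eq) auto
    then show ?thesis using ramp_bounds(3)[OF c] by (simp add: test_fun_def profile_def)
  next
    case False
    then show ?thesis using shell_eq_0[of "norm x"] by (auto simp: test_fun_def)
  qed
qed

lemma norm_tangential_test_grad: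
  fixes x :: "real^'n::finite"
  assumes "x \<noteq> 0"
  shows "norm (tangential x (test_grad k \<beta> e c x)) =
    shell (norm x) * \<bar>profile_deriv \<beta> e c (x $ k / norm x)\<bar> * (sqrt (1 - (x $ k / norm x)\<^sup>2) / norm x)"
proof -
  have "tangential x (s *\<^sub>R x + t *\<^sub>R cos_grad k x) = t *\<^sub>R cos_grad k x" for s t
    using assms by (simp add: tangential_def inner_add_left cos_grad_inner_self power2_norm_eq_inner[symmetric]
        power2_eq_square field_simps)
  then show ?thesis
    unfolding test_grad_def using shell_bounds(1)[of "norm x"]
    by (simp add: norm_cos_grad[OF assms] abs_mult)
qed

text \<open>For \<open>z \<le> c\<close> the base \<open>1 - z\<^sup>2 + e\<close> is at least
  \<open>1 - c\<^sup>2\<close>, so the bound does not depend on \<open>e\<close>: this region adds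
  only a bounded amount of energy. The 6 bounds \<open>shell\<close> and \<open>8 / c\<close> bounds
  \<open>ramp_deriv\<close>.\<close>

lemma tangential_test_grad_le_far:
  fixes x :: "real^'n::finite"
  assumes e: "0 < e" and c: "0 < c" "c < 1" and \<beta>: "0 \<le> \<beta>" and x: "x \<in> half_space k" "x $ k / norm x \<le> c"
  shows "norm (tangential x (test_grad k \<beta> e c x))
    \<le> 6 * (\<beta> * (1 - c\<^sup>2) powr (- \<beta> / 2 - 1) + (1 - c\<^sup>2) powr (- \<beta> / 2) * (8 / c)) * indicator (cball 0 4) x"
proof (cases "1 \<le> norm x \<and> norm x \<le> 4")
  case False
  have "shell (norm x) = 0" using False by (intro shell_eq_0) auto
  then show ?thesis using half_space_nonzero[OF x(1)] \<beta> c by (simp add: norm_tangential_test_grad)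
next
  case True
  define z q where "z = x $ k / norm x" and "q = 1 - z\<^sup>2 + e"
  have z: "0 < z" "z \<le> c" using half_space_cos_pos[OF x(1)] x(2) by (auto simp: z_def)
  have "z\<^sup>2 \<le> c\<^sup>2" using z by (intro power_mono) auto
  then have q: "1 - c\<^sup>2 \<le> q" using e by (simp add: q_def)
  have c2: "0 < 1 - c\<^sup>2" using c by (simp add: power_less_one_iff)
  have r: "0 \<le> ramp c z" "ramp c z \<le> 1" "0 \<le> ramp_deriv c z" "ramp_deriv c z \<le> 8 / c"
    using ramp_bounds[OF c(1), of z] z by auto
  have A: "q powr s \<le> (1 - c\<^sup>2) powr s" if "s \<le> 0" for s
    using q c2 that by (intro powr_mono2') auto
  have "\<bar>profile_deriv \<beta> e c z\<bar> = \<beta> * z * q powr (- \<beta> / 2 - 1) * ramp c z + q powr (- \<beta> / 2) * ramp_deriv c z"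
    unfolding profile_deriv_def q_def[symmetric] using r z \<beta> by (intro abs_of_nonneg add_nonneg_nonneg mult_nonneg_nonneg) auto
  also have "\<dots> \<le> \<beta> * 1 * (1 - c\<^sup>2) powr (- \<beta> / 2 - 1) * 1 + (1 - c\<^sup>2) powr (- \<beta> / 2) * (8 / c)"
    using r z \<beta> c A[of "- \<beta> / 2 - 1"] A[of "- \<beta> / 2"]
    by (intro add_mono mult_mono mult_nonneg_nonneg) auto
  finally have P: "\<bar>profile_deriv \<beta> e c z\<bar> \<le> \<beta> * (1 - c\<^sup>2) powr (- \<beta> / 2 - 1) + (1 - c\<^sup>2) powr (- \<beta> / 2) * (8 / c)" by simp
  have s: "sqrt (1 - z\<^sup>2) / norm x \<le> 1"
  proof -
    have "sqrt (1 - z\<^sup>2) \<le> 1" by (simp add: real_sqrt_le_1_iff)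
    then have "sqrt (1 - z\<^sup>2) \<le> norm x" using True by linarith
    then have "sqrt (1 - z\<^sup>2) / norm x \<le> norm x / norm x" by (rule divide_right_mono) simp
    also have "norm x / norm x = 1" using True by auto
    finally show ?thesis .
  qed
  have s0: "0 \<le> sqrt (1 - z\<^sup>2) / norm x" using \<open>z\<^sup>2 \<le> c\<^sup>2\<close> c2 by simp
  have "norm (tangential x (test_grad k \<beta> e c x)) = shell (norm x) * \<bar>profile_deriv \<beta> e c z\<bar> * (sqrt (1 - z\<^sup>2) / norm x)"
    using norm_tangential_test_grad[OF half_space_nonzero[OF x(1)]] by (simp add: z_def)
  also have "\<dots> \<le> 6 * (\<beta> * (1 - c\<^sup>2) powr (- \<beta> / 2 - 1) + (1 - c\<^sup>2) powr (- \<beta> / 2) * (8 / c)) * 1"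
    using shell_bounds(1,2)[of "norm x"] P s s0 \<beta> c
    by (intro mult_mono mult_nonneg_nonneg add_nonneg_nonneg) auto
  finally show ?thesis using True by simp
qed

text \<open>The denominator is the distance to the axis. Where the ramp is constant only the power
  is differentiated, and the regularisation can only help: with \<open>s\<close> the sine and
  \<open>s\<^sup>2 \<le> q\<close>, the factor \<open>z * s / q\<close> is at most
  \<open>1 / s\<close>.\<close>

lemma tangential_test_grad_le_near:
  fixes x :: "real^'n::finite"
  assumes e: "0 < e" and c: "0 < c" and \<beta>: "0 \<le> \<beta>" and x: "x \<in> half_space k" "c < x $ k / norm x"
  shows "norm (tangential x (test_grad k \<beta> e c x))
    \<le> \<beta> * (\<bar>test_fun k \<beta> e c x\<bar> / (sqrt (1 - (x $ k / norm x)\<^sup>2) * norm x))"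
proof -
  define z q s where "z = x $ k / norm x" and "q = 1 - z\<^sup>2 + e" and "s = sqrt (1 - z\<^sup>2)"
  have z1: "\<bar>z\<bar> \<le> 1" unfolding z_def by (rule cos_abs_le_1)
  then have zz: "z\<^sup>2 \<le> 1" by (simp add: abs_square_le_1)
  have "c < z" using x(2) by (simp add: z_def)
  then have z: "0 < z" "z \<le> 1" "c \<le> z" using z1 c by linarith+
  have q: "0 < q" "s\<^sup>2 \<le> q" using zz e by (auto simp: q_def s_def)
  have s0: "0 \<le> s" using zz by (simp add: s_def)
  have x0: "x \<noteq> 0" using x(1) by (rule half_space_nonzero)
  have P: "\<bar>profile_deriv \<beta> e c z\<bar> = \<beta> * z * q powr (- \<beta> / 2 - 1)"
    using ramp_bounds(4,5)[OF c z(3)] z \<beta> by (simp add: profile_deriv_def q_def[symmetric] abs_mult)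
  have T: "\<bar>test_fun k \<beta> e c x\<bar> = shell (norm x) * q powr (- \<beta> / 2)"
    unfolding test_fun_def z_def[symmetric] profile_def
    using ramp_bounds(4)[OF c z(3)] shell_bounds(1)[of "norm x"] by (simp add: q_def abs_mult)
  have N: "norm (tangential x (test_grad k \<beta> e c x)) = shell (norm x) * (\<beta> * z * q powr (- \<beta> / 2 - 1)) * (s / norm x)"
    using norm_tangential_test_grad[OF x0, of k \<beta> e c] by (simp add: z_def[symmetric] s_def P)
  show ?thesis
  \<comment> \<open>On the axis the tangential gradient vanishes, and the right-hand side is 0 by
    the convention for division by 0.\<close>
  proof (cases "s = 0")
    case True
    then show ?thesis unfolding N by (simp add: z_def[symmetric] s_def[symmetric])
  next
    case False
    then have s: "0 < s" using s0 by simp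
    have "z * (s / q) \<le> 1 * (1 / s)"
      using q s z by (intro mult_mono) (auto simp: field_simps power2_eq_square)
    then have "(shell (norm x) * \<beta> * q powr (- \<beta> / 2) / norm x) * (z * (s / q))
        \<le> (shell (norm x) * \<beta> * q powr (- \<beta> / 2) / norm x) * (1 / s)"
      using \<beta> shell_bounds(1)[of "norm x"] by (intro mult_left_mono) auto
    moreover have "q powr (- \<beta> / 2 - 1) = q powr (- \<beta> / 2) / q" using q by (simp add: powr_diff)
    ultimately show ?thesis
      unfolding N T z_def[symmetric] s_def[symmetric] by (simp add: mult_ac)
  qed
qed

section \<open>Comparison with the inverse distance to the axis\<close>

lemma norm_square_cart:
  fixes x :: "real^'n::finite"
  shows "(norm x)\<^sup>2 = (x $ k)\<^sup>2 + (\<Sum>i\<in>UNIV - {k}. (x $ i)\<^sup>2)"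
proof -
  have "(norm x)\<^sup>2 = (\<Sum>i\<in>UNIV. (x $ i)\<^sup>2)" by (simp add: norm_vec_def L2_set_def sum_nonneg)
  also have "\<dots> = (x $ k)\<^sup>2 + (\<Sum>i\<in>UNIV - {k}. (x $ i)\<^sup>2)" by (rule sum.remove) auto
  finally show ?thesis .
qed

text \<open>The left side is \<open>1 - d\<close> over the distance to the axis, and
  \<open>cos t0 < x $ k / norm x\<close> says that the polar angle is below \<open>t0\<close>. On
  the axis the left side is 0 by the convention for division by 0.\<close>

lemma zeta_ge_near_axis:
  fixes x :: "real^'n::finite"
  assumes p: "1 < p" "p < real n" and x: "x \<in> half_space k"
    and t0: "0 < t0" "t0 < pi/2"
      "\<forall>t. 0 < t \<and> t < t0 \<longrightarrow> (1 - d) / sin t \<le> (p - 1) / (real n - p) * eta_tT n p t"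
    and z: "cos t0 < x $ k / norm x"
  shows "(1 - d) / (sqrt (1 - (x $ k / norm x)\<^sup>2) * norm x) \<le> zeta n p k x / norm x"
proof (cases "x $ k / norm x = 1")
  case True
  have "(1 - d) / (sqrt (1 - (x $ k / norm x)\<^sup>2) * norm x) = 0" unfolding True by simp
  also have "0 \<le> zeta n p k x / norm x"
    using zeta_le_hardy_weight(1)[OF p x] by (intro divide_nonneg_nonneg) auto
  finally show ?thesis .
next
  case False
  define y where "y = x $ k / norm x"
  have x0: "x \<noteq> 0" using x by (rule half_space_nonzero)
  have "0 < y" "y \<le> 1" "y \<noteq> 1" unfolding y_def
    using half_space_cos_pos[OF x] order_trans[OF abs_ge_self cos_abs_le_1[of x k]] False by blast+
  then have y: "0 < y" "y < 1" by simp_all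
  have na: "\<not> (\<forall>i. i \<noteq> k \<longrightarrow> x $ i = 0)"
  proof
    assume "\<forall>i. i \<noteq> k \<longrightarrow> x $ i = 0"
    then have "(norm x)\<^sup>2 = (x $ k)\<^sup>2" by (simp add: norm_square_cart[of x k])
    then have "norm x = x $ k" using x by (simp add: half_space_def power2_eq_iff_nonneg less_imp_le)
    then show False using False x by (simp add: half_space_def)
  qed
  have arc: "0 < arccos y" "arccos y < pi/2"
    using y arccos_less_mono[of 1 y] arccos_less_mono[of y 0] by (auto simp: arccos_0)
  have "arccos y < arccos (cos t0)" using y z t0 by (subst arccos_less_mono) (auto simp: y_def abs_le_iff)
  then have "arccos y < t0" using t0 by (simp add: arccos_cos)
  then have "(1 - d) / sin (arccos y) \<le> (p - 1) / (real n - p) * eta_tT n p (arccos y)" using t0 arc by auto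
  moreover have "sin (arccos y) = sqrt (1 - y\<^sup>2)" using y by (intro sin_arccos) auto
  moreover have "zeta n p k x = (p - 1) / (real n - p) * eta_tT n p (arccos y)"
  proof -
    have "polar_angle k (x /\<^sub>R norm x) = arccos y"
      by (simp add: polar_angle_def y_def divide_inverse mult.commute)
    then show ?thesis using na arc unfolding zeta_def rho_def by auto
  qed
  ultimately have "(1 - d) / sqrt (1 - y\<^sup>2) \<le> zeta n p k x" by simp
  then have "(1 - d) / sqrt (1 - y\<^sup>2) / norm x \<le> zeta n p k x / norm x" by (rule divide_right_mono) simp
  then show ?thesis by (simp add: y_def)
qed

text \<open>Boxes stand in for dyadic shells around the axis: length 1 along it, and distance from
  it comparable to \<open>c / 2 ^ j\<close>. Their volume is a plain product, and 3/4, being larger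
  than 1/2, separates consecutive scales.\<close>

definition dyadic_box :: "'n::finite \<Rightarrow> real \<Rightarrow> nat \<Rightarrow> (real^'n) set" where
  "dyadic_box k c j = cbox (\<chi> i. if i = k then 2 else 3 / 4 * (c / 2 ^ j)) (\<chi> i. if i = k then 3 else c / 2 ^ j)"

lemma dyadic_box_iff:
  "x \<in> dyadic_box k c j \<longleftrightarrow> 2 \<le> x $ k \<and> x $ k \<le> 3 \<and> (\<forall>i. i \<noteq> k \<longrightarrow> 3 / 4 * (c / 2 ^ j) \<le> x $ i \<and> x $ i \<le> c / 2 ^ j)"
  unfolding dyadic_box_def mem_box_cart by (auto split: if_splits)

lemma emeasure_dyadic_box:
  fixes k :: "'n::finite"
  assumes n: "CARD('n) = n + 1" and c: "0 < c"
  shows "emeasure lborel (dyadic_box k c j) = ennreal ((c / 4 / 2 ^ j) ^ n)"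
proof -
  let ?a = "\<chi> i. if i = k then 2 else 3 / 4 * (c / 2 ^ j)" and ?b = "\<chi> i. if i = k then 3 else c / 2 ^ j"
  have "?a \<in> cbox ?a ?b" using c by (auto simp: mem_box_cart field_simps)
  then have "cbox ?a ?b \<noteq> {}" by blast
  then have "measure lborel (cbox ?a ?b) = (\<Prod>i\<in>UNIV. ?b $ i - ?a $ i)"
    by (rule content_cbox_cart)
  also have "\<dots> = (\<Prod>i\<in>UNIV. if i = k then 1 else c / 4 / 2 ^ j)" by (intro prod.cong) (auto simp: field_simps)
  also have "\<dots> = 1 * (\<Prod>i\<in>UNIV - {k}. c / 4 / 2 ^ j)"
    by (subst prod.remove[of _ k]) (auto intro!: prod.cong)
  also have "\<dots> = (c / 4 / 2 ^ j) ^ n" using n by (simp add: card_Diff_singleton)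
  finally show ?thesis
    unfolding dyadic_box_def using emeasure_lborel_cbox_finite[of ?a ?b]
    by (subst emeasure_eq_ennreal_measure) auto
qed

text \<open>A single coordinate other than \<open>k\<close>, which exists since
  \<open>1 \<le> n\<close>, decides: at the finer scale it is at most half of
  \<open>c / 2 ^ i\<close>, at the coarser one at least three quarters of it.\<close>

lemma dyadic_box_disjoint:
  fixes k :: "'n::finite"
  assumes n: "CARD('n) = n + 1" "1 \<le> n" and c: "0 < c" and x: "x \<in> dyadic_box k c i" "x \<in> dyadic_box k c j"
  shows "i = j"
proof -
  have "card (UNIV - {k} :: 'n set) = n" using n by (simp add: card_Diff_singleton)
  then have "UNIV - {k} \<noteq> ({} :: 'n set)" using n by (metis card.empty not_one_le_zero)
  then obtain m where m: "m \<noteq> k" by blast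
  have *: False if "i < j" "x \<in> dyadic_box k c i" "x \<in> dyadic_box k c j" for i j
  proof -
    have "3 / 4 * (c / 2 ^ i) \<le> c / 2 ^ j" using that m by (auto simp: dyadic_box_iff intro: order_trans)
    also have "c / 2 ^ j \<le> c / 2 ^ Suc i" using c that by (intro divide_left_mono power_increasing) auto
    finally show False using c by (simp add: field_simps)
  qed
  show ?thesis using *[of i j] *[of j i] x by (cases i j rule: linorder_cases) auto
qed

text \<open>The squared sine of the polar angle is \<open>S / (norm x)\<^sup>2\<close>, with
  \<open>S\<close> the squared distance to the axis. \<open>S\<close> is at most \<open>n\<close>
  times the square of \<open>c / 2 ^ j\<close>, and \<open>real n * c \<le> 1 / 2\<close> absorbs
  both \<open>n\<close> and one factor \<open>c\<close>.\<close>

lemma dyadic_box_geometry: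
  fixes x :: "real^'n::finite"
  assumes n: "CARD('n) = n + 1" "1 \<le> n" and c: "0 < c" "real n * c \<le> 1 / 2" and x: "x \<in> dyadic_box k c j"
  shows "x \<in> half_space k" "2 \<le> norm x" "norm x \<le> 7/2"
    "0 < 1 - (x $ k / norm x)\<^sup>2" "1 - (x $ k / norm x)\<^sup>2 \<le> c / 8 / 4 ^ j"
proof -
  have xk: "2 \<le> x $ k" "x $ k \<le> 3" and xi: "\<And>i. i \<noteq> k \<Longrightarrow> 0 < x $ i \<and> x $ i \<le> c / 2 ^ j"
  proof -
    show "2 \<le> x $ k" "x $ k \<le> 3" using x by (auto simp: dyadic_box_iff)
    fix i assume i: "i \<noteq> k"
    have "0 < 3 / 4 * (c / 2 ^ j)" using c by simp
    then show "0 < x $ i \<and> x $ i \<le> c / 2 ^ j" using x i unfolding dyadic_box_iff by (metis order_less_le_trans)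
  qed
  show "x \<in> half_space k" using xk by (simp add: half_space_def)
  show r2: "2 \<le> norm x" using component_le_norm_cart[of x k] xk by simp
  have card: "card (UNIV - {k} :: 'n set) = n" using n by (simp add: card_Diff_singleton)
  define S where "S = (\<Sum>i\<in>UNIV - {k}. (x $ i)\<^sup>2)"
  have ne: "UNIV - {k} \<noteq> ({} :: 'n set)" using n card by (metis card.empty not_one_le_zero)
  have S0: "0 < S" unfolding S_def using ne xi by (intro sum_pos) (auto simp: less_imp_neq[symmetric])
  have "S \<le> (\<Sum>i\<in>UNIV - {k}. (c / 2 ^ j)\<^sup>2)"
    unfolding S_def by (intro sum_mono power_mono) (use xi in \<open>auto simp: less_imp_le\<close>)
  also have "\<dots> = (real n * c) * c / 4 ^ j"
    using card by (simp add: power_divide power2_eq_square power_mult_distrib[symmetric])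
  also have "\<dots> \<le> 1 / 2 * c / 4 ^ j" using c by (intro divide_right_mono mult_right_mono) auto
  finally have S1: "S \<le> c / 2 / 4 ^ j" by simp
  have "c / 2 / 4 ^ j \<le> c / 2" using c by (simp add: field_simps)
  also have "c \<le> real n * c" using n c by simp
  finally have S2: "S \<le> 1" using S1 c by linarith
  have N: "(norm x)\<^sup>2 = (x $ k)\<^sup>2 + S" unfolding S_def by (rule norm_square_cart)
  have "(norm x)\<^sup>2 \<le> 3\<^sup>2 + 1" unfolding N using xk S2 by (intro add_mono power_mono) auto
  also have "\<dots> \<le> (7/2)\<^sup>2" by (simp add: power2_eq_square)
  finally show "norm x \<le> 7/2" by (rule power2_le_imp_le) simp
  have r0: "0 < (norm x)\<^sup>2" using r2 by auto
  have eq: "1 - (x $ k / norm x)\<^sup>2 = S / (norm x)\<^sup>2"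
    using r0 N by (simp add: power_divide field_simps)
  show "0 < 1 - (x $ k / norm x)\<^sup>2" unfolding eq using S0 r0 by simp
  have "4 \<le> (norm x)\<^sup>2" using power_mono[OF r2, of 2] by simp
  then have "S / (norm x)\<^sup>2 \<le> S / 4" using S0 by (intro divide_left_mono) auto
  also have "\<dots> \<le> c / 8 / 4 ^ j" using S1 by simp
  finally show "1 - (x $ k / norm x)\<^sup>2 \<le> c / 8 / 4 ^ j" unfolding eq .
qed

text \<open>For \<open>j \<le> J\<close> the regularisation \<open>1 / 4 ^ J\<close> does not exceed
  the scale \<open>1 / 4 ^ j\<close>, so the base of the power is at most \<open>2 / 4 ^ j\<close>.
  The distance to the axis is at most \<open>4 / 2 ^ j\<close>, which raises the exponent from
  \<open>\<beta>\<close> to \<open>\<beta> + 1\<close>.\<close>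

lemma test_fun_ge_on_dyadic_box:
  fixes x :: "real^'n::finite"
  assumes n: "CARD('n) = n + 1" "1 \<le> n" and c: "0 < c" "real n * c \<le> 1 / 2" "c \<le> 1 - z1\<^sup>2" and z1: "0 < z1" "z1 < 1"
    and x: "x \<in> dyadic_box k c j" and j: "j \<le> J" and \<beta>: "0 \<le> \<beta>"
  shows "z1 < x $ k / norm x"
    "2 powr (- \<beta> / 2) / 4 * (2 ^ j) powr (\<beta> + 1) \<le>
      \<bar>test_fun k \<beta> (1 / 4 ^ J) z1 x\<bar> / (sqrt (1 - (x $ k / norm x)\<^sup>2) * norm x)"
proof -
  note g = dyadic_box_geometry[OF n c(1,2) x]
  define z q where "z = x $ k / norm x" and "q = 1 - z\<^sup>2 + 1 / 4 ^ J"
  define a :: real where "a = 2 ^ j"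
  have a: "1 \<le> a" "(4::real) ^ j = a\<^sup>2" by (auto simp: a_def power_mult[symmetric] power2_eq_square power_mult_distrib[symmetric])
  have z0: "0 < z" using half_space_cos_pos[OF g(1)] by (simp add: z_def)
  have z: "0 < 1 - z\<^sup>2" "1 - z\<^sup>2 \<le> c / 8 / a\<^sup>2" using g(4,5) by (auto simp: z_def a)
  have "c / 8 / a\<^sup>2 \<le> c / 8" using a c by (simp add: field_simps)
  then have "z1\<^sup>2 < z\<^sup>2" using z c by linarith
  then have zz: "z1 < z" by (rule power2_less_imp_less[OF _ less_imp_le[OF z0]])
  then show "z1 < x $ k / norm x" by (simp add: z_def)
  have c1: "c \<le> 1" using c(3) zero_le_power2[of z1] by linarith
  have "c / 8 / a\<^sup>2 \<le> 1 / a\<^sup>2" using c1 by (intro divide_right_mono) auto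
  then have za: "1 - z\<^sup>2 \<le> 1 / a\<^sup>2" using z by linarith
  have "1 / 4 ^ J \<le> 1 / (4::real) ^ j" using j by (intro divide_left_mono power_increasing) auto
  then have q: "q \<le> 2 / a\<^sup>2" using za by (simp add: q_def a)
  have q0: "0 < q" using z by (simp add: q_def add_pos_nonneg)
  have A: "2 powr (- \<beta> / 2) * a powr \<beta> \<le> q powr (- \<beta> / 2)"
  proof -
    have "2 powr (- \<beta> / 2) * a powr \<beta> = (2 / a\<^sup>2) powr (- \<beta> / 2)"
    proof -
      have "(2 / a\<^sup>2) powr (- \<beta> / 2) = 2 powr (- \<beta> / 2) / (a powr 2) powr (- \<beta> / 2)"
        using a by (simp add: powr_divide)
      also have "(a powr 2) powr (- \<beta> / 2) = a powr (- \<beta>)" unfolding powr_powr by simp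
      finally show ?thesis by (simp add: powr_minus_divide)
    qed
    also have "\<dots> \<le> q powr (- \<beta> / 2)" using q q0 \<beta> by (intro powr_mono2') auto
    finally show ?thesis .
  qed
  have T: "\<bar>test_fun k \<beta> (1 / 4 ^ J) z1 x\<bar> = shell (norm x) * q powr (- \<beta> / 2)"
    unfolding test_fun_def z_def[symmetric] profile_def
    using ramp_bounds(4)[OF z1(1), of z] zz shell_bounds(1)[of "norm x"] by (simp add: q_def abs_mult)
  have "1 * (2 powr (- \<beta> / 2) * a powr \<beta>) \<le> shell (norm x) * q powr (- \<beta> / 2)"
    using shell_bounds[of "norm x"] g(2,3) A by (intro mult_mono) auto
  then have T1: "2 powr (- \<beta> / 2) * a powr \<beta> \<le> \<bar>test_fun k \<beta> (1 / 4 ^ J) z1 x\<bar>" unfolding T by simp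
  have s: "0 < sqrt (1 - z\<^sup>2)" using z by simp
  have "sqrt (1 - z\<^sup>2) \<le> sqrt ((1 / a)\<^sup>2)" using za by (simp add: power_divide)
  then have s1: "sqrt (1 - z\<^sup>2) \<le> 1 / a" using a by simp
  have "sqrt (1 - z\<^sup>2) * norm x \<le> (1 / a) * 4" using s s1 g(2,3) a(1) by (intro mult_mono) auto
  then have D: "sqrt (1 - z\<^sup>2) * norm x \<le> 4 / a" by simp
  have "2 powr (- \<beta> / 2) / 4 * a powr (\<beta> + 1) = (2 powr (- \<beta> / 2) * a powr \<beta>) / (4 / a)"
    using a by (simp add: powr_add)
  also have "\<dots> \<le> \<bar>test_fun k \<beta> (1 / 4 ^ J) z1 x\<bar> / (sqrt (1 - z\<^sup>2) * norm x)"
  proof (rule frac_le)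
    show "0 < sqrt (1 - z\<^sup>2) * norm x" using s g(2) by (intro mult_pos_pos) auto
  qed (use T1 D in auto)
  finally show "2 powr (- \<beta> / 2) / 4 * (2 ^ j) powr (\<beta> + 1) \<le>
      \<bar>test_fun k \<beta> (1 / 4 ^ J) z1 x\<bar> / (sqrt (1 - (x $ k / norm x)\<^sup>2) * norm x)"
    by (simp add: a_def z_def)
qed

text \<open>The quantity to which both sides are compared in a cone around the axis: by
  \<open>zeta_ge_near_axis\<close> it bounds the weighted integral from below for a suitable
  \<open>z1\<close>, and \<open>(\<beta> / (1 - d)) powr p\<close> times it bounds the gradient
  energy of the cone from above.\<close>

definition axis_energy :: "'n::finite \<Rightarrow> real \<Rightarrow> real \<Rightarrow> real \<Rightarrow> real \<Rightarrow> real \<Rightarrow> ennreal" where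
  "axis_energy k p \<beta> e z1 d = (\<integral>\<^sup>+x\<in>{x \<in> half_space k. z1 < x $ k / norm x}.
     ennreal ((\<bar>test_fun k \<beta> e z1 x\<bar> * ((1 - d) / (sqrt (1 - (x $ k / norm x)\<^sup>2) * norm x))) powr p) \<partial>lborel)"

text \<open>Every dyadic box up to the regularisation scale carries the same amount of energy, so the
  energy diverges logarithmically.\<close>
lemma axis_energy_ge:
  fixes k :: "'n::finite" and p :: real
  assumes n: "CARD('n) = n + 1" "1 \<le> n" and p: "1 < p" "p < real n" and z1: "0 < z1" "z1 < 1" and d: "d < 1"
  obtains c1 where "0 < c1" "\<And>J. ennreal (real J * c1) \<le> axis_energy k p ((real n - p) / p) (1 / 4 ^ J) z1 d"
proof -
  define \<beta> where "\<beta> = (real n - p) / p"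
  \<comment> \<open>This is the criticality of \<open>\<beta>\<close>: the integrand grows like
    \<open>(2 ^ j) ^ n\<close>, exactly compensating the volume of the box.\<close>
  have \<beta>: "0 \<le> \<beta>" "(\<beta> + 1) * p = real n" using p by (auto simp: \<beta>_def field_simps)
  \<comment> \<open>The first bound is the smallness required by \<open>dyadic_box_geometry\<close>;
    the second puts every box inside the cone \<open>z1 < x $ k / norm x\<close>.\<close>
  define c where "c = min (1 / (2 * real n)) (1 - z1\<^sup>2)"
  have "z1\<^sup>2 < 1" using z1 by (simp add: power_less_one_iff)
  then have c: "0 < c" "c \<le> 1 - z1\<^sup>2" using n by (auto simp: c_def)
  have "real n * c \<le> real n * (1 / (2 * real n))" by (intro mult_left_mono) (auto simp: c_def)
  then have cn: "real n * c \<le> 1 / 2" using n by simp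
  define \<kappa> where "\<kappa> = ((1 - d) * (2 powr (- \<beta> / 2) / 4)) powr p"
  have \<kappa>: "0 < \<kappa>" using d by (simp add: \<kappa>_def)
  let ?S = "{x \<in> half_space k. z1 < x $ k / norm x}"
  show ?thesis
  proof (rule that[of "\<kappa> * (c / 4) ^ n"])
    show "0 < \<kappa> * (c / 4) ^ n" using \<kappa> c by simp
    fix J :: nat
    let ?R = "\<lambda>x. (\<bar>test_fun k \<beta> (1 / 4 ^ J) z1 x\<bar> * ((1 - d) / (sqrt (1 - (x $ k / norm x)\<^sup>2) * norm x))) powr p"
    have R: "\<kappa> * (2 ^ j) ^ n \<le> ?R x" "x \<in> ?S" if x: "x \<in> dyadic_box k c j" and j: "j < J" for x j
    proof -
      note t = test_fun_ge_on_dyadic_box[OF n c(1) cn c(2) z1 x less_imp_le[OF j] \<beta>(1)]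
      show "x \<in> ?S" using t(1) dyadic_box_geometry(1)[OF n c(1) cn x] by simp
      have "\<kappa> * (2 ^ j) ^ n = ((1 - d) * (2 powr (- \<beta> / 2) / 4) * (2 ^ j) powr (\<beta> + 1)) powr p"
      proof -
        have "((2 ^ j) powr (\<beta> + 1)) powr p = (2 ^ j :: real) ^ n"
          unfolding powr_powr \<beta>(2) by (rule powr_realpow) simp
        then show ?thesis
          using d powr_mult[of "(1 - d) * (2 powr (- \<beta> / 2) / 4)" "(2 ^ j) powr (\<beta> + 1)" p] by (simp add: \<kappa>_def)
      qed
      also have "\<dots> = ((1 - d) * (2 powr (- \<beta> / 2) / 4 * (2 ^ j) powr (\<beta> + 1))) powr p" by (simp only: mult.assoc)
      also have "\<dots> \<le> ((1 - d) * (\<bar>test_fun k \<beta> (1 / 4 ^ J) z1 x\<bar> / (sqrt (1 - (x $ k / norm x)\<^sup>2) * norm x))) powr p"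
        using d p t(2) by (intro powr_mono2 mult_left_mono mult_nonneg_nonneg) auto
      also have "\<dots> = ?R x" by (simp add: mult.commute)
      finally show "\<kappa> * (2 ^ j) ^ n \<le> ?R x" .
    qed
    have "ennreal (real J * (\<kappa> * (c / 4) ^ n)) = (\<Sum>j<J. ennreal (\<kappa> * (2 ^ j) ^ n) * emeasure lborel (dyadic_box k c j))"
    proof -
      have "ennreal (\<kappa> * (2 ^ j) ^ n) * emeasure lborel (dyadic_box k c j) = ennreal (\<kappa> * (c / 4) ^ n)" for j
      proof -
        have "\<kappa> * (2 ^ j) ^ n * (c / 4 / 2 ^ j) ^ n = \<kappa> * (c / 4) ^ n"
          by (simp add: power_divide)
        then show ?thesis using \<kappa> c by (simp add: emeasure_dyadic_box[OF n(1) c(1)] ennreal_mult[symmetric])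
      qed
      then show ?thesis using \<kappa> c by (simp add: ennreal_mult ennreal_of_nat_eq_real_of_nat)
    qed
    also have "\<dots> = (\<Sum>j<J. \<integral>\<^sup>+x. ennreal (\<kappa> * (2 ^ j) ^ n) * indicator (dyadic_box k c j) x \<partial>lborel)"
      by (intro sum.cong refl nn_integral_cmult_indicator[symmetric]) (simp add: dyadic_box_def)
    also have "\<dots> = (\<integral>\<^sup>+x. (\<Sum>j<J. ennreal (\<kappa> * (2 ^ j) ^ n) * indicator (dyadic_box k c j) x) \<partial>lborel)"
      by (rule nn_integral_sum[symmetric]) (simp add: dyadic_box_def)
    also have "\<dots> \<le> (\<integral>\<^sup>+x\<in>?S. ennreal (?R x) \<partial>lborel)"
    proof (rule nn_integral_mono)
      fix x :: "real^'n"
      show "(\<Sum>j<J. ennreal (\<kappa> * (2 ^ j) ^ n) * indicator (dyadic_box k c j) x) \<le> ennreal (?R x) * indicator ?S x"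
      proof (cases "\<exists>i<J. x \<in> dyadic_box k c i")
        case False
        then have "(\<Sum>j<J. ennreal (\<kappa> * (2 ^ j) ^ n) * indicator (dyadic_box k c j) x) = 0"
          by (intro sum.neutral) auto
        then show ?thesis by simp
      next
        case True
        then obtain i where i: "i < J" "x \<in> dyadic_box k c i" by auto
        have "(\<Sum>j<J. ennreal (\<kappa> * (2 ^ j) ^ n) * indicator (dyadic_box k c j) x)
            = (\<Sum>j<J. if j = i then ennreal (\<kappa> * (2 ^ j) ^ n) else 0)"
        proof (intro sum.cong refl)
          fix j
          have "x \<in> dyadic_box k c j \<longleftrightarrow> j = i" using dyadic_box_disjoint[OF n c(1) i(2)] i(2) by blast
          then show "ennreal (\<kappa> * (2 ^ j) ^ n) * indicator (dyadic_box k c j) x = (if j = i then ennreal (\<kappa> * (2 ^ j) ^ n) else 0)"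
            using i(2) by simp
        qed
        also have "\<dots> = ennreal (\<kappa> * (2 ^ i) ^ n)" using i by simp
        also have "\<dots> \<le> ennreal (?R x) * indicator ?S x"
          using R[OF i(2,1)] by (simp add: ennreal_leI)
        finally show ?thesis .
      qed
    qed
    finally show "ennreal (real J * (\<kappa> * (c / 4) ^ n)) \<le> axis_energy k p ((real n - p) / p) (1 / 4 ^ J) z1 d"
      by (simp add: axis_energy_def \<beta>_def)
  qed
qed

section \<open>Failure of every larger constant\<close>

lemma W1p0_C1c:
  fixes u :: "real^'n::finite \<Rightarrow> real"
  assumes "C1c \<Omega> u g" "0 < p"
  shows "W1p0 p \<Omega> u g"
  unfolding W1p0_def using assms C1c_D(4,5)[OF assms(1)]
  by (auto intro!: exI[of _ "\<lambda>_. u"] exI[of _ "\<lambda>_. g"])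

text \<open>With \<open>I\<close> the axis energy, the gradient side is at most
  \<open>q * I + K'\<close> and the weighted integral is at least \<open>I\<close>. Validity of
  \<open>C\<close> would give \<open>(C - q) * I \<le> K'\<close> with \<open>q < C\<close>, whereas
  \<open>I\<close> exceeds every bound as the regularisation is refined.\<close>

lemma hardy_constant_sharp:
  fixes k :: "'n::finite" and p :: real
  assumes n: "CARD('n) = n + 1" "1 \<le> n" and p: "1 < p" "p < real n" and C: "((real n - p) / p) powr p < C"
  shows "\<exists>u g. W1p0 p (half_space k) u g \<and>
     \<not> (ennreal C * (\<integral>\<^sup>+x\<in>half_space k. ennreal (\<bar>u x\<bar> powr p * (zeta n p k x) powr p / norm x powr p) \<partial>lborel)
       \<le> (\<integral>\<^sup>+x\<in>half_space k. ennreal (norm (tangential x (g x)) powr p) \<partial>lborel))"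
proof -
  define \<beta> where "\<beta> = (real n - p) / p"
  have \<beta>: "0 \<le> \<beta>" using p by (simp add: \<beta>_def)
  \<comment> \<open>\<open>\<beta> powr p\<close> is the claimed constant, and \<open>d\<close> is
    the fraction of the weight given up near the axis; it is taken so small that the resulting
    factor \<open>q\<close> stays below \<open>C\<close>.\<close>
  have "((\<lambda>d. (\<beta> / (1 - d)) powr p) \<longlongrightarrow> (\<beta> / (1 - 0)) powr p) (at_right 0)"
    using p by (intro tendsto_powr2 tendsto_intros) (auto simp: \<beta>_def)
  moreover have "(\<beta> / (1 - 0)) powr p < C" using C by (simp add: \<beta>_def)
  ultimately have "\<forall>\<^sub>F d in at_right 0. (\<beta> / (1 - d)) powr p < C" by (rule order_tendstoD(2))
  then obtain b where b: "0 < b" "\<And>d. 0 < d \<Longrightarrow> d < b \<Longrightarrow> (\<beta> / (1 - d)) powr p < C"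
    unfolding eventually_at_right_field by auto
  define d where "d = min b 1 / 2"
  have d: "0 < d" "d < 1" "d < b" using b by (auto simp: d_def)
  define q where "q = (\<beta> / (1 - d)) powr p"
  have q: "0 \<le> q" "q < C" using b(2)[OF d(1,3)] by (auto simp: q_def)
  obtain t0 where t0: "0 < t0" "t0 < pi/2"
    "\<forall>t. 0 < t \<and> t < t0 \<longrightarrow> (1 - d) / sin t \<le> (p - 1) / (real n - p) * eta_tT n p t"
    using eta_tT_near_0[OF p d(1)] by blast
  define z1 where "z1 = cos t0"
  have z1: "0 < z1" "z1 < 1"
    using t0 cos_gt_zero cos_monotone_0_pi[of 0 t0] by (auto simp: z1_def)
  obtain c1 where c1: "0 < c1" "\<And>J. ennreal (real J * c1) \<le> axis_energy k p \<beta> (1 / 4 ^ J) z1 d"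
    using axis_energy_ge[OF n p z1 d(2), of k] unfolding \<beta>_def by blast
  define K where "K = 6 * (\<beta> * (1 - z1\<^sup>2) powr (- \<beta> / 2 - 1) + (1 - z1\<^sup>2) powr (- \<beta> / 2) * (8 / z1))"
  have K: "0 \<le> K" unfolding K_def using \<beta> z1 by (intro mult_nonneg_nonneg add_nonneg_nonneg) auto
  define K' where "K' = K powr p * measure lborel (cball (0 :: real^'n) 4)"
  have K': "0 \<le> K'" by (simp add: K'_def)
  \<comment> \<open>Neither \<open>K'\<close> nor \<open>c1\<close> depends on the regularisation,
    so \<open>J\<close> can be chosen after them, with \<open>J * c1\<close> beyond
    \<open>K' / (C - q)\<close>.\<close>
  obtain J :: nat where J: "K' / (C - q) / c1 < real J" using reals_Archimedean2 by blast
  define e :: real where "e = 1 / 4 ^ J"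
  have e: "0 < e" by (simp add: e_def)
  let ?\<Omega> = "half_space k"
  define S where "S = {x \<in> half_space k. z1 < x $ k / norm x}"
  define u g where "u = test_fun k \<beta> e z1" and "g = test_grad k \<beta> e z1"
  have ug: "C1c ?\<Omega> u g" unfolding u_def g_def by (rule C1c_test_fun[OF e z1(1)])
  have [measurable]: "u \<in> borel_measurable borel" "g \<in> borel_measurable borel" using C1c_D(4,5)[OF ug] .
  have S_eq: "S = half_space k \<inter> {x. z1 < x $ k / norm x}" by (auto simp: S_def)
  have [measurable]: "S \<in> sets borel" unfolding S_eq by measurable
  define R where "R x = (\<bar>u x\<bar> * ((1 - d) / (sqrt (1 - (x $ k / norm x)\<^sup>2) * norm x))) powr p" for x
  have [measurable]: "R \<in> borel_measurable borel" unfolding R_def[abs_def] by measurable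
  define I where "I = (\<integral>\<^sup>+x\<in>S. ennreal (R x) \<partial>lborel)"
  have Ige: "ennreal (real J * c1) \<le> I"
    using c1(2)[of J] by (simp add: axis_energy_def I_def S_def R_def u_def e_def)
  let ?L = "\<integral>\<^sup>+x\<in>?\<Omega>. ennreal (norm (tangential x (g x)) powr p) \<partial>lborel"
  have upper: "?L \<le> ennreal q * I + ennreal K'"
  proof -
    have "?L \<le> (\<integral>\<^sup>+x. ennreal q * (ennreal (R x) * indicator S x) + ennreal (K powr p) * indicator (cball 0 4) x \<partial>lborel)"
    proof (rule nn_integral_mono)
      fix x
      show "ennreal (norm (tangential x (g x)) powr p) * indicator ?\<Omega> x
        \<le> ennreal q * (ennreal (R x) * indicator S x) + ennreal (K powr p) * indicator (cball 0 4) x"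
      proof (cases "x \<in> ?\<Omega>")
        case x: True
        show ?thesis
        proof (cases "x \<in> S")
          case True
          then have z: "z1 < x $ k / norm x" by (simp add: S_def)
          define m where "m = sqrt (1 - (x $ k / norm x)\<^sup>2) * norm x"
          have m: "0 \<le> m" unfolding m_def using cos_abs_le_1[of x k]
            by (intro mult_nonneg_nonneg) (auto simp: abs_square_le_1)
          have "norm (tangential x (g x)) \<le> \<beta> * (\<bar>u x\<bar> / m)"
            using tangential_test_grad_le_near[OF e z1(1) \<beta> x z] by (simp add: g_def u_def m_def)
          also have "\<dots> = \<beta> / (1 - d) * (\<bar>u x\<bar> * ((1 - d) / m))" using d by simp
          finally have "norm (tangential x (g x)) powr p \<le> (\<beta> / (1 - d) * (\<bar>u x\<bar> * ((1 - d) / m))) powr p"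
            using p by (intro powr_mono2) auto
          also have "\<dots> = q * R x"
            unfolding q_def R_def m_def[symmetric] using m d \<beta> by (intro powr_mult)
          finally show ?thesis using True x q
            by (simp add: ennreal_mult[symmetric] R_def add_increasing2 ennreal_leI)
        next
          case False
          then have z: "x $ k / norm x \<le> z1" using x by (simp add: S_def)
          have "norm (tangential x (g x)) \<le> K * indicator (cball 0 4) x"
            using tangential_test_grad_le_far[OF e z1 \<beta> x z] by (simp add: g_def K_def)
          then have "norm (tangential x (g x)) powr p \<le> (K * indicator (cball 0 4) x) powr p"
            using p by (intro powr_mono2) auto
          then show ?thesis using False x p by (auto simp: indicator_def intro!: ennreal_leI split: if_splits)
        qed
      qed simp
    qed
    also have "\<dots> = ennreal q * I + ennreal (K powr p) * emeasure lborel (cball (0 :: real^'n) 4)"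
    proof -
      have m1: "(\<lambda>x. ennreal (R x) * indicator S x) \<in> borel_measurable lborel"
        by measurable
      have m2: "(\<lambda>x. ennreal q * (ennreal (R x) * indicator S x)) \<in> borel_measurable lborel"
        using m1 by measurable
      have m3: "(\<lambda>x :: real^'n. ennreal (K powr p) * indicator (cball 0 4) x) \<in> borel_measurable lborel"
        by (intro borel_measurable_times_ennreal borel_measurable_const borel_measurable_indicator) simp
      have "(\<integral>\<^sup>+x. ennreal (K powr p) * indicator (cball (0 :: real^'n) 4) x \<partial>lborel) = ennreal (K powr p) * emeasure lborel (cball (0 :: real^'n) 4)"
        by (rule nn_integral_cmult_indicator) simp
      then show ?thesis
        unfolding I_def nn_integral_add[OF m2 m3] nn_integral_cmult[OF m1] by simp
    qed
    also have "ennreal (K powr p) * emeasure lborel (cball (0 :: real^'n) 4) = ennreal K'"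
      using emeasure_lborel_cball_finite[of "0 :: real^'n" 4]
      by (subst emeasure_eq_ennreal_measure) (auto simp: K'_def ennreal_mult)
    finally show ?thesis .
  qed
  have fin: "?L < top"
  proof -
    have "?L \<le> (\<integral>\<^sup>+x. ennreal (norm (tangential x (g x)) powr p) \<partial>lborel)"
      by (intro nn_integral_mono) (auto simp: indicator_def)
    also have "\<dots> < top"
      using C1c_integrable_tangential[OF ug, of p] p unfolding integrable_iff_bounded by simp
    finally show ?thesis .
  qed
  have lower: "I \<le> (\<integral>\<^sup>+x\<in>?\<Omega>. ennreal (\<bar>u x\<bar> powr p * (zeta n p k x) powr p / norm x powr p) \<partial>lborel)" (is "_ \<le> ?Z")
    unfolding I_def
  proof (rule nn_integral_mono)
    fix x
    show "ennreal (R x) * indicator S x \<le> ennreal (\<bar>u x\<bar> powr p * (zeta n p k x) powr p / norm x powr p) * indicator ?\<Omega> x"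
    proof (cases "x \<in> S")
      case True
      then have x: "x \<in> ?\<Omega>" and z: "cos t0 < x $ k / norm x" by (auto simp: S_def z1_def)
      have "R x \<le> (\<bar>u x\<bar> * (zeta n p k x / norm x)) powr p"
        unfolding R_def using p d zeta_ge_near_axis[OF p x t0 z] cos_abs_le_1[of x k]
        by (intro powr_mono2 mult_left_mono mult_nonneg_nonneg divide_nonneg_nonneg) (auto simp: abs_square_le_1)
      also have "\<dots> = \<bar>u x\<bar> powr p * (zeta n p k x) powr p / norm x powr p"
        using zeta_le_hardy_weight(1)[OF p x] by (simp add: powr_mult powr_divide)
      finally show ?thesis using True x by (simp add: ennreal_leI)
    qed simp
  qed
  have "\<not> ennreal C * ?Z \<le> ?L"
  proof
    assume "ennreal C * ?Z \<le> ?L"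
    then have CI: "ennreal C * I \<le> ?L" using lower by (meson mult_left_mono order_trans zero_le)
    have C0: "0 < C" using q by simp
    \<comment> \<open>Finiteness is needed to subtract \<open>q * I\<close>. It is inherited from
      the gradient energy \<open>?L\<close>, finite because \<open>g\<close> is bounded with compact
      support.\<close>
    have "I \<noteq> top"
    proof
      assume "I = top"
      then have "ennreal C * I = top" using C0 by (simp add: ennreal_mult_top)
      then show False using CI fin by simp
    qed
    then obtain \<rho> where \<rho>: "0 \<le> \<rho>" "I = ennreal \<rho>" by (cases I) auto
    have "ennreal C * I \<le> ennreal q * I + ennreal K'" using CI upper by (rule order_trans)
    then have "ennreal (C * \<rho>) \<le> ennreal (q * \<rho> + K')"
      using \<rho> q C0 K' by (simp add: ennreal_mult ennreal_plus)
    then have "C * \<rho> \<le> q * \<rho> + K'" using \<rho> q K' by (subst (asm) ennreal_le_iff) auto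
    then have "(C - q) * \<rho> \<le> K'" by (simp add: algebra_simps)
    moreover have "real J * c1 \<le> \<rho>" using Ige \<rho> by (simp add: ennreal_le_iff)
    moreover have "K' < (C - q) * (real J * c1)"
      using J q c1 by (simp add: divide_less_eq mult_ac)
    ultimately show False
      using mult_left_mono[of "real J * c1" \<rho> "C - q"] q by linarith
  qed
  moreover have "W1p0 p ?\<Omega> u g" using ug p by (intro W1p0_C1c) auto
  ultimately show ?thesis by blast
qed

theorem theorem1p2:
  fixes n :: nat and p :: real and k :: "'n::finite"
  assumes "CARD('n) = n + 1" and "n \<ge> 2" and "1 < p" and "p < real n"
  shows "(\<forall>u g. W1p0 p (half_space k) u g \<longrightarrow>
           (\<integral>\<^sup>+x\<in>half_space k. ennreal (norm (tangential x (g x)) powr p) \<partial>lborel)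
             \<ge> ennreal (((real n - p) / p) powr p) *
               (\<integral>\<^sup>+x\<in>half_space k. ennreal (\<bar>u x\<bar> powr p * (zeta n p k x) powr p / norm x powr p) \<partial>lborel))
       \<and> (\<forall>C > ((real n - p) / p) powr p. \<exists>u g. W1p0 p (half_space k) u g \<and>
           \<not> ((\<integral>\<^sup>+x\<in>half_space k. ennreal (norm (tangential x (g x)) powr p) \<partial>lborel)
             \<ge> ennreal C *
               (\<integral>\<^sup>+x\<in>half_space k. ennreal (\<bar>u x\<bar> powr p * (zeta n p k x) powr p / norm x powr p) \<partial>lborel)))"
proof (intro conjI allI impI)
  fix u g assume "W1p0 p (half_space k) u g"
  then show "(\<integral>\<^sup>+x\<in>half_space k. ennreal (norm (tangential x (g x)) powr p) \<partial>lborel)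
             \<ge> ennreal (((real n - p) / p) powr p) *
               (\<integral>\<^sup>+x\<in>half_space k. ennreal (\<bar>u x\<bar> powr p * (zeta n p k x) powr p / norm x powr p) \<partial>lborel)"
    by (rule hardy_inequality_half_space[OF assms(1,3,4)])
next
  fix C assume "((real n - p) / p) powr p < C"
  then show "\<exists>u g. W1p0 p (half_space k) u g \<and>
           \<not> ((\<integral>\<^sup>+x\<in>half_space k. ennreal (norm (tangential x (g x)) powr p) \<partial>lborel)
             \<ge> ennreal C *
               (\<integral>\<^sup>+x\<in>half_space k. ennreal (\<bar>u x\<bar> powr p * (zeta n p k x) powr p / norm x powr p) \<partial>lborel))"
    using assms by (intro hardy_constant_sharp) auto
qed

end
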